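(* For every integer $k\ge1$ and every $r>0$, $$\liminf_{n\to\infty}\ \inf_{\widehat S_n\in\Sigma_n}\ v_n^{2k/(2k+1)}\sup_{S\in W_{k,r}}\mathcal R_n^*(\widehat S_n,S)\ \ge\ l_k(r),$$ where $$l_k(r)=\big((1+2k)r\big)^{1/(2k+1)}\left(\frac{k}{\pi(k+1)}\right)^{2k/(2k+1)},\qquad v_n=\frac n{\overline\sigma_n}.$$
   Context: Model. Let $\Pi$ be a fixed positive (Lévy) measure on $\mathbb R_0=\mathbb R\setminus\{0\}$ with $\int x^2\,\Pi(dx)=1$ and $\int x^6\,\Pi(dx)<\infty$ ($\Pi(\mathbb R_0)=+\infty$ is allowed). Let $(w_t)$ be a standard Brownian motion and $\mu(ds\,dx)$ a jump (Poisson random) measure independent of $w$ with deterministic compensator $\widetilde\mu(ds\,dx)=ds\,\Pi(dx)$. Put $z_t=\int_0^t\int_{\mathbb R_0}x\,(\mu-\widetilde\mu)(ds\,dx)$ and $\xi_t=\sigma_1w_t+\sigma_2z_t$ with constants $\sigma_1,\sigma_2$. One observes $(y_t)_{0\le t\le n}$ with $dy_t=S(t)\,dt+d\xi_t$, where $S:\mathbb R\to\mathbb R$ is an unknown 1-periodic function. $Q$ denotes the law of $(\xi_t)_{0\le t\le n}$ on the Skorokhod space $D[0,n]$, and $\mathcal Q_n$ is the family of all such laws with $0<\underline\sigma_n\le\sigma_1^2$ and $\sigma_1^2+\sigma_2^2\le\overline\sigma_n$, where $0<\underline\sigma_n\le\overline\sigma_n$ are given and satisfy, for every $\epsilon>0$,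 $\liminf_{n\to\infty} n^{\epsilon}\underline\sigma_n>0$ and $\lim_{n\to\infty} n^{-\epsilon}\overline\sigma_n=0$. $\mathbf E_{Q,S}$ is the expectation under the law of $y$ for noise law $Q$ and signal $S$; $\|f\|^2=\int_0^1f^2(t)\,dt$. The robust risk is $\mathcal R_n^*(\widehat S,S)=\sup_{Q\in\mathcal Q_n}\mathbf E_{Q,S}\|\widehat S-S\|^2$. $\Sigma_n$ is the set of all estimators $\widehat S_n$ of $S$ measurable with respect to $\sigma\{y_t,0\le t\le n\}$. Sobolev ball. $W_{k,r}=\{f\in C_p^k[0,1]:\sum_{j=0}^k\|f^{(j)}\|^2\le r\}$, where $C_p^k[0,1]$ is the space of $k$ times differentiable 1-periodic functions $\mathbb R\to\mathbb R$ with $f^{(i)}(0)=f^{(i)}(1)$ for $0\le i\le k-1$. *)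

theory Defs
  imports "HOL-Probability.Probability"
begin

section \<open>Driving processes\<close>

definition standard_brownian_motion :: "'w measure \<Rightarrow> (real \<Rightarrow> 'w \<Rightarrow> real) \<Rightarrow> bool" where
  "standard_brownian_motion M w \<longleftrightarrow>
     prob_space M \<and>
     (\<forall>t\<ge>0. w t \<in> borel_measurable M) \<and>
     (\<forall>\<omega>\<in>space M. w 0 \<omega> = 0 \<and> continuous_on {0..} (\<lambda>t. w t \<omega>)) \<and>
     (\<forall>s t. 0 \<le> s \<and> s < t \<longrightarrow>
        distributed M lborel (\<lambda>\<omega>. w t \<omega> - w s \<omega>) (normal_density 0 (sqrt (t - s)))) \<and>
     (\<forall>m (\<tau> :: nat \<Rightarrow> real). 0 \<le> \<tau> 0 \<and> (\<forall>i<m. \<tau> i < \<tau> (Suc i)) \<longrightarrow>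
        prob_space.indep_vars M (\<lambda>_. borel) (\<lambda>i \<omega>. w (\<tau> (Suc i)) \<omega> - w (\<tau> i) \<omega>) {..<m})"

text \<open>
  Random point measures are maps into measures on the \<sigma>-algebra of the intensity \<^term>\<open>\<nu>\<close>, with
  values in the natural numbers or \<open>\<infinity>\<close>; sets of infinite intensity carry infinitely many points.
  The Poisson probabilities are written out so that rate \<open>0\<close> is covered.
\<close>

definition poisson_random_measure ::
    "'w measure \<Rightarrow> ('w \<Rightarrow> 'e measure) \<Rightarrow> 'e measure \<Rightarrow> bool" where
  "poisson_random_measure M \<mu> \<nu> \<longleftrightarrow>
     prob_space M \<and>
     (\<forall>\<omega>\<in>space M. sets (\<mu> \<omega>) = sets \<nu> \<and>
        (\<forall>A\<in>sets \<nu>. emeasure (\<mu> \<omega>) A = \<infinity> \<or> (\<exists>j. emeasure (\<mu> \<omega>) A = of_nat j))) \<and>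
     (\<forall>A\<in>sets \<nu>. (\<lambda>\<omega>. emeasure (\<mu> \<omega>) A) \<in> borel_measurable M) \<and>
     (\<forall>A\<in>sets \<nu>. emeasure \<nu> A < \<infinity> \<longrightarrow>
        (\<forall>j. measure M {\<omega>\<in>space M. emeasure (\<mu> \<omega>) A = of_nat j}
             = exp (- measure \<nu> A) * measure \<nu> A ^ j / fact j)) \<and>
     (\<forall>A\<in>sets \<nu>. emeasure \<nu> A = \<infinity> \<longrightarrow> (AE \<omega> in M. emeasure (\<mu> \<omega>) A = \<infinity>)) \<and>
     (\<forall>m (A :: nat \<Rightarrow> 'e set). (\<forall>i<m. A i \<in> sets \<nu>) \<and> disjoint_family_on A {..<m} \<longrightarrow>
        prob_space.indep_vars M (\<lambda>_. borel) (\<lambda>i \<omega>. emeasure (\<mu> \<omega>) (A i)) {..<m})"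

definition cadlag_on :: "real set \<Rightarrow> (real \<Rightarrow> real) \<Rightarrow> bool" where
  "cadlag_on I f \<longleftrightarrow>
     (\<forall>t\<in>I. (f \<longlongrightarrow> f t) (at t within I \<inter> {t<..}) \<and>
            (\<exists>l. (f \<longlongrightarrow> l) (at t within I \<inter> {..<t})))"

text \<open>
  The jumps of size at most \<open>\<epsilon>\<close> need not be absolutely summable, so the integral of \<open>x\<close> over
  \<open>[0,t]\<close> against the compensated measure is the \<open>L\<^sup>2\<close>-limit, as \<open>\<epsilon> \<rightarrow> 0\<close>, of the
  following compensated sums of the jumps of size larger than \<open>\<epsilon>\<close>.
\<close>

definition compensated_large_jumps ::
    "real measure \<Rightarrow> (real \<times> real) measure \<Rightarrow> real \<Rightarrow> real \<Rightarrow> real" where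
  "compensated_large_jumps Levy N \<epsilon> t =
     set_lebesgue_integral N ({0..t} \<times> {x. \<epsilon> < \<bar>x\<bar>}) (\<lambda>(s, x). x)
     - t * set_lebesgue_integral Levy {x. \<epsilon> < \<bar>x\<bar>} (\<lambda>x. x)"

definition compensated_jump_process ::
    "'w measure \<Rightarrow> real measure \<Rightarrow> ('w \<Rightarrow> (real \<times> real) measure) \<Rightarrow> (real \<Rightarrow> 'w \<Rightarrow> real) \<Rightarrow> bool" where
  "compensated_jump_process M Levy \<mu> z \<longleftrightarrow>
     (\<forall>t\<ge>0. z t \<in> borel_measurable M) \<and>
     (\<forall>\<omega>\<in>space M. z 0 \<omega> = 0 \<and> cadlag_on {0..} (\<lambda>t. z t \<omega>)) \<and>
     (\<forall>t\<ge>0. ((\<lambda>\<epsilon>. \<integral>\<^sup>+\<omega>. ennreal ((z t \<omega> - compensated_large_jumps Levy (\<mu> \<omega>) \<epsilon> t)\<^sup>2) \<partial>M)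
              \<longlongrightarrow> 0) (at_right 0))"

definition jump_intensity :: "real measure \<Rightarrow> (real \<times> real) measure" where
  "jump_intensity Levy = restrict_space lborel {0..} \<Otimes>\<^sub>M Levy"

text \<open>
  The two driving processes are independent as random elements: the whole Brownian path against the
  family of all counts \<^term>\<open>emeasure (\<mu> \<omega>) A\<close>.
\<close>

locale levy_noise =
  fixes M :: "'w measure"
    and Levy :: "real measure"
    and w :: "real \<Rightarrow> 'w \<Rightarrow> real"
    and \<mu> :: "'w \<Rightarrow> (real \<times> real) measure"
    and z :: "real \<Rightarrow> 'w \<Rightarrow> real"
  assumes sets_Levy: "sets Levy = sets (restrict_space borel (- {0}))"
    and Levy_second_moment: "(\<integral>\<^sup>+x. ennreal (x ^ 2) \<partial>Levy) = 1"
    and Levy_sixth_moment: "(\<integral>\<^sup>+x. ennreal (x ^ 6) \<partial>Levy) < \<infinity>"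
    and brownian: "standard_brownian_motion M w"
    and poisson: "poisson_random_measure M \<mu> (jump_intensity Levy)"
    and indep: "prob_space.indep_set M
          (sets (vimage_algebra (space M) (\<lambda>\<omega>. \<lambda>t\<in>{0..}. w t \<omega>) (\<Pi>\<^sub>M t\<in>{0..}. borel)))
          (sets (vimage_algebra (space M)
             (\<lambda>\<omega>. \<lambda>A\<in>sets (jump_intensity Levy). emeasure (\<mu> \<omega>) A)
             (\<Pi>\<^sub>M A\<in>sets (jump_intensity Levy). borel)))"
    and jumps: "compensated_jump_process M Levy \<mu> z"

section \<open>Observations, estimators and risk\<close>

text \<open>
  The Skorokhod space \<open>D[0,T]\<close> with the \<sigma>-algebra generated by the coordinate maps, which is
  also the Borel \<sigma>-algebra of the Skorokhod topology. Paths are extensional outside \<open>[0,T]\<close>.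
\<close>

definition skorokhod :: "real \<Rightarrow> (real \<Rightarrow> real) measure" where
  "skorokhod T = restrict_space (\<Pi>\<^sub>M t\<in>{0..T}. borel) {f. cadlag_on {0..T} f}"

definition noise_law ::
    "'w measure \<Rightarrow> (real \<Rightarrow> 'w \<Rightarrow> real) \<Rightarrow> (real \<Rightarrow> 'w \<Rightarrow> real) \<Rightarrow> real \<Rightarrow> real \<Rightarrow> real
      \<Rightarrow> (real \<Rightarrow> real) measure" where
  "noise_law M w z T \<sigma>\<^sub>1 \<sigma>\<^sub>2 =
     distr M (skorokhod T) (\<lambda>\<omega>. \<lambda>t\<in>{0..T}. \<sigma>\<^sub>1 * w t \<omega> + \<sigma>\<^sub>2 * z t \<omega>)"

definition noise_family ::
    "'w measure \<Rightarrow> (real \<Rightarrow> 'w \<Rightarrow> real) \<Rightarrow> (real \<Rightarrow> 'w \<Rightarrow> real) \<Rightarrow> real \<Rightarrow> real \<Rightarrow> real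
      \<Rightarrow> (real \<Rightarrow> real) measure set" where
  "noise_family M w z lo hi T =
     {noise_law M w z T \<sigma>\<^sub>1 \<sigma>\<^sub>2 | \<sigma>\<^sub>1 \<sigma>\<^sub>2. lo \<le> \<sigma>\<^sub>1\<^sup>2 \<and> \<sigma>\<^sub>1\<^sup>2 + \<sigma>\<^sub>2\<^sup>2 \<le> hi}"

definition observation_law ::
    "real \<Rightarrow> (real \<Rightarrow> real) measure \<Rightarrow> (real \<Rightarrow> real) \<Rightarrow> (real \<Rightarrow> real) measure" where
  "observation_law T Q S =
     distr Q (skorokhod T) (\<lambda>\<xi>. \<lambda>t\<in>{0..T}. integral {0..t} S + \<xi> t)"

text \<open>
  An estimator is a functional of the observed path, hence a function of \<open>(y\<^sub>t)\<close> not depending on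
  the unknown noise law and signal. Joint measurability in path and time makes the integrated
  squared error a random variable.
\<close>

definition estimators :: "real \<Rightarrow> ((real \<Rightarrow> real) \<Rightarrow> real \<Rightarrow> real) set" where
  "estimators T =
     {Shat. case_prod Shat \<in> borel_measurable (skorokhod T \<Otimes>\<^sub>M restrict_space borel {0..1})}"

definition sq_norm :: "(real \<Rightarrow> real) \<Rightarrow> ennreal" where
  "sq_norm f = (\<integral>\<^sup>+t\<in>{0..1}. ennreal ((f t)\<^sup>2) \<partial>lborel)"

definition robust_risk ::
    "real \<Rightarrow> (real \<Rightarrow> real) measure set \<Rightarrow> ((real \<Rightarrow> real) \<Rightarrow> real \<Rightarrow> real) \<Rightarrow> (real \<Rightarrow> real)
      \<Rightarrow> ennreal" where
  "robust_risk T \<Q> Shat S =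
     (SUP Q\<in>\<Q>. \<integral>\<^sup>+y. sq_norm (\<lambda>t. Shat y t - S t) \<partial>observation_law T Q S)"

section \<open>Sobolev ball and Pinsker constant\<close>

definition periodic_diff :: "nat \<Rightarrow> (real \<Rightarrow> real) set" where
  "periodic_diff k =
     {f. (\<forall>t. f (t + 1) = f t) \<and>
         (\<forall>i<k. \<forall>t. (deriv ^^ i) f differentiable at t) \<and>
         (\<forall>i<k. (deriv ^^ i) f 0 = (deriv ^^ i) f 1)}"

definition sobolev_ball :: "nat \<Rightarrow> real \<Rightarrow> (real \<Rightarrow> real) set" where
  "sobolev_ball k r =
     {f \<in> periodic_diff k. (\<Sum>j\<le>k. sq_norm ((deriv ^^ j) f)) \<le> ennreal r}"

definition pinsker_const :: "nat \<Rightarrow> real \<Rightarrow> real" where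
  "pinsker_const k r =
     ((1 + 2 * real k) * r) powr (1 / (2 * real k + 1)) *
     (real k / (pi * (real k + 1))) powr (2 * real k / (2 * real k + 1))"

end

theory Submission
  imports Defs
begin

text \<open>
  The noise law with \<open>\<sigma>\<^sub>1\<^sup>2 = \<sigma>hi\<close> and \<open>\<sigma>\<^sub>2 = 0\<close> belongs to the family, so the robust risk dominates
  the risk in Gaussian white noise and the claim becomes Pinsker's lower bound. The signal is a
  trigonometric polynomial whose coefficients are independent centred normals with Pinsker's
  variances, at frequencies \<open>\<eta> N < m < N\<close> only. Freezing all coefficients but one, the Bayes risk of
  estimating the remaining coefficient from the whole path is at least the one for a normal mean:
  this holds for functions of finitely many increments, by conjugacy, and these are dense in \<open>L\<^sup>1\<close>,
  so neither Girsanov's theorem nor stochastic integrals are needed. Without low frequencies the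
  Sobolev ball lies in a Euclidean ball of squared radius of order \<open>N\<^sup>-\<^sup>2\<^sup>k\<close>, the order of the risk
  itself, so that Chebyshev's inequality suffices to discard the coefficients outside the Sobolev
  ball. Finally \<open>\<eta>\<close> tends to 0.
\<close>

section \<open>Gaussian regression\<close>

text \<open>At squared noise level \<open>\<epsilon>2 = \<sigma>hi n / n\<close>, a coefficient of
  prior variance \<open>s\<close> has Bayes risk \<open>\<epsilon>2 s / (s + \<epsilon>2)\<close>.
  Maximising the sum of these under a bound on the sum of \<open>m^(2k) s\<close> gives, by a
  Lagrange multiplier, \<open>s = \<epsilon>2 ((N/m)^k - 1)\<close> for \<open>m < N\<close>. The
  bound then forces \<open>\<epsilon>2 N^(2k+1)\<close> to be of constant order, and the risk, about
  \<open>\<epsilon>2 N\<close>, is of order \<open>N^(-2k)\<close>.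

  The obstacle is the unbounded support of the prior. The weighted sum of squares has variance of
  order \<open>1/N\<close>, and the loss outside the ellipsoid is measured in units of
  \<open>r/\<alpha>\<close>, where \<open>\<alpha>\<close> is the least Sobolev weight in use. With
  \<open>\<alpha>\<close> of order \<open>N^(2k)\<close> the tail has order
  \<open>N^(-2k-1)\<close>, one power below the risk; with frequencies of order 1 it would have
  order \<open>1/N\<close> and swamp the risk.

  Truncating the estimated coefficients serves twice: it controls the loss outside the ellipsoid,
  and it lets approximation in L1 control squared errors.\<close>

abbreviation gaussian :: "real \<Rightarrow> real \<Rightarrow> real measure" where
  "gaussian m s \<equiv> density lborel (\<lambda>x. ennreal (normal_density m s x))"

lemma sets_PiM_gaussian [measurable_cong]:
  "sets (Pi\<^sub>M I (\<lambda>i. gaussian (m i) (s i))) = sets (Pi\<^sub>M I (\<lambda>_. borel))"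
  by (intro sets_PiM_cong) auto

lemma nn_integral_normal_density:
  assumes "s > 0"
  shows "(\<integral>\<^sup>+x. ennreal (normal_density m s x) \<partial>lborel) = 1"
  using assms by (subst nn_integral_eq_integral) auto

text \<open>All \<open>s\<close> are covered because \<open>product_sigma_finite\<close> asks for
  this at every index of the type, whereas positive deviations may be known only on the finite index
  set.\<close>

lemma sigma_finite_gaussian: "sigma_finite_measure (gaussian m s)"
proof (cases "s > 0")
  case True
  then interpret prob_space "gaussian m s" by (rule prob_space_normal_density)
  show ?thesis by unfold_locales
next
  case False
  have "AE x in lborel. ennreal (normal_density m s x) \<noteq> \<infinity>" by simp
  then show ?thesis
    by (subst sigma_finite_measure.sigma_finite_iff_density_finite[OF lborel.sigma_finite_measure_axioms])
      auto
qed

text \<open>Bayes' rule for a normal prior and a normal observation: prior times likelihood equals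
  the marginal density of \<open>y\<close> times the posterior density of \<open>x\<close>.\<close>

lemma normal_density_conjugate:
  assumes s: "s > 0" and t: "t > 0"
  shows "normal_density m s x * normal_density (a * x) t y =
    normal_density (a * m) (sqrt (t\<^sup>2 + a\<^sup>2 * s\<^sup>2)) y *
    normal_density (m + s\<^sup>2 * a * (y - a * m) / (t\<^sup>2 + a\<^sup>2 * s\<^sup>2)) (sqrt (s\<^sup>2 * t\<^sup>2 / (t\<^sup>2 + a\<^sup>2 * s\<^sup>2))) x"
proof -
  define D where "D = t\<^sup>2 + a\<^sup>2 * s\<^sup>2"
  have D: "D > 0" using t by (simp add: D_def add_pos_nonneg)
  have st: "s\<^sup>2 > 0" "t\<^sup>2 > 0" using s t by auto
  \<comment> \<open>The square is completed in \<open>x\<close>; \<open>c\<close> below matches the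
    normalising constants.\<close>
  have e: "(x - m)\<^sup>2 / (2 * s\<^sup>2) + (y - a * x)\<^sup>2 / (2 * t\<^sup>2) =
    (y - a * m)\<^sup>2 / (2 * D) + (x - (m + s\<^sup>2 * a * (y - a * m) / D))\<^sup>2 / (2 * (s\<^sup>2 * t\<^sup>2 / D))"
  proof -
    have q: "(p / D)\<^sup>2 / (2 * (u / D)) = p\<^sup>2 / (2 * u * D)" for p u :: real
      using D by (simp add: power2_eq_square)
    have "x - (m + s\<^sup>2 * a * (y - a * m) / D) = ((x - m) * D - s\<^sup>2 * a * (y - a * m)) / D"
      using D by (simp add: field_simps)
    then have "(x - (m + s\<^sup>2 * a * (y - a * m) / D))\<^sup>2 / (2 * (s\<^sup>2 * t\<^sup>2 / D)) =
      ((x - m) * D - s\<^sup>2 * a * (y - a * m))\<^sup>2 / (2 * s\<^sup>2 * t\<^sup>2 * D)"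
      by (simp only: q mult.assoc)
    moreover have "((x - m)\<^sup>2 * t\<^sup>2 + (y - a * x)\<^sup>2 * s\<^sup>2) * D =
       (y - a * m)\<^sup>2 * (s\<^sup>2 * t\<^sup>2) + ((x - m) * D - s\<^sup>2 * a * (y - a * m))\<^sup>2"
      unfolding D_def by (simp add: power2_eq_square algebra_simps)
    moreover have "(x - m)\<^sup>2 / (2 * s\<^sup>2) + (y - a * x)\<^sup>2 / (2 * t\<^sup>2) =
       ((x - m)\<^sup>2 * t\<^sup>2 + (y - a * x)\<^sup>2 * s\<^sup>2) * D / (2 * s\<^sup>2 * t\<^sup>2 * D)"
      using D s t by (simp add: divide_simps)
    moreover have "(y - a * m)\<^sup>2 / (2 * D) = (y - a * m)\<^sup>2 * (s\<^sup>2 * t\<^sup>2) / (2 * s\<^sup>2 * t\<^sup>2 * D)"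
      using D s t by (simp add: divide_simps)
    ultimately show ?thesis by (simp add: add_divide_distrib)
  qed
  have c: "sqrt (2 * pi * s\<^sup>2) * sqrt (2 * pi * t\<^sup>2) = sqrt (2 * pi * D) * sqrt (2 * pi * (s\<^sup>2 * t\<^sup>2 / D))"
    using D by (simp add: real_sqrt_mult[symmetric] mult_ac)
  have sq: "(sqrt (s\<^sup>2 * t\<^sup>2 / D))\<^sup>2 = s\<^sup>2 * t\<^sup>2 / D" "(sqrt D)\<^sup>2 = D"
    using D by auto
  have "normal_density m s x * normal_density (a * x) t y =
    exp (- ((x - m)\<^sup>2 / (2 * s\<^sup>2) + (y - a * x)\<^sup>2 / (2 * t\<^sup>2))) / (sqrt (2 * pi * s\<^sup>2) * sqrt (2 * pi * t\<^sup>2))"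
    by (simp add: normal_density_def exp_add[symmetric] exp_minus_inverse mult_exp_exp)
  also have "\<dots> = normal_density (a * m) (sqrt D) y *
    normal_density (m + s\<^sup>2 * a * (y - a * m) / D) (sqrt (s\<^sup>2 * t\<^sup>2 / D)) x"
    unfolding e c normal_density_def sq by (simp add: mult_exp_exp)
  finally show ?thesis by (simp add: D_def)
qed

lemma gaussian_second_moment:
  assumes "s > 0"
  shows "(\<integral>\<^sup>+x. ennreal ((c - x)\<^sup>2) \<partial>gaussian m s) = ennreal (s\<^sup>2 + (c - m)\<^sup>2)"
proof -
  have 2: "has_bochner_integral lborel (\<lambda>x. normal_density m s x * (x - m)\<^sup>2) (s\<^sup>2)"
    using normal_moment_even[OF assms, of m 1] by (simp add: field_simps power2_eq_square)
  have 1: "has_bochner_integral lborel (\<lambda>x. normal_density m s x * (x - m)) 0"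
    using normal_moment_odd[OF assms, of m 0] by simp
  have 0: "has_bochner_integral lborel (normal_density m s) 1"
    using assms by (simp add: has_bochner_integral_iff)
  have "has_bochner_integral lborel (\<lambda>x. normal_density m s x * (x - m)\<^sup>2 -
      2 * (c - m) * (normal_density m s x * (x - m)) + (c - m)\<^sup>2 * normal_density m s x)
      (s\<^sup>2 - 2 * (c - m) * 0 + (c - m)\<^sup>2 * 1)"
    by (intro has_bochner_integral_add has_bochner_integral_diff has_bochner_integral_mult_right 0 1 2)
  also have "(\<lambda>x. normal_density m s x * (x - m)\<^sup>2 -
      2 * (c - m) * (normal_density m s x * (x - m)) + (c - m)\<^sup>2 * normal_density m s x) =
      (\<lambda>x. normal_density m s x * (c - x)\<^sup>2)"
    by (simp add: fun_eq_iff power2_eq_square algebra_simps)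
  finally have "(\<integral>\<^sup>+x. ennreal (normal_density m s x * (c - x)\<^sup>2) \<partial>lborel) = ennreal (s\<^sup>2 + (c - m)\<^sup>2)"
    by (subst nn_integral_eq_integral) (auto simp: has_bochner_integral_iff)
  then show ?thesis
    by (simp add: nn_integral_density ennreal_mult)
qed

text \<open>Turns additive noise into a likelihood, the form to which
  \<open>normal_density_conjugate\<close> applies.\<close>

lemma gaussian_shift_nn_integral:
  assumes [measurable]: "H \<in> borel_measurable borel"
  shows "(\<integral>\<^sup>+y. H (b + y) \<partial>gaussian 0 t) = (\<integral>\<^sup>+y. ennreal (normal_density b t y) * H y \<partial>lborel)"
proof -
  have "(\<integral>\<^sup>+y. ennreal (normal_density b t y) * H y \<partial>lborel) =
      (\<integral>\<^sup>+y. ennreal (normal_density b t y) * H y \<partial>distr lborel borel ((+) b))"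
    by (simp only: lborel_distr_plus)
  also have "\<dots> = (\<integral>\<^sup>+y. ennreal (normal_density b t (b + y)) * H (b + y) \<partial>lborel)"
    by (subst nn_integral_distr) auto
  also have "\<dots> = (\<integral>\<^sup>+y. ennreal (normal_density 0 t y) * H (b + y) \<partial>lborel)"
    by (simp add: normal_density_def)
  finally show ?thesis by (simp add: nn_integral_density)
qed

text \<open>
  Integrating out one observation at a time replaces the prior by the posterior, which is again
  normal with precision increased by \<open>a\<^sub>i\<^sup>2 / t\<^sub>i\<^sup>2\<close>.
\<close>

lemma gaussian_regression_bayes_risk:
  fixes G :: "('i \<Rightarrow> real) \<Rightarrow> real" and a t :: "'i \<Rightarrow> real"
  assumes "finite I" and "s > 0" and "\<And>i. i \<in> I \<Longrightarrow> t i > 0"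
    and "G \<in> borel_measurable (Pi\<^sub>M I (\<lambda>_. borel))"
  shows "(\<integral>\<^sup>+x. \<integral>\<^sup>+u. ennreal ((G (\<lambda>i\<in>I. a i * x + u i) - x)\<^sup>2) \<partial>Pi\<^sub>M I (\<lambda>i. gaussian 0 (t i)) \<partial>gaussian m s)
     \<ge> ennreal (1 / (1 / s\<^sup>2 + (\<Sum>i\<in>I. (a i)\<^sup>2 / (t i)\<^sup>2)))"
  using assms
proof (induction I arbitrary: G m s rule: finite_induct)
  case empty
  interpret product_sigma_finite "\<lambda>i. gaussian 0 (t i)"
    by (simp add: product_sigma_finite_def sigma_finite_gaussian)
  interpret P: prob_space "Pi\<^sub>M {} (\<lambda>i. gaussian 0 (t i))"
    by (rule prob_spaceI) (simp add: space_PiM emeasure_PiM_empty)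
  \<comment> \<open>Without observations the estimator always sees the same argument, so it is a
    constant, and its risk is at least the prior variance.\<close>
  have "(\<lambda>i\<in>{}. a i * x + u i) = (\<lambda>_. undefined)" for x u
    by (simp add: restrict_def)
  then have "(\<integral>\<^sup>+u. ennreal ((G (\<lambda>i\<in>{}. a i * x + u i) - x)\<^sup>2) \<partial>Pi\<^sub>M {} (\<lambda>i. gaussian 0 (t i)))
    = ennreal ((G (\<lambda>_. undefined) - x)\<^sup>2)" for x
    by (simp add: P.emeasure_space_1)
  then show ?case
    using gaussian_second_moment[OF \<open>s > 0\<close>, where c="G (\<lambda>_. undefined)" and m=m]
    by (simp only:) (simp add: ennreal_leI del: ennreal_plus)
next
  case (insert i I)
  note [measurable] = insert.prems(3)
  have fin [simp]: "finite I" by fact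
  interpret P: product_sigma_finite "\<lambda>i. gaussian 0 (t i)"
    by (simp add: product_sigma_finite_def sigma_finite_gaussian)
  interpret Q: finite_product_sigma_finite "\<lambda>i. gaussian 0 (t i)" I
    by unfold_locales fact
  have ti: "t i > 0" and s: "s > 0" using insert.prems by auto
  let ?P = "Pi\<^sub>M I (\<lambda>i. gaussian 0 (t i))"
  define D where "D = (t i)\<^sup>2 + (a i)\<^sup>2 * s\<^sup>2"
  have D: "D > 0" using ti by (simp add: D_def add_pos_nonneg)
  \<comment> \<open>\<open>m' z\<close> and \<open>s'\<close> are the posterior mean and deviation
    after coordinate \<open>i\<close> is observed as \<open>z\<close>; \<open>H x z\<close> is the
    risk at \<open>x\<close> given this observation, averaged over the other noises.\<close>
  define s' where "s' = sqrt (s\<^sup>2 * (t i)\<^sup>2 / D)"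
  have s': "s' > 0" using s ti D by (simp add: s'_def)
  define m' where "m' = (\<lambda>z. m + s\<^sup>2 * a i * (z - a i * m) / D)"
  define H where "H = (\<lambda>x z. \<integral>\<^sup>+u. ennreal ((G ((\<lambda>j\<in>I. a j * x + u j)(i := z)) - x)\<^sup>2) \<partial>?P)"
  define v where "v = 1 / (1 / s'\<^sup>2 + (\<Sum>i\<in>I. (a i)\<^sup>2 / (t i)\<^sup>2))"
  have upd [measurable]: "(\<lambda>p. (\<lambda>j\<in>I. a j * f p + g p j)(i := h p)) \<in> measurable N (Pi\<^sub>M (insert i I) (\<lambda>_. borel))"
    if [measurable]: "f \<in> borel_measurable N" "g \<in> measurable N (Pi\<^sub>M I (\<lambda>_. borel))" "h \<in> borel_measurable N"
    for f g h and N :: "'x measure"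
  proof (rule measurable_fun_upd[where J=I])
    show "(\<lambda>p. \<lambda>j\<in>I. a j * f p + g p j) \<in> measurable N (Pi\<^sub>M I (\<lambda>_. borel))"
      by (rule measurable_restrict) measurable
  qed (use that in auto)
  have Hm [measurable]: "case_prod H \<in> borel_measurable (borel \<Otimes>\<^sub>M borel)"
    unfolding H_def by measurable
  have Hz: "(\<integral>\<^sup>+x. H x z \<partial>gaussian (m' z) s') \<ge> ennreal v" for z
  proof -
    have [measurable]: "(\<lambda>x. x(i := z)) \<in> measurable (Pi\<^sub>M I (\<lambda>_. borel)) (Pi\<^sub>M (insert i I) (\<lambda>_. borel))"
      by (rule measurable_fun_upd[where J=I]) auto
    show ?thesis
      unfolding H_def v_def
      by (rule insert.IH[where G="\<lambda>x. G (x(i := z))"]) (use s' insert.prems in auto)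
  qed
  have "(\<integral>\<^sup>+u. ennreal ((G (\<lambda>j\<in>insert i I. a j * x + u j) - x)\<^sup>2) \<partial>Pi\<^sub>M (insert i I) (\<lambda>i. gaussian 0 (t i))) =
     (\<integral>\<^sup>+y. H x (a i * x + y) \<partial>gaussian 0 (t i))" for x
  proof -
    have "(\<integral>\<^sup>+u. ennreal ((G (\<lambda>j\<in>insert i I. a j * x + u j) - x)\<^sup>2) \<partial>Pi\<^sub>M (insert i I) (\<lambda>i. gaussian 0 (t i)))
      = (\<integral>\<^sup>+y. \<integral>\<^sup>+u. ennreal ((G (\<lambda>j\<in>insert i I. a j * x + (u(i := y)) j) - x)\<^sup>2) \<partial>?P \<partial>gaussian 0 (t i))"
      using insert.hyps by (subst P.product_nn_integral_insert_rev) auto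
    moreover have "(\<lambda>j\<in>insert i I. a j * x + (u(i := y)) j) = (\<lambda>j\<in>I. a j * x + u j)(i := a i * x + y)" for u y
      using insert.hyps by (auto simp: fun_eq_iff)
    ultimately show ?thesis by (simp add: H_def)
  qed
  moreover have "(\<integral>\<^sup>+y. H x (a i * x + y) \<partial>gaussian 0 (t i)) =
     (\<integral>\<^sup>+z. ennreal (normal_density (a i * x) (t i) z) * H x z \<partial>lborel)" for x
    by (rule gaussian_shift_nn_integral) measurable
  ultimately have "(\<integral>\<^sup>+x. \<integral>\<^sup>+u. ennreal ((G (\<lambda>j\<in>insert i I. a j * x + u j) - x)\<^sup>2) \<partial>Pi\<^sub>M (insert i I) (\<lambda>i. gaussian 0 (t i)) \<partial>gaussian m s)
     = (\<integral>\<^sup>+x. \<integral>\<^sup>+z. ennreal (normal_density (a i * x) (t i) z) * H x z \<partial>lborel \<partial>gaussian m s)"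
    by simp
  also have "\<dots> = (\<integral>\<^sup>+x. \<integral>\<^sup>+z. ennreal (normal_density m s x) * (ennreal (normal_density (a i * x) (t i) z) * H x z) \<partial>lborel \<partial>lborel)"
    by (subst nn_integral_density) (auto simp: normal_density_def nn_integral_cmult)
  \<comment> \<open>With the observation \<open>z\<close> as outer variable, the induction
    hypothesis applies for each \<open>z\<close> with the posterior as new prior; its lower bound is
    the same for all \<open>z\<close>.\<close>
  also have "\<dots> = (\<integral>\<^sup>+z. \<integral>\<^sup>+x. ennreal (normal_density m s x) * (ennreal (normal_density (a i * x) (t i) z) * H x z) \<partial>lborel \<partial>lborel)"
    by (rule lborel_pair.Fubini') (simp add: normal_density_def)
  also have "\<dots> = (\<integral>\<^sup>+z. \<integral>\<^sup>+x. ennreal (normal_density (a i * m) (sqrt D) z) * (ennreal (normal_density (m' z) s' x) * H x z) \<partial>lborel \<partial>lborel)"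
    by (simp add: mult.assoc[symmetric] ennreal_mult[symmetric] normal_density_conjugate[OF s ti] D_def m'_def s'_def)
  also have "\<dots> = (\<integral>\<^sup>+z. ennreal (normal_density (a i * m) (sqrt D) z) * (\<integral>\<^sup>+x. H x z \<partial>gaussian (m' z) s') \<partial>lborel)"
    by (simp add: nn_integral_cmult nn_integral_density)
  also have "\<dots> \<ge> (\<integral>\<^sup>+z. ennreal (normal_density (a i * m) (sqrt D) z) * ennreal v \<partial>lborel)"
    by (intro nn_integral_mono mult_left_mono Hz) auto
  also have "(\<integral>\<^sup>+z. ennreal (normal_density (a i * m) (sqrt D) z) * ennreal v \<partial>lborel) = ennreal v"
    using nn_integral_normal_density[of "sqrt D" "a i * m"] D by (simp add: nn_integral_multc)
  also have "v = 1 / (1 / s\<^sup>2 + (\<Sum>i\<in>insert i I. (a i)\<^sup>2 / (t i)\<^sup>2))"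
  proof -
    have "s'\<^sup>2 = s\<^sup>2 * (t i)\<^sup>2 / D" using D by (simp add: s'_def)
    then have "1 / s'\<^sup>2 = D / (s\<^sup>2 * (t i)\<^sup>2)"
      by simp
    also have "\<dots> = 1 / s\<^sup>2 + (a i)\<^sup>2 / (t i)\<^sup>2"
      using s ti by (simp add: D_def field_simps)
    finally have "1 / s'\<^sup>2 = 1 / s\<^sup>2 + (a i)\<^sup>2 / (t i)\<^sup>2" .
    then show ?thesis using insert.hyps by (simp add: v_def add.assoc)
  qed
  finally show ?case .
qed

section \<open>Approximation by cylinder functions\<close>

text \<open>Distance in L1 is enough, since \<open>brownian_bayes_risk\<close> clips the approximant
  and thereby turns L1 closeness into L2 closeness.\<close>

definition cylinder_approximable :: "('i \<Rightarrow> real) measure \<Rightarrow> 'i set \<Rightarrow> (('i \<Rightarrow> real) \<Rightarrow> real) \<Rightarrow> bool" where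
  "cylinder_approximable N I F \<longleftrightarrow> F \<in> borel_measurable N \<and>
     (\<forall>e>0. \<exists>J G. finite J \<and> J \<subseteq> I \<and> G \<in> borel_measurable (Pi\<^sub>M J (\<lambda>_. borel)) \<and>
        (\<integral>\<^sup>+x. ennreal \<bar>F x - G (restrict x J)\<bar> \<partial>N) < ennreal e)"

text \<open>The Skorokhod space carries the trace of a product sigma-algebra on the cadlag paths. As
  that set need not belong to the uncountable product sigma-algebra, \<open>\<Omega>\<close> is an
  arbitrary set.\<close>

context
  fixes N :: "('i \<Rightarrow> real) measure" and I :: "'i set" and \<Omega> :: "('i \<Rightarrow> real) set"
  assumes sets_N [measurable_cong]: "sets N = sets (restrict_space (Pi\<^sub>M I (\<lambda>_. borel)) \<Omega>)"
begin

lemma measurable_restrict_coordinates: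
  "J \<subseteq> I \<Longrightarrow> (\<lambda>x. restrict x J) \<in> measurable N (Pi\<^sub>M J (\<lambda>_. borel :: real measure))"
  unfolding measurable_cong_sets[OF sets_N refl]
  by (intro measurable_restrict_space1 measurable_restrict_subset)

lemma cylinder_approximable_cylinder:
  assumes "finite J" "J \<subseteq> I" and G: "G \<in> borel_measurable (Pi\<^sub>M J (\<lambda>_. borel))"
  shows "cylinder_approximable N I (\<lambda>x. G (restrict x J))"
  unfolding cylinder_approximable_def
proof (intro conjI allI impI)
  show "(\<lambda>x. G (restrict x J)) \<in> borel_measurable N"
    by (rule measurable_compose[OF measurable_restrict_coordinates G]) fact
  show "\<exists>J' G'. finite J' \<and> J' \<subseteq> I \<and> G' \<in> borel_measurable (Pi\<^sub>M J' (\<lambda>_. borel)) \<and>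
      (\<integral>\<^sup>+x. ennreal \<bar>G (restrict x J) - G' (restrict x J')\<bar> \<partial>N) < ennreal e" if "e > 0" for e :: real
    using assms that by (intro exI[of _ J] exI[of _ G]) auto
qed

text \<open>A single closure property that yields complements (\<open>1 - a\<close>), unions (a
  maximum), scalar multiples and sums.\<close>

lemma cylinder_approximable_lipschitz:
  assumes 1: "cylinder_approximable N I F1" and 2: "cylinder_approximable N I F2"
    and h [measurable]: "case_prod h \<in> borel_measurable (borel \<Otimes>\<^sub>M borel)"
    and lip: "\<And>a b c d :: real. \<bar>h a b - h c d\<bar> \<le> K * \<bar>a - c\<bar> + K * \<bar>b - d\<bar>"
  shows "cylinder_approximable N I (\<lambda>x. h (F1 x) (F2 x))"
proof -
  have [measurable]: "F1 \<in> borel_measurable N" "F2 \<in> borel_measurable N"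
    using 1 2 by (auto simp: cylinder_approximable_def)
  show ?thesis
    unfolding cylinder_approximable_def
  proof (intro conjI allI impI)
    fix e :: real assume "e > 0"
    \<comment> \<open>Each of the two approximations contributes at most
      \<open>\<bar>K\<bar> * d\<close>; the added 1 covers \<open>K = 0\<close>.\<close>
    define d where "d = e / (2 * (\<bar>K\<bar> + 1))"
    have d: "d > 0" "2 * \<bar>K\<bar> * d < e" using \<open>e > 0\<close> by (auto simp: d_def field_simps)
    obtain J1 G1 where J1 [simp]: "finite J1" "J1 \<subseteq> I" and [measurable]: "G1 \<in> borel_measurable (Pi\<^sub>M J1 (\<lambda>_. borel))"
      and a1: "(\<integral>\<^sup>+x. ennreal \<bar>F1 x - G1 (restrict x J1)\<bar> \<partial>N) < ennreal d"
      using 1 d unfolding cylinder_approximable_def by blast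
    obtain J2 G2 where J2 [simp]: "finite J2" "J2 \<subseteq> I" and [measurable]: "G2 \<in> borel_measurable (Pi\<^sub>M J2 (\<lambda>_. borel))"
      and a2: "(\<integral>\<^sup>+x. ennreal \<bar>F2 x - G2 (restrict x J2)\<bar> \<partial>N) < ennreal d"
      using 2 d unfolding cylinder_approximable_def by blast
    note [measurable] = measurable_restrict_coordinates[OF J1(2)] measurable_restrict_coordinates[OF J2(2)]
    have [measurable]: "(\<lambda>x. restrict x J1) \<in> measurable (Pi\<^sub>M (J1 \<union> J2) (\<lambda>_. borel)) (Pi\<^sub>M J1 (\<lambda>_. borel :: real measure))"
      "(\<lambda>x. restrict x J2) \<in> measurable (Pi\<^sub>M (J1 \<union> J2) (\<lambda>_. borel)) (Pi\<^sub>M J2 (\<lambda>_. borel :: real measure))"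
      by (simp_all add: measurable_restrict_subset)
    let ?G = "\<lambda>x. h (G1 (restrict x J1)) (G2 (restrict x J2))"
    have "(\<integral>\<^sup>+x. ennreal \<bar>h (F1 x) (F2 x) - ?G (restrict x (J1 \<union> J2))\<bar> \<partial>N)
      \<le> (\<integral>\<^sup>+x. ennreal \<bar>K\<bar> * ennreal \<bar>F1 x - G1 (restrict x J1)\<bar> + ennreal \<bar>K\<bar> * ennreal \<bar>F2 x - G2 (restrict x J2)\<bar> \<partial>N)"
    proof (rule nn_integral_mono)
      fix x
      have "(J1 \<union> J2) \<inter> J1 = J1" "(J1 \<union> J2) \<inter> J2 = J2" by auto
      then have "\<bar>h (F1 x) (F2 x) - ?G (restrict x (J1 \<union> J2))\<bar> \<le> K * \<bar>F1 x - G1 (restrict x J1)\<bar> + K * \<bar>F2 x - G2 (restrict x J2)\<bar>"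
        using lip by simp
      also have "\<dots> \<le> \<bar>K\<bar> * \<bar>F1 x - G1 (restrict x J1)\<bar> + \<bar>K\<bar> * \<bar>F2 x - G2 (restrict x J2)\<bar>"
        by (intro add_mono mult_right_mono) auto
      finally show "ennreal \<bar>h (F1 x) (F2 x) - ?G (restrict x (J1 \<union> J2))\<bar> \<le>
        ennreal \<bar>K\<bar> * ennreal \<bar>F1 x - G1 (restrict x J1)\<bar> + ennreal \<bar>K\<bar> * ennreal \<bar>F2 x - G2 (restrict x J2)\<bar>"
        by (simp add: ennreal_leI flip: ennreal_mult ennreal_plus)
    qed
    also have "\<dots> = ennreal \<bar>K\<bar> * (\<integral>\<^sup>+x. ennreal \<bar>F1 x - G1 (restrict x J1)\<bar> \<partial>N) +
        ennreal \<bar>K\<bar> * (\<integral>\<^sup>+x. ennreal \<bar>F2 x - G2 (restrict x J2)\<bar> \<partial>N)"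
      by (simp add: nn_integral_add nn_integral_cmult)
    also have "\<dots> \<le> ennreal \<bar>K\<bar> * ennreal d + ennreal \<bar>K\<bar> * ennreal d"
      using a1 a2 by (intro add_mono mult_left_mono) auto
    also have "\<dots> = ennreal (2 * \<bar>K\<bar> * d)"
      using d by (simp flip: ennreal_mult ennreal_plus)
    also have "\<dots> < ennreal e" using d \<open>e > 0\<close> by (simp add: ennreal_lessI)
    finally show "\<exists>J G. finite J \<and> J \<subseteq> I \<and> G \<in> borel_measurable (Pi\<^sub>M J (\<lambda>_. borel)) \<and>
        (\<integral>\<^sup>+x. ennreal \<bar>h (F1 x) (F2 x) - G (restrict x J)\<bar> \<partial>N) < ennreal e"
      by (intro exI[of _ "J1 \<union> J2"] exI[of _ ?G] conjI) (simp_all del: restrict_restrict)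
  qed measurable
qed

lemma cylinder_approximable_cong:
  assumes F: "cylinder_approximable N I F" and F' [measurable]: "F' \<in> borel_measurable N"
    and eq: "\<And>x. x \<in> space N \<Longrightarrow> F' x = F x"
  shows "cylinder_approximable N I F'"
proof -
  have "(\<integral>\<^sup>+x. ennreal \<bar>F' x - G (restrict x J)\<bar> \<partial>N) = (\<integral>\<^sup>+x. ennreal \<bar>F x - G (restrict x J)\<bar> \<partial>N)"
    for G J
    using eq by (intro nn_integral_cong) simp
  with F F' show ?thesis by (simp add: cylinder_approximable_def)
qed

lemma cylinder_approximable_limit:
  assumes F [measurable]: "F \<in> borel_measurable N"
    and U: "\<And>n. cylinder_approximable N I (U n)"
    and lim: "(\<lambda>n. \<integral>\<^sup>+x. ennreal \<bar>F x - U n x\<bar> \<partial>N) \<longlonglongrightarrow> 0"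
  shows "cylinder_approximable N I F"
  unfolding cylinder_approximable_def
proof (intro conjI allI impI)
  fix e :: real assume "e > 0"
  then have "eventually (\<lambda>n. (\<integral>\<^sup>+x. ennreal \<bar>F x - U n x\<bar> \<partial>N) < ennreal (e/2)) sequentially"
    by (intro order_tendstoD[OF lim]) auto
  then obtain n where n: "(\<integral>\<^sup>+x. ennreal \<bar>F x - U n x\<bar> \<partial>N) < ennreal (e/2)"
    by (auto simp: eventually_sequentially)
  obtain J G where J: "finite J" "J \<subseteq> I" and G [measurable]: "G \<in> borel_measurable (Pi\<^sub>M J (\<lambda>_. borel))"
    and a: "(\<integral>\<^sup>+x. ennreal \<bar>U n x - G (restrict x J)\<bar> \<partial>N) < ennreal (e/2)"
    using U[of n] half_gt_zero[OF \<open>e > 0\<close>] unfolding cylinder_approximable_def by blast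
  have [measurable]: "U n \<in> borel_measurable N"
    using U by (auto simp: cylinder_approximable_def)
  note [measurable] = measurable_restrict_coordinates[OF J(2)]
  have "(\<integral>\<^sup>+x. ennreal \<bar>F x - G (restrict x J)\<bar> \<partial>N)
     \<le> (\<integral>\<^sup>+x. ennreal \<bar>F x - U n x\<bar> + ennreal \<bar>U n x - G (restrict x J)\<bar> \<partial>N)"
    by (intro nn_integral_mono) (auto simp flip: ennreal_plus intro!: ennreal_leI)
  also have "\<dots> = (\<integral>\<^sup>+x. ennreal \<bar>F x - U n x\<bar> \<partial>N) + (\<integral>\<^sup>+x. ennreal \<bar>U n x - G (restrict x J)\<bar> \<partial>N)"
    by (rule nn_integral_add) measurable
  also have "\<dots> < ennreal (e/2) + ennreal (e/2)"
    using n a by (rule add_strict_mono)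
  also have "\<dots> = ennreal e" using \<open>e > 0\<close> by (simp flip: ennreal_plus)
  finally show "\<exists>J G. finite J \<and> J \<subseteq> I \<and> G \<in> borel_measurable (Pi\<^sub>M J (\<lambda>_. borel)) \<and>
        (\<integral>\<^sup>+x. ennreal \<bar>F x - G (restrict x J)\<bar> \<partial>N) < ennreal e"
    using J G by blast
qed fact

context
  assumes fin: "finite_measure N"
begin

interpretation finite_measure N by (rule fin)

lemma space_N: "space N = \<Omega> \<inter> (\<Pi>\<^sub>E i\<in>I. UNIV)"
  using sets_eq_imp_space_eq[OF sets_N] by (simp add: space_restrict_space space_PiM Int_commute)

lemma indicator_measurable_N:
  "A \<in> sets (Pi\<^sub>M I (\<lambda>_. borel)) \<Longrightarrow> (indicator A :: _ \<Rightarrow> real) \<in> borel_measurable N"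
  unfolding measurable_cong_sets[OF sets_N refl]
  by (intro measurable_restrict_space1 borel_measurable_indicator)

text \<open>Induction over the sigma-algebra generated by conditions on one coordinate. A countable
  union is the L1-limit of its finite subunions; the constant 1 is an integrable bound as
  \<open>N\<close> is finite.\<close>

lemma cylinder_approximable_indicator:
  assumes "A \<in> sets (Pi\<^sub>M I (\<lambda>_. borel))"
  shows "cylinder_approximable N I (indicator A)"
  using assms unfolding sets_PiM_single
proof (induction rule: sigma_sets.induct)
  case (Basic A)
  then obtain i X where i: "i \<in> I" and X [measurable]: "X \<in> sets borel"
    and A: "A = {f \<in> \<Pi>\<^sub>E i\<in>I. space borel. f i \<in> X}" by auto
  have "A \<in> sets (Pi\<^sub>M I (\<lambda>_. borel))" unfolding sets_PiM_single using Basic by auto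
  moreover have "cylinder_approximable N I (\<lambda>x. indicator X (restrict x {i} i))"
    using i by (intro cylinder_approximable_cylinder) auto
  ultimately show ?case
    by (intro cylinder_approximable_cong[OF _ indicator_measurable_N]) (auto simp: A space_N indicator_def)
next
  case Empty
  have "cylinder_approximable N I (\<lambda>x. 0)"
    using cylinder_approximable_cylinder[of "{}" "\<lambda>_. 0"] by simp
  then show ?case by (simp add: indicator_def[abs_def])
next
  case (Compl A)
  have A: "A \<in> sets (Pi\<^sub>M I (\<lambda>_. borel))" unfolding sets_PiM_single by (rule Compl)
  have 1: "(\<Pi>\<^sub>E i\<in>I. space borel) - A \<in> sets (Pi\<^sub>M I (\<lambda>_. borel))"
    using A sets.compl_sets[OF A] by (simp add: space_PiM)
  have 2: "cylinder_approximable N I (\<lambda>x. 1 - indicator A x)"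
    by (rule cylinder_approximable_lipschitz[OF Compl.IH Compl.IH, where h="\<lambda>a b. 1 - a" and K=1]) auto
  \<comment> \<open>The indicator of the complement agrees with \<open>1 - indicator A\<close> only
    on extensional functions, hence only on the space of \<open>N\<close>.\<close>
  show ?case
    by (rule cylinder_approximable_cong[OF 2 indicator_measurable_N[OF 1]]) (auto simp: space_N indicator_def)
next
  case (Union A)
  have A: "A n \<in> sets (Pi\<^sub>M I (\<lambda>_. borel))" for n
    unfolding sets_PiM_single by (rule Union)
  have mU [measurable]: "(indicator (\<Union>i. A i) :: _ \<Rightarrow> real) \<in> borel_measurable N"
      "(indicator (\<Union>i<n. A i) :: _ \<Rightarrow> real) \<in> borel_measurable N" for n
    using A by (auto intro!: indicator_measurable_N sets.countable_UN sets.finite_UN)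
  have U: "cylinder_approximable N I (indicator (\<Union>i<n. A i))" for n
  proof (induction n)
    case 0
    have "cylinder_approximable N I (\<lambda>x. 0)"
      using cylinder_approximable_cylinder[of "{}" "\<lambda>_. 0"] by simp
    then show ?case by (simp add: indicator_def[abs_def])
  next
    case (Suc n)
    have "cylinder_approximable N I (\<lambda>x. max (indicator (\<Union>i<n. A i) x) (indicator (A n) x))"
      by (rule cylinder_approximable_lipschitz[OF Suc Union.IH, where K=1]) auto
    also have "(\<lambda>x. max (indicator (\<Union>i<n. A i) x) (indicator (A n) x)) = (indicator (\<Union>i<Suc n. A i) :: _ \<Rightarrow> real)"
      by (auto simp: fun_eq_iff indicator_def lessThan_Suc)
    finally show ?case .
  qed
  show ?case
  proof (rule cylinder_approximable_limit[OF _ U])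
    show "(indicator (\<Union>(range A)) :: _ \<Rightarrow> real) \<in> borel_measurable N" by (rule mU)
    have "(\<lambda>n. \<integral>\<^sup>+x. ennreal \<bar>indicator (\<Union>i. A i) x - indicator (\<Union>i<n. A i) x\<bar> \<partial>N)
        \<longlonglongrightarrow> (\<integral>\<^sup>+x. 0 \<partial>N)"
    proof (rule nn_integral_dominated_convergence[where w="\<lambda>_. 1"])
      show "(\<lambda>x. ennreal \<bar>indicator (\<Union>i. A i) x - indicator (\<Union>i<n. A i) x\<bar>) \<in> borel_measurable N" for n
        by measurable
      show "AE x in N. (\<lambda>n. ennreal \<bar>indicator (\<Union>i. A i) x - indicator (\<Union>i<n. A i) x\<bar>) \<longlonglongrightarrow> 0"
      proof (rule AE_I2)
        fix x
        have "eventually (\<lambda>n. ennreal \<bar>indicator (\<Union>i. A i) x - indicator (\<Union>i<n. A i) x\<bar> = 0) sequentially"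
        proof (cases "\<exists>i. x \<in> A i")
          case True
          then obtain i where "x \<in> A i" ..
          then show ?thesis
            by (auto simp: indicator_def eventually_sequentially intro!: exI[of _ "Suc i"])
        qed (auto simp: indicator_def)
        then show "(\<lambda>n. ennreal \<bar>indicator (\<Union>i. A i) x - indicator (\<Union>i<n. A i) x\<bar>) \<longlonglongrightarrow> 0"
          by (rule tendsto_eventually)
      qed
    qed (auto simp: indicator_def less_top[symmetric])
    then show "(\<lambda>n. \<integral>\<^sup>+x. ennreal \<bar>indicator (\<Union>(range A)) x - indicator (\<Union>i<n. A i) x\<bar> \<partial>N) \<longlonglongrightarrow> 0"
      by simp
  qed
qed

lemma cylinder_approximable_integrable:
  assumes "integrable N F"
  shows "cylinder_approximable N I F"
  using assms
proof (induction rule: integrable_induct)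
  case (base A c)
  obtain B where B: "B \<in> sets (Pi\<^sub>M I (\<lambda>_. borel))" "A = \<Omega> \<inter> B"
    using base unfolding sets_N sets_restrict_space by auto
  have A: "cylinder_approximable N I (indicator A)"
    by (rule cylinder_approximable_cong[OF cylinder_approximable_indicator[OF B(1)]])
      (use base in \<open>auto simp: B(2) space_N indicator_def\<close>)
  have eq: "\<bar>a * c - b * c\<bar> = \<bar>c\<bar> * \<bar>a - b\<bar>" for a b
    by (simp only: left_diff_distrib[symmetric] abs_mult mult.commute)
  from A A have "cylinder_approximable N I (\<lambda>x. indicator A x * c)"
    by (rule cylinder_approximable_lipschitz[where h="\<lambda>a b. a * c" and K="\<bar>c\<bar>"])
      (simp_all add: eq)
  then show ?case by simp
next
  case (add f g)
  show ?case
    by (rule cylinder_approximable_lipschitz[OF add.IH, where K=1]) auto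
next
  case (lim f s)
  have [measurable]: "f \<in> borel_measurable N" using lim by auto
  show ?case
  proof (rule cylinder_approximable_limit[OF _ lim.IH])
    show "f \<in> borel_measurable N" by measurable
    have [measurable]: "s n \<in> borel_measurable N" for n using lim.hyps(1) by auto
    have "(\<lambda>n. \<integral>\<^sup>+x. ennreal \<bar>f x - s n x\<bar> \<partial>N) \<longlonglongrightarrow> (\<integral>\<^sup>+x. 0 \<partial>N)"
    \<comment> \<open>The approximants supplied by the induction satisfy
      \<open>norm (s n x) \<le> 2 * norm (f x)\<close>, whence the factor 3.\<close>
    proof (rule nn_integral_dominated_convergence[where w="\<lambda>x. ennreal (3 * norm (f x))"])
      have "integrable N (\<lambda>x. 3 * norm (f x))" using lim by auto
      then show "(\<integral>\<^sup>+x. ennreal (3 * norm (f x)) \<partial>N) < \<infinity>"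
        by (subst (asm) integrable_iff_bounded) (simp add: abs_mult)
      show "AE x in N. (\<lambda>n. ennreal \<bar>f x - s n x\<bar>) \<longlonglongrightarrow> 0"
      proof (rule AE_I2)
        fix x assume "x \<in> space N"
        from tendsto_ennrealI[OF tendsto_rabs[OF tendsto_diff[OF tendsto_const lim.hyps(2)[OF this]]], of "f x"]
        show "(\<lambda>n. ennreal \<bar>f x - s n x\<bar>) \<longlonglongrightarrow> 0" by simp
      qed
      show "AE x in N. ennreal \<bar>f x - s n x\<bar> \<le> ennreal (3 * norm (f x))" for n
        using lim.hyps(3)[of _ n] by (intro AE_I2 ennreal_leI) (fastforce simp: abs_if split: if_splits)
    qed auto
    then show "(\<lambda>n. \<integral>\<^sup>+x. ennreal \<bar>f x - s n x\<bar> \<partial>N) \<longlonglongrightarrow> 0" by simp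
  qed
qed

end
end

section \<open>Brownian motion with a drift of random amplitude\<close>

lemma brownian_prob_space: "standard_brownian_motion M w \<Longrightarrow> prob_space M"
  by (simp add: standard_brownian_motion_def)

lemma brownian_measurable: "standard_brownian_motion M w \<Longrightarrow> 0 \<le> t \<Longrightarrow> w t \<in> borel_measurable M"
  by (simp add: standard_brownian_motion_def)

lemma brownian_increments_distr:
  fixes \<tau> :: "nat \<Rightarrow> real"
  assumes w: "standard_brownian_motion M w" and m: "m > 0"
    and \<tau>: "0 \<le> \<tau> 0" "\<And>i. i < m \<Longrightarrow> \<tau> i < \<tau> (Suc i)"
  shows "distr M (Pi\<^sub>M {..<m} (\<lambda>_. borel)) (\<lambda>\<omega>. \<lambda>i\<in>{..<m}. w (\<tau> (Suc i)) \<omega> - w (\<tau> i) \<omega>) =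
    Pi\<^sub>M {..<m} (\<lambda>i. gaussian 0 (sqrt (\<tau> (Suc i) - \<tau> i)))"
proof -
  interpret prob_space M using w by (rule brownian_prob_space)
  have nn: "0 \<le> \<tau> i" if "i \<le> m" for i
    using that by (induction i) (use \<tau> in \<open>auto intro: order_trans less_imp_le simp: Suc_le_eq\<close>)
  have meas: "w (\<tau> i) \<in> borel_measurable M" if "i \<le> m" for i
    using w nn[OF that] by (rule brownian_measurable)
  have "indep_vars (\<lambda>_. borel) (\<lambda>i \<omega>. w (\<tau> (Suc i)) \<omega> - w (\<tau> i) \<omega>) {..<m}"
    using w \<tau> by (auto simp: standard_brownian_motion_def)
  then have "distr M (Pi\<^sub>M {..<m} (\<lambda>_. borel)) (\<lambda>\<omega>. \<lambda>i\<in>{..<m}. w (\<tau> (Suc i)) \<omega> - w (\<tau> i) \<omega>) =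
    Pi\<^sub>M {..<m} (\<lambda>i. distr M borel (\<lambda>\<omega>. w (\<tau> (Suc i)) \<omega> - w (\<tau> i) \<omega>))"
    using m meas by (subst (asm) indep_vars_iff_distr_eq_PiM') (auto intro!: borel_measurable_diff)
  also have "\<dots> = Pi\<^sub>M {..<m} (\<lambda>i. gaussian 0 (sqrt (\<tau> (Suc i) - \<tau> i)))"
  proof (intro PiM_cong refl)
    fix i assume "i \<in> {..<m}"
    then have "distributed M lborel (\<lambda>\<omega>. w (\<tau> (Suc i)) \<omega> - w (\<tau> i) \<omega>) (normal_density 0 (sqrt (\<tau> (Suc i) - \<tau> i)))"
      using w nn[of i] \<tau>(2)[of i] by (auto simp: standard_brownian_motion_def)
    then show "distr M borel (\<lambda>\<omega>. w (\<tau> (Suc i)) \<omega> - w (\<tau> i) \<omega>) = gaussian 0 (sqrt (\<tau> (Suc i) - \<tau> i))"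
      by (simp add: distributed_def cong: distr_cong)
  qed
  finally show ?thesis .
qed

text \<open>
  The function \<open>\<Psi>\<close> dominates the information about the amplitude \<open>x\<close> of the drift \<open>x \<Phi>\<close> that is
  carried by the increments.
\<close>

lemma brownian_cylinder_bayes_risk:
  fixes \<Phi> \<Psi> g :: "real \<Rightarrow> real"
  assumes w: "standard_brownian_motion M w" and \<sigma>: "\<sigma> > 0" and s: "s > 0" and T: "T > 0"
    and \<Phi>0: "\<Phi> 0 = 0"
    and \<Psi>: "\<And>a b. 0 \<le> a \<Longrightarrow> a < b \<Longrightarrow> b \<le> T \<Longrightarrow> (\<Phi> b - \<Phi> a)\<^sup>2 \<le> (b - a) * (\<Psi> b - \<Psi> a)"
    and J: "finite J" "J \<subseteq> {0..T}"
    and G [measurable]: "G \<in> borel_measurable (Pi\<^sub>M J (\<lambda>_. borel))"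
  shows "(\<integral>\<^sup>+x. \<integral>\<^sup>+\<omega>. ennreal ((G (\<lambda>t\<in>J. g t + x * \<Phi> t + \<sigma> * w t \<omega>) - x)\<^sup>2) \<partial>M \<partial>gaussian 0 s)
    \<ge> ennreal (1 / (1 / s\<^sup>2 + (\<Psi> T - \<Psi> 0) / \<sigma>\<^sup>2))"
proof -
  interpret prob_space M using w by (rule brownian_prob_space)
  \<comment> \<open>With 0 and \<open>T\<close> added, the values at \<open>J\<close> are sums of
    increments from 0, and sums over the partition telescope over the whole interval.\<close>
  define A where "A = insert 0 (insert T J)"
  have A: "finite A" "A \<subseteq> {0..T}" using J T by (auto simp: A_def)
  define \<tau> where "\<tau> i = sorted_list_of_set A ! i" for i
  define m where "m = card A - 1"
  have cA: "card A = Suc m"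
    using A by (auto simp: m_def A_def card_gt_0_iff)
  have "card {0, T} \<le> card A" using A by (intro card_mono) (auto simp: A_def)
  then have m: "m > 0" using cA T by simp
  have mono: "\<tau> i < \<tau> j" if "i < j" "j \<le> m" for i j
    using that cA A sorted_wrt_nth_less[OF strict_sorted_list_of_set[of A], of i j]
    by (simp add: \<tau>_def)
  have in_A: "\<tau> i \<in> A" if "i \<le> m" for i
    using that cA A nth_mem[of i "sorted_list_of_set A"] by (simp add: \<tau>_def)
  have ex: "\<exists>i\<le>m. \<tau> i = t" if "t \<in> A" for t
    using that cA A in_set_conv_nth[of t "sorted_list_of_set A"] by (auto simp: \<tau>_def less_Suc_eq_le)
  define idx where "idx t = (SOME i. i \<le> m \<and> \<tau> i = t)" for t
  have idx: "idx t \<le> m" "\<tau> (idx t) = t" if "t \<in> A" for t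
    using someI_ex[OF ex[OF that]] by (auto simp: idx_def)
  have \<tau>0: "\<tau> 0 = 0"
  proof -
    obtain i where i: "i \<le> m" "\<tau> i = 0" using ex[of 0] by (auto simp: A_def)
    have "0 \<le> \<tau> 0" using in_A[of 0] A by auto
    with i mono[of 0 i] show ?thesis by (cases i) auto
  qed
  have \<tau>m: "\<tau> m = T"
  proof -
    obtain i where i: "i \<le> m" "\<tau> i = T" using ex[of T] by (auto simp: A_def)
    have "\<tau> m \<le> T" using in_A[of m] A by auto
    with i mono[of i m] show ?thesis by (cases "i = m") auto
  qed
  have bnd: "0 \<le> \<tau> i" "\<tau> i \<le> T" if "i \<le> m" for i using in_A[OF that] A by auto
  \<comment> \<open>After division by \<open>\<sigma>\<close>, increment \<open>i\<close> of the
    observation is normal with mean \<open>a i * x\<close>, up to the known drift \<open>g\<close>,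
    and deviation \<open>d i\<close>: a regression in \<open>x\<close>.\<close>
  define a where "a i = (\<Phi> (\<tau> (Suc i)) - \<Phi> (\<tau> i)) / \<sigma>" for i
  define d where "d i = sqrt (\<tau> (Suc i) - \<tau> i)" for i
  define W where "W \<omega> = (\<lambda>i\<in>{..<m}. w (\<tau> (Suc i)) \<omega> - w (\<tau> i) \<omega>)" for \<omega>
  \<comment> \<open>\<open>H\<close> rebuilds the path at the times in \<open>J\<close> from its
    increments; this is exact because \<open>w\<close> and \<open>\<Phi>\<close> vanish at
    0.\<close>
  define H where "H z = G (\<lambda>t\<in>J. g t + \<sigma> * (\<Sum>i<idx t. z i))" for z :: "nat \<Rightarrow> real"
  have [measurable]: "W \<in> measurable M (Pi\<^sub>M {..<m} (\<lambda>_. borel))"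
    unfolding W_def by (intro measurable_restrict borel_measurable_diff brownian_measurable[OF w] bnd) auto
  have Hm [measurable]: "H \<in> borel_measurable (Pi\<^sub>M {..<m} (\<lambda>_. borel))"
  proof -
    have "(\<lambda>z. \<Sum>i<idx t. z i) \<in> borel_measurable (Pi\<^sub>M {..<m} (\<lambda>_. borel :: real measure))" if "t \<in> J" for t
      using idx(1)[of t] that by (intro borel_measurable_sum measurable_component_singleton) (auto simp: A_def)
    then show ?thesis
      unfolding H_def
      by (intro measurable_compose[OF _ G] measurable_restrict borel_measurable_add borel_measurable_times) auto
  qed
  have HG: "H (\<lambda>i\<in>{..<m}. a i * x + W \<omega> i) = G (\<lambda>t\<in>J. g t + x * \<Phi> t + \<sigma> * w t \<omega>)"
    if "\<omega> \<in> space M" for x \<omega>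
  proof -
    have w0: "w 0 \<omega> = 0" using w that by (simp add: standard_brownian_motion_def)
    have "\<sigma> * (\<Sum>i<idx t. (\<lambda>i\<in>{..<m}. a i * x + W \<omega> i) i) = x * \<Phi> t + \<sigma> * w t \<omega>" if "t \<in> J" for t
    proof -
      have t: "t \<in> A" using that by (simp add: A_def)
      have "\<sigma> * (\<Sum>i<idx t. (\<lambda>i\<in>{..<m}. a i * x + W \<omega> i) i)
        = \<sigma> * (\<Sum>i<idx t. (x / \<sigma> * \<Phi> (\<tau> (Suc i)) + w (\<tau> (Suc i)) \<omega>) - (x / \<sigma> * \<Phi> (\<tau> i) + w (\<tau> i) \<omega>))"
        using idx[OF t] by (intro arg_cong2[where f="(*)"] sum.cong refl) (auto simp: a_def W_def diff_divide_distrib algebra_simps)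
      also have "\<dots> = \<sigma> * (x / \<sigma> * \<Phi> t + w t \<omega>)"
        by (subst sum_lessThan_telescope) (simp add: \<tau>0 w0 \<Phi>0 idx[OF t])
      also have "\<dots> = x * \<Phi> t + \<sigma> * w t \<omega>" using \<sigma> by (simp add: field_simps)
      finally show ?thesis .
    qed
    then show ?thesis unfolding H_def by (intro arg_cong[where f=G] restrict_ext) simp
  qed
  have aff [measurable]: "(\<lambda>u. \<lambda>i\<in>{..<m}. a i * x + u i) \<in> measurable (Pi\<^sub>M {..<m} (\<lambda>_. borel)) (Pi\<^sub>M {..<m} (\<lambda>_. borel :: real measure))" for x
    by (rule measurable_restrict) auto
  have "(\<integral>\<^sup>+\<omega>. ennreal ((G (\<lambda>t\<in>J. g t + x * \<Phi> t + \<sigma> * w t \<omega>) - x)\<^sup>2) \<partial>M) =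
    (\<integral>\<^sup>+u. ennreal ((H (\<lambda>i\<in>{..<m}. a i * x + u i) - x)\<^sup>2) \<partial>Pi\<^sub>M {..<m} (\<lambda>i. gaussian 0 (d i)))" for x
  proof -
    have "(\<integral>\<^sup>+\<omega>. ennreal ((G (\<lambda>t\<in>J. g t + x * \<Phi> t + \<sigma> * w t \<omega>) - x)\<^sup>2) \<partial>M) =
       (\<integral>\<^sup>+\<omega>. ennreal ((H (\<lambda>i\<in>{..<m}. a i * x + W \<omega> i) - x)\<^sup>2) \<partial>M)"
      by (intro nn_integral_cong) (simp add: HG)
    also have "\<dots> = (\<integral>\<^sup>+u. ennreal ((H (\<lambda>i\<in>{..<m}. a i * x + u i) - x)\<^sup>2) \<partial>distr M (Pi\<^sub>M {..<m} (\<lambda>_. borel)) W)"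
      by (subst nn_integral_distr) auto
    also have "distr M (Pi\<^sub>M {..<m} (\<lambda>_. borel)) W = Pi\<^sub>M {..<m} (\<lambda>i. gaussian 0 (d i))"
      unfolding W_def d_def by (rule brownian_increments_distr[OF w m]) (use \<tau>0 mono in auto)
    finally show ?thesis .
  qed
  then have eq: "(\<integral>\<^sup>+x. \<integral>\<^sup>+\<omega>. ennreal ((G (\<lambda>t\<in>J. g t + x * \<Phi> t + \<sigma> * w t \<omega>) - x)\<^sup>2) \<partial>M \<partial>gaussian 0 s) =
    (\<integral>\<^sup>+x. \<integral>\<^sup>+u. ennreal ((H (\<lambda>i\<in>{..<m}. a i * x + u i) - x)\<^sup>2) \<partial>Pi\<^sub>M {..<m} (\<lambda>i. gaussian 0 (d i)) \<partial>gaussian 0 s)"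
    by simp
  have dpos: "d i > 0" if "i < m" for i
    using mono[of i "Suc i"] that by (simp add: d_def)
  \<comment> \<open>The information in the increments: the hypothesis on \<open>\<Psi>\<close>
    bounds each term by an increment of \<open>\<Psi> / \<sigma>\<^sup>2\<close>, so the total does
    not depend on the partition.\<close>
  have "(\<Sum>i<m. (a i)\<^sup>2 / (d i)\<^sup>2) \<le> (\<Sum>i<m. (\<Psi> (\<tau> (Suc i)) - \<Psi> (\<tau> i)) / \<sigma>\<^sup>2)"
  proof (rule sum_mono)
    fix i assume "i \<in> {..<m}"
    then have i: "i < m" by simp
    have lt: "\<tau> i < \<tau> (Suc i)" using mono i by auto
    have "(a i)\<^sup>2 = (\<Phi> (\<tau> (Suc i)) - \<Phi> (\<tau> i))\<^sup>2 / \<sigma>\<^sup>2" by (simp add: a_def power_divide)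
    also have "\<dots> \<le> (\<tau> (Suc i) - \<tau> i) * (\<Psi> (\<tau> (Suc i)) - \<Psi> (\<tau> i)) / \<sigma>\<^sup>2"
      using bnd[of i] bnd[of "Suc i"] i lt by (intro divide_right_mono \<Psi>) auto
    also have "\<dots> = (d i)\<^sup>2 * ((\<Psi> (\<tau> (Suc i)) - \<Psi> (\<tau> i)) / \<sigma>\<^sup>2)"
      using lt by (simp add: d_def)
    finally show "(a i)\<^sup>2 / (d i)\<^sup>2 \<le> (\<Psi> (\<tau> (Suc i)) - \<Psi> (\<tau> i)) / \<sigma>\<^sup>2"
      using dpos[OF i] by (simp add: pos_divide_le_eq mult.commute)
  qed
  also have "\<dots> = (\<Psi> T - \<Psi> 0) / \<sigma>\<^sup>2"
    using sum_lessThan_telescope[of "\<lambda>i. \<Psi> (\<tau> i)" m]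
    by (simp add: sum_divide_distrib[symmetric] \<tau>0 \<tau>m)
  finally have le: "(\<Sum>i<m. (a i)\<^sup>2 / (d i)\<^sup>2) \<le> (\<Psi> T - \<Psi> 0) / \<sigma>\<^sup>2" .
  have "1 / (1 / s\<^sup>2 + (\<Psi> T - \<Psi> 0) / \<sigma>\<^sup>2) \<le> 1 / (1 / s\<^sup>2 + (\<Sum>i<m. (a i)\<^sup>2 / (d i)\<^sup>2))"
    using s le by (intro divide_left_mono add_left_mono mult_pos_pos add_pos_nonneg sum_nonneg) (auto intro: order_trans[OF sum_nonneg le])
  then have "ennreal (1 / (1 / s\<^sup>2 + (\<Psi> T - \<Psi> 0) / \<sigma>\<^sup>2)) \<le> ennreal (1 / (1 / s\<^sup>2 + (\<Sum>i<m. (a i)\<^sup>2 / (d i)\<^sup>2)))"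
    by (rule ennreal_leI)
  also have "\<dots> \<le> (\<integral>\<^sup>+x. \<integral>\<^sup>+u. ennreal ((H (\<lambda>i\<in>{..<m}. a i * x + u i) - x)\<^sup>2) \<partial>Pi\<^sub>M {..<m} (\<lambda>i. gaussian 0 (d i)) \<partial>gaussian 0 s)"
    using s dpos by (intro gaussian_regression_bayes_risk) auto
  finally show ?thesis unfolding eq .
qed

section \<open>From finitely many increments to functionals of the whole path\<close>

lemma ennreal_le_of_le_scaled:
  assumes "\<And>\<eta>. \<eta> > 0 \<Longrightarrow> ennreal v \<le> ennreal (1 + \<eta>) * R + ennreal \<eta>"
  shows "ennreal v \<le> R"
proof (cases R)
  case (real q)
  have "v \<le> q"
  proof (rule tendsto_lowerbound[where F="at_right 0"])
    show "((\<lambda>\<eta>. (1 + \<eta>) * q + \<eta>) \<longlongrightarrow> q) (at_right 0)" by (auto intro!: tendsto_eq_intros)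
    show "\<forall>\<^sub>F \<eta> in at_right 0. v \<le> (1 + \<eta>) * q + \<eta>"
      unfolding eventually_at_right_field
    proof (intro exI[of _ 1] conjI allI impI)
      fix \<eta> :: real assume "0 < \<eta>"
      with assms[OF this] real show "v \<le> (1 + \<eta>) * q + \<eta>"
        by (simp flip: ennreal_mult ennreal_plus)
    qed simp
  qed simp
  with real show ?thesis by (simp add: ennreal_leI)
qed auto

lemma sets_skorokhod [measurable_cong]:
  "sets (skorokhod T) = sets (restrict_space (\<Pi>\<^sub>M t\<in>{0..T}. borel) {f. cadlag_on {0..T} f})"
  by (simp add: skorokhod_def)

lemma continuous_path_cadlag:
  assumes "continuous_on {0..T} f"
  shows "cadlag_on {0..T} (restrict f {0..T})"
proof -
  have "continuous_on {0..T} (restrict f {0..T})"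
    using assms by (rule continuous_on_eq) simp
  then have "(restrict f {0..T} \<longlongrightarrow> restrict f {0..T} t) (at t within {0..T} \<inter> A)" if "t \<in> {0..T}" for t A
    using that unfolding continuous_on_def by (blast intro: tendsto_within_subset)
  then show ?thesis unfolding cadlag_on_def by blast
qed

lemma measurable_continuous_path:
  assumes "\<And>t. t \<in> {0..T} \<Longrightarrow> (\<lambda>p. h p t) \<in> borel_measurable N"
    and "\<And>p. p \<in> space N \<Longrightarrow> continuous_on {0..T} (h p)"
  shows "(\<lambda>p. \<lambda>t\<in>{0..T}. h p t) \<in> measurable N (skorokhod T)"
  unfolding skorokhod_def
  by (intro measurable_restrict_space2 measurable_restrict assms)
    (auto simp: space_PiM intro: continuous_path_cadlag assms)

lemma brownian_continuous:
  "standard_brownian_motion M w \<Longrightarrow> \<omega> \<in> space M \<Longrightarrow> continuous_on {0..T} (\<lambda>t. w t \<omega>)"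
  by (auto simp: standard_brownian_motion_def intro: continuous_on_subset)

text \<open>Under the joint law of prior and noise the path has one law \<open>L\<close>, in which
  \<open>F\<close> is L1-close to a cylinder function. The bound for cylinder functions is free of
  their coordinates and so survives the limit; boundedness of \<open>F\<close> converts the L1 error
  into a squared error.\<close>

lemma brownian_bayes_risk:
  fixes \<Phi> \<Psi> g :: "real \<Rightarrow> real" and F :: "(real \<Rightarrow> real) \<Rightarrow> real"
  assumes w: "standard_brownian_motion M w" and \<sigma>: "\<sigma> > 0" and s: "s > 0" and T: "T > 0"
    and \<Phi>0: "\<Phi> 0 = 0"
    and \<Psi>: "\<And>a b. 0 \<le> a \<Longrightarrow> a < b \<Longrightarrow> b \<le> T \<Longrightarrow> (\<Phi> b - \<Phi> a)\<^sup>2 \<le> (b - a) * (\<Psi> b - \<Psi> a)"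
    and cont: "continuous_on {0..T} \<Phi>" "continuous_on {0..T} g"
    and F [measurable]: "F \<in> borel_measurable (skorokhod T)"
    and bdd: "\<And>y. \<bar>F y\<bar> \<le> c"
  shows "(\<integral>\<^sup>+x. \<integral>\<^sup>+\<omega>. ennreal ((F (\<lambda>t\<in>{0..T}. g t + x * \<Phi> t + \<sigma> * w t \<omega>) - x)\<^sup>2) \<partial>M \<partial>gaussian 0 s)
    \<ge> ennreal (1 / (1 / s\<^sup>2 + (\<Psi> T - \<Psi> 0) / \<sigma>\<^sup>2))"
    (is "?R \<ge> ennreal ?v")
proof (rule ennreal_le_of_le_scaled)
  fix \<eta> :: real assume \<eta>: "\<eta> > 0"
  interpret M: prob_space M using w by (rule brownian_prob_space)
  interpret N: prob_space "gaussian 0 s" using s by (rule prob_space_normal_density)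
  interpret P: pair_prob_space "gaussian 0 s" M ..
  have c: "c \<ge> 0" using bdd[of undefined] by linarith
  define Y where "Y x \<omega> = (\<lambda>t\<in>{0..T}. g t + x * \<Phi> t + \<sigma> * w t \<omega>)" for x \<omega>
  have [measurable]: "case_prod Y \<in> measurable (gaussian 0 s \<Otimes>\<^sub>M M) (skorokhod T)"
    unfolding Y_def split_beta'
  proof (rule measurable_continuous_path)
    fix t assume "t \<in> {0..T}"
    then have [measurable]: "w t \<in> borel_measurable M" using brownian_measurable[OF w] by auto
    show "(\<lambda>p. g t + fst p * \<Phi> t + \<sigma> * w t (snd p)) \<in> gaussian 0 s \<Otimes>\<^sub>M M \<rightarrow>\<^sub>M borel"
      by measurable
  next
    fix p assume "p \<in> space (gaussian 0 s \<Otimes>\<^sub>M M)"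
    then have "snd p \<in> space M" by (auto simp: space_pair_measure)
    then show "continuous_on {0..T} (\<lambda>t. g t + fst p * \<Phi> t + \<sigma> * w t (snd p))"
      using cont brownian_continuous[OF w] by (intro continuous_intros) auto
  qed
  define L where "L = distr (gaussian 0 s \<Otimes>\<^sub>M M) (skorokhod T) (case_prod Y)"
  interpret L: prob_space L unfolding L_def by (rule P.prob_space_distr) measurable
  have L_int: "(\<integral>\<^sup>+y. h y \<partial>L) = (\<integral>\<^sup>+x. \<integral>\<^sup>+\<omega>. h (Y x \<omega>) \<partial>M \<partial>gaussian 0 s)"
    if [measurable]: "h \<in> borel_measurable (skorokhod T)" for h
    unfolding L_def by (subst nn_integral_distr) (auto simp: M.nn_integral_fst[symmetric])
  have "integrable L F"
    using bdd by (intro L.integrable_const_bound[where B=c]) (auto simp: L_def)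
  then have "cylinder_approximable L {0..T} F"
    by (intro cylinder_approximable_integrable[where \<Omega>="{f. cadlag_on {0..T} f}"])
      (auto simp: L_def skorokhod_def L.finite_measure_axioms[unfolded L_def skorokhod_def])
  \<comment> \<open>Chosen so that the approximation error, multiplied by the constant of the
    pointwise bound \<open>pt\<close>, is at most \<open>\<eta>\<close>; the added 1 covers
    \<open>c = 0\<close>.\<close>
  moreover define e where "e = \<eta> / ((1 + 1 / \<eta>) * (2 * c) + 1)"
  moreover have den: "(1 + 1 / \<eta>) * (2 * c) \<ge> 0" using \<eta> c by simp
  moreover have e: "e > 0" unfolding e_def using \<eta> den by (intro divide_pos_pos add_nonneg_pos) auto
  ultimately obtain J G where J: "finite J" "J \<subseteq> {0..T}" and G [measurable]: "G \<in> borel_measurable (Pi\<^sub>M J (\<lambda>_. borel))"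
    and a: "(\<integral>\<^sup>+y. ennreal \<bar>F y - G (restrict y J)\<bar> \<partial>L) < ennreal e"
    unfolding cylinder_approximable_def by blast
  have [measurable]: "(\<lambda>x. restrict x J) \<in> measurable (skorokhod T) (Pi\<^sub>M J (\<lambda>_. borel :: real measure))"
    using J by (intro measurable_restrict_coordinates[where I="{0..T}", OF sets_skorokhod])
  have e_le: "(1 + 1 / \<eta>) * (2 * c) * e \<le> \<eta>"
  proof -
    have "q * (\<eta> / (q + 1)) \<le> \<eta>" if "q \<ge> 0" for q
      using that \<eta> by (simp add: field_simps)
    from this[OF den] show ?thesis by (simp add: e_def)
  qed
  \<comment> \<open>Clipping to the range of \<open>F\<close> does not increase the distance to
    \<open>F\<close> and bounds that distance by \<open>2 * c\<close>.\<close>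
  define G' where "G' y = max (- c) (min c (G y))" for y
  have [measurable]: "G' \<in> borel_measurable (Pi\<^sub>M J (\<lambda>_. borel))" unfolding G'_def by measurable
  have restr: "restrict (Y x \<omega>) J = (\<lambda>t\<in>J. g t + x * \<Phi> t + \<sigma> * w t \<omega>)" for x \<omega>
    using J by (auto simp: Y_def fun_eq_iff restrict_def)
  have pt: "(G' z - x)\<^sup>2 \<le> (1 + \<eta>) * (F y - x)\<^sup>2 + (1 + 1 / \<eta>) * (2 * c) * \<bar>F y - G z\<bar>" for x y z
  proof -
    have "\<bar>F y - G' z\<bar> \<le> \<bar>F y - G z\<bar>" "\<bar>F y - G' z\<bar> \<le> 2 * c"
      using bdd[of y] c by (auto simp: G'_def)
    then have "\<bar>F y - G' z\<bar> * \<bar>F y - G' z\<bar> \<le> 2 * c * \<bar>F y - G z\<bar>"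
      by (intro mult_mono) auto
    then have 1: "(F y - G' z)\<^sup>2 \<le> 2 * c * \<bar>F y - G z\<bar>" by (simp add: power2_eq_square)
    \<comment> \<open>Young's inequality
      \<open>(a + b)^2 \<le> (1 + \<eta>) a^2 + (1 + 1/\<eta>) b^2\<close> with
      \<open>a = F y - x\<close> and \<open>b = G' z - F y\<close>, written as the nonnegativity of
      a square.\<close>
    have "0 \<le> (\<eta> * (F y - x) + (F y - G' z))\<^sup>2 / \<eta>" using \<eta> by simp
    also have "\<dots> = (1 + \<eta>) * (F y - x)\<^sup>2 + (1 + 1 / \<eta>) * (F y - G' z)\<^sup>2 - (G' z - x)\<^sup>2"
      using \<eta> by (simp add: field_simps power2_eq_square)
    finally have "(G' z - x)\<^sup>2 \<le> (1 + \<eta>) * (F y - x)\<^sup>2 + (1 + 1 / \<eta>) * (F y - G' z)\<^sup>2" by simp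
    also have "\<dots> \<le> (1 + \<eta>) * (F y - x)\<^sup>2 + (1 + 1 / \<eta>) * (2 * c * \<bar>F y - G z\<bar>)"
      using 1 \<eta> by (intro add_left_mono mult_left_mono) auto
    finally show ?thesis by (simp add: mult.assoc)
  qed
  have "ennreal ?v \<le> (\<integral>\<^sup>+x. \<integral>\<^sup>+\<omega>. ennreal ((G' (restrict (Y x \<omega>) J) - x)\<^sup>2) \<partial>M \<partial>gaussian 0 s)"
    unfolding restr by (rule brownian_cylinder_bayes_risk[OF w \<sigma> s T \<Phi>0 \<Psi> J]) auto
  also have "\<dots> \<le> (\<integral>\<^sup>+x. \<integral>\<^sup>+\<omega>. ennreal (1 + \<eta>) * ennreal ((F (Y x \<omega>) - x)\<^sup>2) +
      ennreal ((1 + 1 / \<eta>) * (2 * c)) * ennreal \<bar>F (Y x \<omega>) - G (restrict (Y x \<omega>) J)\<bar> \<partial>M \<partial>gaussian 0 s)"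
    using pt \<eta> c by (intro nn_integral_mono) (simp flip: ennreal_mult ennreal_plus add: ennreal_leI)
  also have "\<dots> = ennreal (1 + \<eta>) * (\<integral>\<^sup>+x. \<integral>\<^sup>+\<omega>. ennreal ((F (Y x \<omega>) - x)\<^sup>2) \<partial>M \<partial>gaussian 0 s) +
     ennreal ((1 + 1 / \<eta>) * (2 * c)) * (\<integral>\<^sup>+x. \<integral>\<^sup>+\<omega>. ennreal \<bar>F (Y x \<omega>) - G (restrict (Y x \<omega>) J)\<bar> \<partial>M \<partial>gaussian 0 s)"
    by (simp add: nn_integral_add nn_integral_cmult)
  also have "(\<integral>\<^sup>+x. \<integral>\<^sup>+\<omega>. ennreal \<bar>F (Y x \<omega>) - G (restrict (Y x \<omega>) J)\<bar> \<partial>M \<partial>gaussian 0 s)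
      = (\<integral>\<^sup>+y. ennreal \<bar>F y - G (restrict y J)\<bar> \<partial>L)"
    by (rule L_int[symmetric]) measurable
  finally have "ennreal ?v \<le> ennreal (1 + \<eta>) * ?R +
     ennreal ((1 + 1 / \<eta>) * (2 * c)) * (\<integral>\<^sup>+y. ennreal \<bar>F y - G (restrict y J)\<bar> \<partial>L)"
    unfolding Y_def .
  also have "\<dots> \<le> ennreal (1 + \<eta>) * ?R + ennreal ((1 + 1 / \<eta>) * (2 * c)) * ennreal e"
    using a by (intro add_left_mono mult_left_mono) auto
  also have "\<dots> = ennreal (1 + \<eta>) * ?R + ennreal ((1 + 1 / \<eta>) * (2 * c) * e)"
    using e den by (subst ennreal_mult) auto
  also have "\<dots> \<le> ennreal (1 + \<eta>) * ?R + ennreal \<eta>"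
    using e_le by (intro add_left_mono ennreal_leI)
  finally show "ennreal ?v \<le> ennreal (1 + \<eta>) * ?R + ennreal \<eta>" .
qed

section \<open>Trigonometric polynomials\<close>

text \<open>The phase index \<open>b\<close> counts quarter periods, so that differentiation just
  raises \<open>b\<close> by one, up to the angular frequency. \<open>b = 0\<close> gives the cosine
  and \<open>b = 1\<close> minus the sine, of norm 1 on the unit interval for
  \<open>m \<ge> 1\<close>.\<close>

definition trig :: "nat \<Rightarrow> nat \<Rightarrow> real \<Rightarrow> real" where
  "trig m b t = sqrt 2 * cos (2 * pi * real m * t + real b * (pi / 2))"

lemma trig_has_derivative:
  "(trig m b has_field_derivative 2 * pi * real m * trig m (Suc b) t) (at t)"
proof -
  have "cos (y + pi / 2) = - sin y" for y :: real
    by (simp add: cos_add)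
  from this[of "2 * pi * real m * t + real b * (pi / 2)"]
  have "cos (2 * pi * real m * t + real (Suc b) * (pi / 2)) = - sin (2 * pi * real m * t + real b * (pi / 2))"
    by (simp add: algebra_simps add_divide_distrib)
  then have e: "2 * pi * real m * trig m (Suc b) t =
      sqrt 2 * (- sin (2 * pi * real m * t + real b * (pi / 2)) * (2 * pi * real m))"
    unfolding trig_def by simp
  show ?thesis
    unfolding e unfolding trig_def[abs_def]
    by (auto intro!: derivative_eq_intros)
qed

lemma continuous_on_trig [continuous_intros]: "continuous_on A (trig m b)"
  unfolding trig_def[abs_def] by (intro continuous_intros)

lemma trig_measurable [measurable]: "trig m b \<in> borel_measurable borel"
  by (intro borel_measurable_continuous_onI continuous_on_trig)

lemma cos_int_shift: "cos (x + 2 * pi * of_int n) = cos x"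
  by (metis cos_int_2pin cos_add sin_int_2pin mult.assoc mult.commute mult_1_right diff_zero mult_zero_right)

lemma sin_int_shift: "sin (x + 2 * pi * of_int n) = sin x"
  by (metis cos_int_2pin sin_add sin_int_2pin mult.assoc mult.commute mult_1_right add_0_right mult_zero_right)

lemma trig_periodic: "trig m b (t + 1) = trig m b t"
  using cos_int_shift[of "2 * pi * real m * t + real b * (pi / 2)" "int m"]
  by (simp add: trig_def algebra_simps)

lemma integral_cos_period:
  assumes "p \<noteq> 0"
  shows "((\<lambda>t. cos (2 * pi * of_int p * t + c)) has_integral 0) {0..1}"
proof -
  have "((\<lambda>t. cos (2 * pi * of_int p * t + c)) has_integral
      (sin (2 * pi * of_int p * 1 + c) / (2 * pi * of_int p) - sin (2 * pi * of_int p * 0 + c) / (2 * pi * of_int p))) {0..1}"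
  proof (rule fundamental_theorem_of_calculus)
    fix x :: real
    show "((\<lambda>t. sin (2 * pi * of_int p * t + c) / (2 * pi * of_int p)) has_vector_derivative
        cos (2 * pi * of_int p * x + c)) (at x within {0..1})"
      using assms unfolding has_real_derivative_iff_has_vector_derivative[symmetric]
      by (auto intro!: derivative_eq_intros)
  qed simp
  then show ?thesis using sin_int_shift[of c p] by (simp add: add.commute)
qed

text \<open>Product-to-sum formula: the sum frequency \<open>m + m'\<close> is nonzero and
  integrates to 0, while the difference frequency survives only for \<open>m = m'\<close>, where it
  is the cosine of the phase difference.\<close>

lemma trig_orthogonal:
  assumes "m \<ge> 1" "m' \<ge> 1"
  shows "((\<lambda>t. trig m b t * trig m' b' t) has_integral
    (if m = m' then cos ((real b - real b') * (pi / 2)) else 0)) {0..1}"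
proof -
  have e: "trig m b t * trig m' b' t =
      cos (2 * pi * of_int (int m - int m') * t + (real b - real b') * (pi / 2)) +
      cos (2 * pi * of_int (int m + int m') * t + (real b + real b') * (pi / 2))" for t
  proof -
    have "trig m b t * trig m' b' t = 2 * (cos (2 * pi * real m * t + real b * (pi / 2)) * cos (2 * pi * real m' * t + real b' * (pi / 2)))"
      by (simp add: trig_def)
    then show ?thesis by (simp add: cos_times_cos algebra_simps diff_divide_distrib add_divide_distrib)
  qed
  have 2: "((\<lambda>t. cos (2 * pi * of_int (int m + int m') * t + (real b + real b') * (pi / 2))) has_integral 0) {0..1}"
    using assms by (intro integral_cos_period) auto
  have 1: "((\<lambda>t. cos (2 * pi * of_int (int m - int m') * t + (real b - real b') * (pi / 2))) has_integral
     (if m = m' then cos ((real b - real b') * (pi / 2)) else 0)) {0..1}"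
  proof (cases "m = m'")
    case True
    then show ?thesis using has_integral_const_real[of "cos ((real b - real b') * (pi / 2))" 0 1] by simp
  next
    case False
    then show ?thesis using integral_cos_period[of "int m - int m'"] by simp
  qed
  show ?thesis unfolding e using has_integral_add[OF 1 2] by simp
qed

text \<open>The common shift \<open>l\<close> treats all derivatives of the system at once; phases 0
  and 1 remain a quarter period apart.\<close>

lemma trig_orthonormal:
  assumes "i \<in> {1..} \<times> {0, 1}" "j \<in> {1..} \<times> {0, 1}"
  shows "((\<lambda>t. trig (fst i) (snd i + l) t * trig (fst j) (snd j + l) t) has_integral (if i = j then 1 else 0)) {0..1}"
  using trig_orthogonal[of "fst i" "fst j" "snd i + l" "snd j + l"] assms
  by (auto split: if_splits)

text \<open>\<open>j\<close> is the order of differentiation, so \<open>trig_poly I 0 c\<close> is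
  the signal itself; the pairs in \<open>I\<close> are frequency and phase.\<close>

definition trig_poly :: "(nat \<times> nat) set \<Rightarrow> nat \<Rightarrow> (nat \<times> nat \<Rightarrow> real) \<Rightarrow> real \<Rightarrow> real" where
  "trig_poly I j c t = (\<Sum>i\<in>I. c i * (2 * pi * real (fst i)) ^ j * trig (fst i) (snd i + j) t)"

lemma trig_poly_has_derivative: "(trig_poly I j c has_field_derivative trig_poly I (Suc j) c t) (at t)"
proof -
  have "((\<lambda>t. \<Sum>i\<in>I. c i * (2 * pi * real (fst i)) ^ j * trig (fst i) (snd i + j) t) has_field_derivative
    (\<Sum>i\<in>I. c i * (2 * pi * real (fst i)) ^ j * (2 * pi * real (fst i) * trig (fst i) (Suc (snd i + j)) t))) (at t)"
    by (intro DERIV_sum DERIV_cmult trig_has_derivative)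
  then show ?thesis
    by (simp add: trig_poly_def[abs_def] mult_ac)
qed

lemma deriv_trig_poly: "(deriv ^^ j) (trig_poly I 0 c) = trig_poly I j c"
proof (induction j)
  case (Suc j)
  have "deriv (trig_poly I j c) = trig_poly I (Suc j) c"
    by (rule ext) (rule DERIV_imp_deriv[OF trig_poly_has_derivative])
  with Suc show ?case by simp
qed simp

lemma sq_norm_trig_poly:
  assumes I: "finite I" "I \<subseteq> {1..} \<times> {0, 1}"
  shows "sq_norm (trig_poly I j c) = ennreal (\<Sum>i\<in>I. (c i)\<^sup>2 * (2 * pi * real (fst i)) ^ (2 * j))"
proof -
  let ?d = "\<lambda>i. c i * (2 * pi * real (fst i)) ^ j"
  have "((\<lambda>t. \<Sum>i\<in>I. \<Sum>l\<in>I. ?d i * ?d l * (trig (fst i) (snd i + j) t * trig (fst l) (snd l + j) t)) has_integral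
     (\<Sum>i\<in>I. \<Sum>l\<in>I. ?d i * ?d l * (if i = l then 1 else 0))) {0..1}"
    using I by (intro has_integral_sum has_integral_mult_right trig_orthonormal) auto
  moreover have "(trig_poly I j c t)\<^sup>2 = (\<Sum>i\<in>I. \<Sum>l\<in>I. ?d i * ?d l * (trig (fst i) (snd i + j) t * trig (fst l) (snd l + j) t))" for t
    by (simp add: trig_poly_def power2_eq_square sum_product mult_ac)
  moreover have "(\<Sum>i\<in>I. \<Sum>l\<in>I. ?d i * ?d l * (if i = l then 1 else 0)) = (\<Sum>i\<in>I. (?d i)\<^sup>2)"
    using I by (simp add: if_distrib sum.delta power2_eq_square cong: if_cong)
  ultimately have "((\<lambda>t. (trig_poly I j c t)\<^sup>2) has_integral (\<Sum>i\<in>I. (?d i)\<^sup>2)) {0..1}"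
    by simp
  then have "(\<integral>\<^sup>+t. ennreal ((trig_poly I j c t)\<^sup>2) * indicator {0..1} t \<partial>lborel) = ennreal (\<Sum>i\<in>I. (?d i)\<^sup>2)"
    by (rule nn_integral_has_integral_lebesgue'[rotated]) simp
  moreover have "(\<Sum>i\<in>I. (?d i)\<^sup>2) = (\<Sum>i\<in>I. (c i)\<^sup>2 * (2 * pi * real (fst i)) ^ (2 * j))"
    by (simp add: power_mult_distrib power_mult[symmetric] mult.commute)
  ultimately show ?thesis
    by (simp add: sq_norm_def)
qed

text \<open>The squared Sobolev norm of a normalised trigonometric function of frequency
  \<open>m\<close>. With these weights the Sobolev constraint on coefficients is an
  ellipsoid.\<close>

definition sobolev_weight :: "nat \<Rightarrow> nat \<Rightarrow> real" where
  "sobolev_weight k m = (\<Sum>j\<le>k. (2 * pi * real m) ^ (2 * j))"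

lemma trig_poly_in_sobolev_ball:
  assumes I: "finite I" "I \<subseteq> {1..} \<times> {0, 1}"
    and le: "(\<Sum>i\<in>I. sobolev_weight k (fst i) * (c i)\<^sup>2) \<le> r"
  shows "trig_poly I 0 c \<in> sobolev_ball k r"
proof -
  have per: "trig_poly I j c (t + 1) = trig_poly I j c t" for j t
    by (simp add: trig_poly_def trig_periodic)
  have "trig_poly I 0 c \<in> periodic_diff k"
    using per[of _ 0] differentiableI[OF trig_poly_has_derivative[unfolded has_field_derivative_def]]
    by (auto simp: periodic_diff_def deriv_trig_poly per)
  moreover have "(\<Sum>j\<le>k. sq_norm ((deriv ^^ j) (trig_poly I 0 c))) = ennreal (\<Sum>j\<le>k. \<Sum>i\<in>I. (c i)\<^sup>2 * (2 * pi * real (fst i)) ^ (2 * j))"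
    by (simp add: deriv_trig_poly sq_norm_trig_poly[OF I] sum_nonneg)
  moreover have "(\<Sum>j\<le>k. \<Sum>i\<in>I. (c i)\<^sup>2 * (2 * pi * real (fst i)) ^ (2 * j)) = (\<Sum>i\<in>I. sobolev_weight k (fst i) * (c i)\<^sup>2)"
    by (subst sum.swap) (simp add: sobolev_weight_def sum_distrib_left sum_distrib_right mult.commute)
  ultimately show ?thesis using le by (simp add: sobolev_ball_def ennreal_leI)
qed

lemma integral_trig_poly:
  assumes "finite I"
  shows "integral {0..t} (trig_poly I 0 c) = (\<Sum>i\<in>I. c i * integral {0..t} (trig (fst i) (snd i)))"
proof (rule integral_unique)
  have "((\<lambda>u. c i * trig (fst i) (snd i) u) has_integral c i * integral {0..t} (trig (fst i) (snd i))) {0..t}" for i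
    by (rule has_integral_mult_right[OF integrable_integral[OF integrable_continuous_real[OF continuous_on_trig]]])
  then have "((\<lambda>u. \<Sum>i\<in>I. c i * trig (fst i) (snd i) u) has_integral
      (\<Sum>i\<in>I. c i * integral {0..t} (trig (fst i) (snd i)))) {0..t}"
    by (rule has_integral_sum[OF assms])
  then show "(trig_poly I 0 c has_integral (\<Sum>i\<in>I. c i * integral {0..t} (trig (fst i) (snd i)))) {0..t}"
    by (simp add: trig_poly_def[abs_def])
qed

text \<open>Cauchy-Schwarz against the constant 1: the integral of the squared deviation of
  \<open>f\<close> from its mean is nonnegative.\<close>

lemma integral_squared_le:
  fixes f :: "real \<Rightarrow> real"
  assumes f: "continuous_on {a..b} f" and ab: "a < b"
  shows "(integral {a..b} f)\<^sup>2 \<le> (b - a) * integral {a..b} (\<lambda>t. (f t)\<^sup>2)"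
proof -
  let ?I = "integral {a..b} f" and ?Q = "integral {a..b} (\<lambda>t. (f t)\<^sup>2)"
  define \<mu> where "\<mu> = ?I / (b - a)"
  have 1: "(f has_integral ?I) {a..b}" "((\<lambda>t. (f t)\<^sup>2) has_integral ?Q) {a..b}"
    using f by (auto intro!: integrable_integral integrable_continuous_real continuous_intros)
  have "((\<lambda>t. (f t)\<^sup>2 - 2 * \<mu> * f t + \<mu>\<^sup>2) has_integral (?Q - 2 * \<mu> * ?I + \<mu>\<^sup>2 * (b - a))) {a..b}"
    using ab has_integral_const_real[of "\<mu>\<^sup>2" a b]
    by (intro has_integral_add has_integral_diff has_integral_mult_right 1) (simp add: mult.commute)
  moreover have "0 \<le> (f t)\<^sup>2 - 2 * \<mu> * f t + \<mu>\<^sup>2" for t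
    using zero_le_power2[of "f t - \<mu>"] by (simp add: power2_eq_square algebra_simps)
  ultimately have "0 \<le> ?Q - 2 * \<mu> * ?I + \<mu>\<^sup>2 * (b - a)"
    by (rule has_integral_nonneg)
  also have "\<dots> = ?Q - ?I\<^sup>2 / (b - a)"
    using ab by (simp add: \<mu>_def power2_eq_square)
  finally have "?I\<^sup>2 / (b - a) \<le> ?Q" by simp
  then show ?thesis using ab by (simp add: pos_divide_le_eq mult.commute)
qed

text \<open>Supplies the hypothesis on \<open>\<Phi>\<close> and \<open>\<Psi>\<close> in
  \<open>brownian_bayes_risk\<close>, with \<open>\<Phi>\<close> the integral of the basis function
  and \<open>\<Psi>\<close> that of its square.\<close>

lemma trig_increment_squared_le:
  assumes "0 \<le> a" "a < b"
  shows "(integral {0..b} (trig m l) - integral {0..a} (trig m l))\<^sup>2 \<le>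
    (b - a) * (integral {0..b} (\<lambda>t. (trig m l t)\<^sup>2) - integral {0..a} (\<lambda>t. (trig m l t)\<^sup>2))"
proof -
  have "integral {0..a} f + integral {a..b} f = integral {0..b} f" if "continuous_on UNIV f" for f :: "real \<Rightarrow> real"
    using assms that by (intro Henstock_Kurzweil_Integration.integral_combine integrable_continuous_real) (auto intro: continuous_on_subset)
  from this[of "trig m l"] this[of "\<lambda>t. (trig m l t)\<^sup>2"]
  have "integral {0..b} (trig m l) - integral {0..a} (trig m l) = integral {a..b} (trig m l)"
    "integral {0..b} (\<lambda>t. (trig m l t)\<^sup>2) - integral {0..a} (\<lambda>t. (trig m l t)\<^sup>2) = integral {a..b} (\<lambda>t. (trig m l t)\<^sup>2)"
    by (simp_all add: continuous_intros)
  then show ?thesis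
    using integral_squared_le[OF continuous_on_trig \<open>a < b\<close>, of m l] by simp
qed

text \<open>The oscillating part of the square completes whole periods. This value is the
  information \<open>n / \<sigma>\<^sup>2\<close> on each coefficient, up to the noise
  level.\<close>

lemma integral_trig_squared:
  assumes "m \<ge> 1"
  shows "integral {0..real n} (\<lambda>t. (trig m b t)\<^sup>2) = real n"
proof (rule integral_unique)
  let ?F = "\<lambda>t. t + sin (2 * pi * (2 * real m) * t + real b * pi) / (2 * pi * (2 * real m))"
  have sq: "(trig m b t)\<^sup>2 = 1 + cos (2 * pi * (2 * real m) * t + real b * pi)" for t
  proof -
    have "cos (2 * (2 * pi * real m * t + real b * (pi / 2))) = (trig m b t)\<^sup>2 - 1"
      unfolding cos_double_cos trig_def by (simp add: power_mult_distrib)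
    then show ?thesis by (simp add: algebra_simps)
  qed
  have "((\<lambda>t. (trig m b t)\<^sup>2) has_integral (?F (real n) - ?F 0)) {0..real n}"
  proof (rule fundamental_theorem_of_calculus)
    fix x :: real
    show "(?F has_vector_derivative (trig m b x)\<^sup>2) (at x within {0..real n})"
      using assms unfolding has_real_derivative_iff_has_vector_derivative[symmetric] sq
      by (auto intro!: derivative_eq_intros)
  qed simp
  moreover have "sin (2 * pi * (2 * real m) * real n + real b * pi) = sin (real b * pi)"
    using sin_int_shift[of "real b * pi" "int (2 * m * n)"] by (simp add: algebra_simps)
  ultimately show "((\<lambda>t. (trig m b t)\<^sup>2) has_integral real n) {0..real n}" by simp
qed

section \<open>Bessel's inequality for a finite orthonormal system\<close>

context
  fixes U :: "'a measure" and I :: "'i set" and \<phi> :: "'i \<Rightarrow> 'a \<Rightarrow> real"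
  assumes fin: "finite I" and meas: "\<And>i. i \<in> I \<Longrightarrow> \<phi> i \<in> borel_measurable U"
    and orthonormal: "\<And>i j. i \<in> I \<Longrightarrow> j \<in> I \<Longrightarrow> has_bochner_integral U (\<lambda>t. \<phi> i t * \<phi> j t) (if i = j then 1 else 0)"
begin

lemma bessel_inequality:
  assumes [measurable]: "f \<in> borel_measurable U" and f: "(\<integral>\<^sup>+t. ennreal ((f t)\<^sup>2) \<partial>U) < \<infinity>"
  shows "\<And>i. i \<in> I \<Longrightarrow> integrable U (\<lambda>t. f t * \<phi> i t)"
    and "ennreal (\<Sum>i\<in>I. (\<integral>t. f t * \<phi> i t \<partial>U)\<^sup>2) \<le> (\<integral>\<^sup>+t. ennreal ((f t)\<^sup>2) \<partial>U)"
proof -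
  define q where "q = (\<integral>t. (f t)\<^sup>2 \<partial>U)"
  define c where "c i = (\<integral>t. f t * \<phi> i t \<partial>U)" for i
  have if2: "integrable U (\<lambda>t. (f t)\<^sup>2)"
    using f by (simp add: integrable_iff_bounded)
  then have q: "has_bochner_integral U (\<lambda>t. (f t)\<^sup>2) q" by (simp add: q_def has_bochner_integral_iff)
  show int: "integrable U (\<lambda>t. f t * \<phi> i t)" if i: "i \<in> I" for i
  proof -
    have [measurable]: "\<phi> i \<in> borel_measurable U" using i by (rule meas)
    have "integrable U (\<lambda>t. (f t)\<^sup>2 + \<phi> i t * \<phi> i t)"
      using if2 orthonormal[OF i i] by (auto simp: has_bochner_integral_iff)
    then show "integrable U (\<lambda>t. f t * \<phi> i t)"
    proof (rule Bochner_Integration.integrable_bound)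
      have "\<bar>x * y\<bar> \<le> x\<^sup>2 + y * y" for x y :: real
      proof -
        have "2 * \<bar>x * y\<bar> \<le> x\<^sup>2 + y * y"
          using sum_squares_bound[of "\<bar>x\<bar>" "\<bar>y\<bar>"] by (simp add: abs_mult power2_eq_square mult.assoc)
        then show ?thesis using abs_ge_zero[of "x * y"] by linarith
      qed
      then show "AE t in U. norm (f t * \<phi> i t) \<le> norm ((f t)\<^sup>2 + \<phi> i t * \<phi> i t)"
        by (intro AE_I2) (auto intro: order_trans)
    qed simp
  qed
  have c: "has_bochner_integral U (\<lambda>t. f t * \<phi> i t) (c i)" if "i \<in> I" for i
    using int[OF that] by (simp add: c_def has_bochner_integral_iff)
  \<comment> \<open>The squared residual of the projection, expanded into terms with known
    integrals.\<close>
  have "has_bochner_integral U (\<lambda>t. (f t)\<^sup>2 - 2 * (\<Sum>i\<in>I. c i * (f t * \<phi> i t)) + (\<Sum>i\<in>I. \<Sum>j\<in>I. c i * c j * (\<phi> i t * \<phi> j t)))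
    (q - 2 * (\<Sum>i\<in>I. c i * c i) + (\<Sum>i\<in>I. \<Sum>j\<in>I. c i * c j * (if i = j then 1 else 0)))"
    by (intro has_bochner_integral_add has_bochner_integral_diff has_bochner_integral_mult_right has_bochner_integral_sum q c orthonormal)
  also have "(\<Sum>i\<in>I. \<Sum>j\<in>I. c i * c j * (if i = j then 1 else 0)) = (\<Sum>i\<in>I. c i * c i)"
    using fin by (simp add: if_distrib sum.delta cong: if_cong)
  also have "(\<lambda>t. (f t)\<^sup>2 - 2 * (\<Sum>i\<in>I. c i * (f t * \<phi> i t)) + (\<Sum>i\<in>I. \<Sum>j\<in>I. c i * c j * (\<phi> i t * \<phi> j t)))
     = (\<lambda>t. (f t - (\<Sum>i\<in>I. c i * \<phi> i t))\<^sup>2)"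
    by (simp add: fun_eq_iff power2_diff power2_eq_square[of "sum _ _"] sum_product sum_distrib_left mult_ac)
  finally have ex: "has_bochner_integral U (\<lambda>t. (f t - (\<Sum>i\<in>I. c i * \<phi> i t))\<^sup>2) (q - 2 * (\<Sum>i\<in>I. c i * c i) + (\<Sum>i\<in>I. c i * c i))" .
  have "0 \<le> (\<integral>t. (f t - (\<Sum>i\<in>I. c i * \<phi> i t))\<^sup>2 \<partial>U)" by simp
  then have "(\<Sum>i\<in>I. (c i)\<^sup>2) \<le> q"
    unfolding has_bochner_integral_integral_eq[OF ex] by (simp add: power2_eq_square)
  also have "ennreal q = (\<integral>\<^sup>+t. ennreal ((f t)\<^sup>2) \<partial>U)"
    using if2 by (simp add: q_def nn_integral_eq_integral)
  finally show "ennreal (\<Sum>i\<in>I. (\<integral>t. f t * \<phi> i t \<partial>U)\<^sup>2) \<le> (\<integral>\<^sup>+t. ennreal ((f t)\<^sup>2) \<partial>U)"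
    by (simp add: c_def ennreal_leI)
qed

text \<open>An estimator may have infinite norm, so only measurability of \<open>f\<close> is asked.
  If the right-hand side is finite, Bessel's inequality applies to the difference \<open>h\<close>,
  whose coefficients are those of \<open>f\<close> minus \<open>\<theta>\<close>.\<close>

lemma bessel_inequality_shifted:
  assumes [measurable]: "f \<in> borel_measurable U"
  shows "ennreal (\<Sum>i\<in>I. ((\<integral>t. f t * \<phi> i t \<partial>U) - \<theta> i)\<^sup>2) \<le> (\<integral>\<^sup>+t. ennreal ((f t - (\<Sum>i\<in>I. \<theta> i * \<phi> i t))\<^sup>2) \<partial>U)"
proof (cases "(\<integral>\<^sup>+t. ennreal ((f t - (\<Sum>i\<in>I. \<theta> i * \<phi> i t))\<^sup>2) \<partial>U) < \<infinity>")
  case True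
  define h where "h t = f t - (\<Sum>i\<in>I. \<theta> i * \<phi> i t)" for t
  have h: "h \<in> borel_measurable U" unfolding h_def using meas by measurable
  have "(\<integral>t. f t * \<phi> i t \<partial>U) - \<theta> i = (\<integral>t. h t * \<phi> i t \<partial>U)" if i: "i \<in> I" for i
  proof -
    have 1: "has_bochner_integral U (\<lambda>t. \<Sum>j\<in>I. \<theta> j * (\<phi> j t * \<phi> i t)) (\<Sum>j\<in>I. \<theta> j * (if j = i then 1 else 0))"
      using i by (intro has_bochner_integral_sum has_bochner_integral_mult_right orthonormal)
    have 2: "integrable U (\<lambda>t. h t * \<phi> i t)"
      using True i by (intro bessel_inequality(1) h) (auto simp: h_def)
    have "has_bochner_integral U (\<lambda>t. h t * \<phi> i t + (\<Sum>j\<in>I. \<theta> j * (\<phi> j t * \<phi> i t)))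
       ((\<integral>t. h t * \<phi> i t \<partial>U) + \<theta> i)"
      using has_bochner_integral_add[OF has_bochner_integral_integrable[OF 2] 1] i fin
      by (simp add: if_distrib sum.delta cong: if_cong)
    also have "(\<lambda>t. h t * \<phi> i t + (\<Sum>j\<in>I. \<theta> j * (\<phi> j t * \<phi> i t))) = (\<lambda>t. f t * \<phi> i t)"
      by (simp add: h_def fun_eq_iff left_diff_distrib sum_distrib_right mult.assoc)
    finally show ?thesis by (simp add: has_bochner_integral_iff)
  qed
  then have "(\<Sum>i\<in>I. ((\<integral>t. f t * \<phi> i t \<partial>U) - \<theta> i)\<^sup>2) = (\<Sum>i\<in>I. (\<integral>t. h t * \<phi> i t \<partial>U)\<^sup>2)"
    by (intro sum.cong) auto
  with bessel_inequality(2)[OF h] True show ?thesis by (simp add: h_def)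
next
  case False
  then have "(\<integral>\<^sup>+t. ennreal ((f t - (\<Sum>i\<in>I. \<theta> i * \<phi> i t))\<^sup>2) \<partial>U) = top"
    by (simp add: less_top[symmetric])
  then show ?thesis by simp
qed

end

abbreviation unit_interval :: "real measure" where
  "unit_interval \<equiv> restrict_space lborel {0..1}"

lemma sq_norm_eq: "sq_norm f = (\<integral>\<^sup>+t. ennreal ((f t)\<^sup>2) \<partial>unit_interval)"
  by (simp add: sq_norm_def nn_integral_restrict_space)

lemma trig_orthonormal_unit_interval:
  assumes "i \<in> {1..} \<times> {0, 1}" "j \<in> {1..} \<times> {0, 1}"
  shows "has_bochner_integral unit_interval (\<lambda>t. trig (fst i) (snd i) t * trig (fst j) (snd j) t) (if i = j then 1 else 0)"
proof -
  let ?f = "\<lambda>t. trig (fst i) (snd i) t * trig (fst j) (snd j) t"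
  have "set_integrable lborel {0..1} ?f"
    by (intro borel_integrable_atLeastAtMost' continuous_intros)
  from set_borel_integral_eq_integral[OF this] integral_unique[OF trig_orthonormal[OF assms, of 0]] this
  show ?thesis
    by (simp add: has_bochner_integral_iff integrable_restrict_space integral_restrict_space
        set_integrable_def set_lebesgue_integral_def)
qed

text \<open>Lets every estimator of the function be judged by its finitely many coefficients on
  \<open>I\<close>, at no increase of the loss.\<close>

lemma trig_poly_bessel:
  assumes I: "finite I" "I \<subseteq> {1..} \<times> {0, 1}" and f: "f \<in> borel_measurable unit_interval"
  shows "ennreal (\<Sum>i\<in>I. ((\<integral>t. f t * trig (fst i) (snd i) t \<partial>unit_interval) - \<theta> i)\<^sup>2)
    \<le> sq_norm (\<lambda>t. f t - trig_poly I 0 \<theta> t)"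
  using bessel_inequality_shifted[of I "\<lambda>i. trig (fst i) (snd i)" unit_interval f \<theta>] I f
    trig_orthonormal_unit_interval measurable_restrict_space1[OF trig_measurable[unfolded measurable_lborel1[symmetric]]]
  by (simp add: sq_norm_eq trig_poly_def subset_eq)

section \<open>Minimax risk in Gaussian white noise\<close>

lemma gaussian_quadratic_second_moment:
  assumes s: "s > 0"
  shows "(\<integral>\<^sup>+y. ennreal ((c + a * (y\<^sup>2 - s\<^sup>2))\<^sup>2) \<partial>gaussian 0 s) = ennreal (c\<^sup>2 + 2 * a\<^sup>2 * s ^ 4)"
proof -
  have 4: "has_bochner_integral lborel (\<lambda>x. normal_density 0 s x * x ^ 4) (3 * s ^ 4)"
    using normal_moment_even[OF s, of 0 2] by (simp add: fact_numeral field_simps power_mult[symmetric])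
  have 2: "has_bochner_integral lborel (\<lambda>x. normal_density 0 s x * x\<^sup>2) (s\<^sup>2)"
    using normal_moment_even[OF s, of 0 1] by (simp add: field_simps power2_eq_square)
  have 0: "has_bochner_integral lborel (normal_density 0 s) 1"
    using s by (simp add: has_bochner_integral_iff)
  let ?d = "c - a * s\<^sup>2"
  have "has_bochner_integral lborel (\<lambda>x. a\<^sup>2 * (normal_density 0 s x * x ^ 4) +
      2 * a * ?d * (normal_density 0 s x * x\<^sup>2) + ?d\<^sup>2 * normal_density 0 s x)
      (a\<^sup>2 * (3 * s ^ 4) + 2 * a * ?d * s\<^sup>2 + ?d\<^sup>2 * 1)"
    by (intro has_bochner_integral_add has_bochner_integral_mult_right 0 2 4)
  also have "(\<lambda>x. a\<^sup>2 * (normal_density 0 s x * x ^ 4) +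
      2 * a * ?d * (normal_density 0 s x * x\<^sup>2) + ?d\<^sup>2 * normal_density 0 s x) =
      (\<lambda>x. normal_density 0 s x * (c + a * (x\<^sup>2 - s\<^sup>2))\<^sup>2)"
    by (simp add: fun_eq_iff power2_eq_square power4_eq_xxxx algebra_simps)
  also have "a\<^sup>2 * (3 * s ^ 4) + 2 * a * ?d * s\<^sup>2 + ?d\<^sup>2 * 1 = c\<^sup>2 + 2 * a\<^sup>2 * s ^ 4"
    by (simp add: power2_eq_square power4_eq_xxxx algebra_simps)
  finally have "(\<integral>\<^sup>+x. ennreal (normal_density 0 s x * (c + a * (x\<^sup>2 - s\<^sup>2))\<^sup>2) \<partial>lborel) = ennreal (c\<^sup>2 + 2 * a\<^sup>2 * s ^ 4)"
    by (subst nn_integral_eq_integral) (auto simp: has_bochner_integral_iff)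
  then show ?thesis
    by (simp add: nn_integral_density ennreal_mult)
qed

lemma product_sigma_finite_gaussian: "product_sigma_finite (\<lambda>i. gaussian (m i) (s i))"
  by (simp add: product_sigma_finite_def sigma_finite_gaussian)

text \<open>Centred squares of independent normals are uncorrelated, so their variances
  \<open>2 * s^4\<close> add up. The constant \<open>c\<close> is free because the induction absorbs
  a fixed coordinate into it.\<close>

lemma gaussian_quadratic_form_second_moment:
  fixes a s :: "'i \<Rightarrow> real"
  assumes "finite I" and s: "\<And>i. s i > 0"
  shows "(\<integral>\<^sup>+x. ennreal ((c + (\<Sum>i\<in>I. a i * ((x i)\<^sup>2 - (s i)\<^sup>2)))\<^sup>2) \<partial>Pi\<^sub>M I (\<lambda>i. gaussian 0 (s i)))
    = ennreal (c\<^sup>2 + (\<Sum>i\<in>I. 2 * (a i)\<^sup>2 * s i ^ 4))"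
  using assms(1)
proof (induction I arbitrary: c rule: finite_induct)
  case empty
  interpret P: prob_space "Pi\<^sub>M {} (\<lambda>i. gaussian 0 (s i))"
    by (rule prob_spaceI) (simp add: space_PiM emeasure_PiM_empty)
  show ?case by (simp add: P.emeasure_space_1)
next
  case (insert i I)
  interpret P: product_sigma_finite "\<lambda>i. gaussian 0 (s i)"
    by (rule product_sigma_finite_gaussian)
  have e: "(\<Sum>j\<in>insert i I. a j * (((x(i := y)) j)\<^sup>2 - (s j)\<^sup>2)) =
      a i * (y\<^sup>2 - (s i)\<^sup>2) + (\<Sum>j\<in>I. a j * ((x j)\<^sup>2 - (s j)\<^sup>2))" for x y
  proof -
    have "(\<Sum>j\<in>I. a j * (((x(i := y)) j)\<^sup>2 - (s j)\<^sup>2)) = (\<Sum>j\<in>I. a j * ((x j)\<^sup>2 - (s j)\<^sup>2))"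
      using insert.hyps by (intro sum.cong) auto
    then show ?thesis using insert.hyps by simp
  qed
  let ?v = "\<Sum>i\<in>I. 2 * (a i)\<^sup>2 * s i ^ 4"
  have v: "?v \<ge> 0" by (intro sum_nonneg) auto
  have "(\<integral>\<^sup>+x. ennreal ((c + (\<Sum>j\<in>insert i I. a j * ((x j)\<^sup>2 - (s j)\<^sup>2)))\<^sup>2) \<partial>Pi\<^sub>M (insert i I) (\<lambda>i. gaussian 0 (s i)))
    = (\<integral>\<^sup>+y. \<integral>\<^sup>+x. ennreal (((c + a i * (y\<^sup>2 - (s i)\<^sup>2)) + (\<Sum>j\<in>I. a j * ((x j)\<^sup>2 - (s j)\<^sup>2)))\<^sup>2)
        \<partial>Pi\<^sub>M I (\<lambda>i. gaussian 0 (s i)) \<partial>gaussian 0 (s i))"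
    using insert.hyps by (subst P.product_nn_integral_insert_rev) (auto simp: e add.assoc simp del: fun_upd_apply)
  also have "\<dots> = (\<integral>\<^sup>+y. ennreal ((c + a i * (y\<^sup>2 - (s i)\<^sup>2))\<^sup>2) + ennreal ?v \<partial>gaussian 0 (s i))"
    unfolding insert.IH using v by simp
  also have "\<dots> = (\<integral>\<^sup>+y. ennreal ((c + a i * (y\<^sup>2 - (s i)\<^sup>2))\<^sup>2) \<partial>gaussian 0 (s i)) + ennreal ?v"
    using prob_space.emeasure_space_1[OF prob_space_normal_density[OF s[of i], of 0]]
    by (subst nn_integral_add) auto
  also have "\<dots> = ennreal (c\<^sup>2 + (\<Sum>j\<in>insert i I. 2 * (a j)\<^sup>2 * s j ^ 4))"
    using insert.hyps v s[of i] by (simp add: gaussian_quadratic_second_moment add.assoc flip: ennreal_plus)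
  finally show ?case .
qed

text \<open>
  Under the Gaussian prior the weighted sum \<open>V\<close> of squares has mean \<open>E\<close>, and outside the
  ellipsoid it exceeds its mean by at least \<open>\<eta> r\<close>; this yields the constant 12.
\<close>

lemma quadratic_tail_bound:
  fixes V E r \<eta> :: real
  assumes r: "r > 0" and \<eta>: "0 < \<eta>" "\<eta> \<le> 1" and E: "E \<le> (1 - \<eta>) * r" and V: "V > r"
  shows "8 * r + 2 * V \<le> 12 / (\<eta>\<^sup>2 * r) * (V - E)\<^sup>2"
proof -
  define t where "t = V - E"
  have t: "t \<ge> \<eta> * r" using E V by (simp add: t_def algebra_simps)
  have \<eta>r: "\<eta> * r > 0" using r \<eta> by simp
  have sq: "(\<eta> * r)\<^sup>2 \<le> t\<^sup>2" using t \<eta>r by (intro power_mono) auto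
  have "\<eta> * r * t \<le> t\<^sup>2" using t \<eta>r by (simp add: power2_eq_square mult_right_mono)
  moreover have "\<eta> * (\<eta> * r * t) \<le> 1 * (\<eta> * r * t)"
    using order_trans[OF less_imp_le[OF \<eta>r] t] \<eta> r by (intro mult_right_mono mult_nonneg_nonneg) auto
  then have "\<eta>\<^sup>2 * r * t \<le> \<eta> * r * t"
    by (simp only: power2_eq_square mult.assoc mult_1)
  ultimately have 2: "\<eta>\<^sup>2 * r * t \<le> t\<^sup>2" by simp
  \<comment> \<open>\<open>V = E + t\<close> with \<open>E \<le> r\<close>. Then \<open>r\<close>
    and \<open>t\<close> are both at most \<open>t\<^sup>2 / (\<eta>\<^sup>2 * r)\<close>, and the
    coefficients 10 and 2 add up to 12.\<close>
  have "(8 * r + 2 * V) * (\<eta>\<^sup>2 * r) \<le> (10 * r + 2 * t) * (\<eta>\<^sup>2 * r)"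
  proof (rule mult_right_mono)
    have "(1 - \<eta>) * r \<le> r" using \<eta> r by simp
    then show "8 * r + 2 * V \<le> 10 * r + 2 * t" using E by (simp add: t_def)
  qed (use r in simp)
  also have "\<dots> = 10 * (\<eta> * r)\<^sup>2 + 2 * (\<eta>\<^sup>2 * r * t)" by (simp add: power2_eq_square algebra_simps)
  also have "\<dots> \<le> 12 * t\<^sup>2" using sq 2 by simp
  finally show ?thesis using r \<eta> by (simp add: t_def pos_le_divide_eq)
qed

text \<open>A point outside the ball of radius \<open>2 * sqrt q\<close> has distance at least
  \<open>sqrt q\<close> from \<open>\<theta>\<close>, so the origin is no farther from
  \<open>\<theta>\<close>. Truncation is thus free for parameters in the ball of squared radius
  \<open>q\<close>.\<close>

lemma truncated_distance_le:
  fixes d \<theta> :: "'i \<Rightarrow> real"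
  assumes fin: "finite I" and \<theta>: "(\<Sum>i\<in>I. (\<theta> i)\<^sup>2) \<le> q"
  shows "(\<Sum>i\<in>I. ((if (\<Sum>j\<in>I. (d j)\<^sup>2) \<le> 4 * q then d i else 0) - \<theta> i)\<^sup>2) \<le> (\<Sum>i\<in>I. (d i - \<theta> i)\<^sup>2)"
proof (cases "(\<Sum>j\<in>I. (d j)\<^sup>2) \<le> 4 * q")
  case False
  \<comment> \<open>Outside the ball, half the squared norm of \<open>d\<close> exceeds
    \<open>2 * q\<close>, which pays for twice the squared norm of \<open>\<theta>\<close>.\<close>
  have "(\<Sum>i\<in>I. (d i)\<^sup>2 / 2 - 2 * (\<theta> i)\<^sup>2 + (\<theta> i)\<^sup>2) \<le> (\<Sum>i\<in>I. (d i - \<theta> i)\<^sup>2)"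
  proof (rule sum_mono)
    fix i
    have "0 \<le> (d i - 2 * \<theta> i)\<^sup>2" by simp
    then show "(d i)\<^sup>2 / 2 - 2 * (\<theta> i)\<^sup>2 + (\<theta> i)\<^sup>2 \<le> (d i - \<theta> i)\<^sup>2"
      by (simp add: power2_eq_square algebra_simps)
  qed
  moreover have "(\<Sum>i\<in>I. (d i)\<^sup>2 / 2 - 2 * (\<theta> i)\<^sup>2 + (\<theta> i)\<^sup>2) =
      (\<Sum>i\<in>I. (d i)\<^sup>2) / 2 - 2 * (\<Sum>i\<in>I. (\<theta> i)\<^sup>2) + (\<Sum>i\<in>I. (\<theta> i)\<^sup>2)"
    by (simp add: sum.distrib sum_subtractf sum_distrib_left sum_divide_distrib)
  ultimately show ?thesis using False \<theta> by simp
qed simp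

lemma sum_squared_diff_le:
  fixes d \<theta> :: "'i \<Rightarrow> real"
  shows "(\<Sum>i\<in>I. (d i - \<theta> i)\<^sup>2) \<le> 2 * (\<Sum>i\<in>I. (d i)\<^sup>2) + 2 * (\<Sum>i\<in>I. (\<theta> i)\<^sup>2)"
proof -
  have "(\<Sum>i\<in>I. (d i - \<theta> i)\<^sup>2) \<le> (\<Sum>i\<in>I. 2 * (d i)\<^sup>2 + 2 * (\<theta> i)\<^sup>2)"
  proof (rule sum_mono)
    fix i
    have "0 \<le> (d i + \<theta> i)\<^sup>2" by simp
    then show "(d i - \<theta> i)\<^sup>2 \<le> 2 * (d i)\<^sup>2 + 2 * (\<theta> i)\<^sup>2"
      by (simp add: power2_eq_square algebra_simps)
  qed
  then show ?thesis by (simp add: sum.distrib sum_distrib_left)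
qed

section \<open>The white noise model and its Bayes risk\<close>

definition white_noise_path ::
    "(real \<Rightarrow> 'w \<Rightarrow> real) \<Rightarrow> real \<Rightarrow> real \<Rightarrow> (real \<Rightarrow> real) \<Rightarrow> 'w \<Rightarrow> real \<Rightarrow> real" where
  "white_noise_path w T \<sigma> S \<omega> = (\<lambda>t\<in>{0..T}. integral {0..t} S + \<sigma> * w t \<omega>)"

definition white_noise_risk ::
    "'w measure \<Rightarrow> (real \<Rightarrow> 'w \<Rightarrow> real) \<Rightarrow> real \<Rightarrow> real \<Rightarrow> ((real \<Rightarrow> real) \<Rightarrow> real \<Rightarrow> real) \<Rightarrow> (real \<Rightarrow> real) \<Rightarrow> ennreal" where
  "white_noise_risk M w T \<sigma> Shat S =
     (\<integral>\<^sup>+\<omega>. sq_norm (\<lambda>t. Shat (white_noise_path w T \<sigma> S \<omega>) t - S t) \<partial>M)"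

lemma estimator_measurable:
  assumes "Shat \<in> estimators T"
  shows "case_prod Shat \<in> borel_measurable (skorokhod T \<Otimes>\<^sub>M unit_interval)"
proof -
  have "sets (skorokhod T \<Otimes>\<^sub>M unit_interval) = sets (skorokhod T \<Otimes>\<^sub>M restrict_space borel {0..1})"
    by (intro sets_pair_measure_cong refl sets_restrict_space_cong) simp
  from measurable_cong_sets[OF this refl] show ?thesis
    using assms unfolding estimators_def by blast
qed

lemma sigma_finite_unit_interval: "sigma_finite_measure unit_interval"
  by (intro sigma_finite_measure_restrict_space lborel.sigma_finite_measure_axioms) simp

lemma estimator_coefficient_measurable:
  assumes "Shat \<in> estimators T"
  shows "(\<lambda>y. \<integral>t. Shat y t * trig m b t \<partial>unit_interval) \<in> borel_measurable (skorokhod T)"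
proof -
  interpret sigma_finite_measure unit_interval by (rule sigma_finite_unit_interval)
  note [measurable] = estimator_measurable[OF assms]
  have [measurable]: "trig m b \<in> borel_measurable unit_interval"
    by (intro measurable_restrict_space1) simp
  show ?thesis by measurable
qed

text \<open>
  The risk integrated over the prior splits into the part over the ellipsoid, bounded by the
  supremum, and a tail that is small because the coefficients of the estimator may be truncated:
  the ellipsoid lies in the Euclidean ball of squared radius \<open>r / \<alpha>\<close>.
\<close>

lemma white_noise_minimax_lower_bound:
  fixes s :: "nat \<times> nat \<Rightarrow> real" and k :: nat
  defines "a \<equiv> \<lambda>i. sobolev_weight k (fst i)"
  assumes w: "standard_brownian_motion M w" and \<sigma>: "\<sigma> > 0" and n: "n \<ge> 1"
    and Shat: "Shat \<in> estimators (real n)"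
    and I: "finite I" "I \<subseteq> {1..} \<times> {0, 1}" and s: "\<And>i. s i > 0"
    and r: "r > 0" and \<eta>: "0 < \<eta>" "\<eta> \<le> 1"
    and \<alpha>: "\<alpha> > 0" "\<And>i. i \<in> I \<Longrightarrow> \<alpha> \<le> a i"
    and mean: "(\<Sum>i\<in>I. a i * (s i)\<^sup>2) \<le> (1 - \<eta>) * r"
  shows "ennreal (\<Sum>i\<in>I. 1 / (1 / (s i)\<^sup>2 + real n / \<sigma>\<^sup>2)) \<le>
    (SUP S\<in>sobolev_ball k r. white_noise_risk M w (real n) \<sigma> Shat S) +
    ennreal (12 / (\<alpha> * \<eta>\<^sup>2 * r) * (\<Sum>i\<in>I. 2 * (a i)\<^sup>2 * s i ^ 4))"
proof -
  interpret M: prob_space M using w by (rule brownian_prob_space)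
  interpret P: product_sigma_finite "\<lambda>i. gaussian 0 (s i)" by (rule product_sigma_finite_gaussian)
  have pg: "prob_space (gaussian 0 (s i))" for i using s by (rule prob_space_normal_density)
  interpret PP: product_prob_space "\<lambda>i. gaussian 0 (s i)" I
    using pg by (auto simp: product_prob_space_def product_prob_space_axioms_def product_sigma_finite_gaussian)
  define prior where "prior = Pi\<^sub>M I (\<lambda>i. gaussian 0 (s i))"
  interpret prior: prob_space prior unfolding prior_def by (rule PP.prob_space_axioms)
  have sets_prior [measurable_cong]: "sets prior = sets (Pi\<^sub>M I (\<lambda>_. borel))"
    unfolding prior_def by (rule sets_PiM_gaussian)
  have fin [simp]: "finite I" by fact
  define q where "q = r / \<alpha>"
  have q: "q > 0" using r \<alpha> by (simp add: q_def)
  \<comment> \<open>The Bochner integral is 0 when the product is not integrable, so the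
    coefficients are defined on every path.\<close>
  define d where "d i y = (\<integral>t. Shat y t * trig (fst i) (snd i) t \<partial>unit_interval)" for i y
  have d_meas [measurable]: "d i \<in> borel_measurable (skorokhod (real n))" for i
    unfolding d_def by (rule estimator_coefficient_measurable) fact
  \<comment> \<open>Bounded, as \<open>brownian_bayes_risk\<close> requires, and with controlled
    loss also for parameters outside the ellipsoid.\<close>
  define d' where "d' i y = (if (\<Sum>j\<in>I. (d j y)\<^sup>2) \<le> 4 * q then d i y else 0)" for i y
  have d'_meas [measurable]: "d' i \<in> borel_measurable (skorokhod (real n))" for i
    unfolding d'_def by measurable
  have d'_sum: "(\<Sum>i\<in>I. (d' i y)\<^sup>2) \<le> 4 * q" for y
    using q by (cases "(\<Sum>j\<in>I. (d j y)\<^sup>2) \<le> 4 * q") (simp_all add: d'_def)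
  have d'_bdd: "\<bar>d' i y\<bar> \<le> sqrt (4 * q)" if "i \<in> I" for i y
  proof -
    have "(d' i y)\<^sup>2 \<le> (\<Sum>i\<in>I. (d' i y)\<^sup>2)" using that by (intro member_le_sum) auto
    with d'_sum[of y] have "(d' i y)\<^sup>2 \<le> 4 * q" by linarith
    then show ?thesis by (metis real_sqrt_abs real_sqrt_le_iff)
  qed
  define \<Phi> where "\<Phi> i t = integral {0..t} (trig (fst i) (snd i))" for i t
  have \<Phi>_cont: "continuous_on {0..real n} (\<Phi> i)" for i
    unfolding \<Phi>_def by (intro indefinite_integral_continuous_1 integrable_continuous_real continuous_on_trig)
  \<comment> \<open>The white noise path of the trigonometric polynomial, written as affine in
    \<open>\<theta>\<close> so that a single coefficient can be split off; it makes sense for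
    parameters outside the ellipsoid as well.\<close>
  define Y where "Y \<theta> \<omega> = (\<lambda>t\<in>{0..real n}. (\<Sum>i\<in>I. \<theta> i * \<Phi> i t) + \<sigma> * w t \<omega>)" for \<theta> \<omega>
  have Y_eq: "Y \<theta> = white_noise_path w (real n) \<sigma> (trig_poly I 0 \<theta>)" for \<theta>
    by (simp add: Y_def white_noise_path_def fun_eq_iff integral_trig_poly \<Phi>_def)
  have Y_meas: "(\<lambda>p. Y (f p) (g p)) \<in> measurable N (skorokhod (real n))"
    if f: "f \<in> measurable N prior" and g: "g \<in> measurable N M" for f g and N :: "'x measure"
    unfolding Y_def
  proof (rule measurable_continuous_path)
    fix t assume t: "t \<in> {0..real n}"
    then have [measurable]: "w t \<in> borel_measurable M" using brownian_measurable[OF w] by auto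
    note [measurable] = f g
    have [measurable]: "(\<lambda>p. f p i) \<in> borel_measurable N" if "i \<in> I" for i
      using measurable_compose[OF f[unfolded measurable_cong_sets[OF refl sets_prior]] measurable_component_singleton[OF that]] .
    show "(\<lambda>p. (\<Sum>i\<in>I. f p i * \<Phi> i t) + \<sigma> * w t (g p)) \<in> borel_measurable N"
      by measurable
  next
    fix p assume "p \<in> space N"
    then have "g p \<in> space M" using measurable_space[OF g] by auto
    then show "continuous_on {0..real n} (\<lambda>t. (\<Sum>i\<in>I. f p i * \<Phi> i t) + \<sigma> * w t (g p))"
      using \<Phi>_cont brownian_continuous[OF w] by (intro continuous_intros) auto
  qed
  have Y_meas2 [measurable]: "(\<lambda>p. Y (fst p) (snd p)) \<in> measurable (prior \<Otimes>\<^sub>M M) (skorokhod (real n))"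
    by (rule Y_meas) measurable
  have Y_meas1 [measurable]: "Y \<theta> \<in> measurable M (skorokhod (real n))" if "\<theta> \<in> space prior" for \<theta>
    using that by (intro Y_meas) auto
  define R where "R \<theta> = (\<integral>\<^sup>+\<omega>. ennreal (\<Sum>i\<in>I. (d' i (Y \<theta> \<omega>) - \<theta> i)\<^sup>2) \<partial>M)" for \<theta>
  define V where "V \<theta> = (\<Sum>i\<in>I. a i * (\<theta> i)\<^sup>2)" for \<theta>
  define E where "E = (\<Sum>i\<in>I. a i * (s i)\<^sup>2)"
  define U where "U = (SUP S\<in>sobolev_ball k r. white_noise_risk M w (real n) \<sigma> Shat S)"
  have norm_le: "(\<Sum>i\<in>I. (\<theta> i)\<^sup>2) \<le> V \<theta> / \<alpha>" for \<theta>
  proof -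
    have "\<alpha> * (\<Sum>i\<in>I. (\<theta> i)\<^sup>2) \<le> V \<theta>"
      unfolding V_def sum_distrib_left using \<alpha> by (intro sum_mono mult_right_mono) auto
    then show ?thesis using \<alpha> by (simp add: pos_le_divide_eq mult.commute)
  qed
  \<comment> \<open>Inside the ellipsoid, truncation and Bessel's inequality reduce \<open>R\<close>
    to the risk of \<open>Shat\<close>. Outside, the loss is at most
    \<open>8 * q + 2 * V \<theta> / \<alpha>\<close>, which \<open>quadratic_tail_bound\<close>
    dominates by the squared deviation of \<open>V\<close> from its mean.\<close>
  have R_le: "R \<theta> \<le> U + ennreal (12 / (\<alpha> * \<eta>\<^sup>2 * r) * (V \<theta> - E)\<^sup>2)" if \<theta>: "\<theta> \<in> space prior" for \<theta>
  proof (cases "V \<theta> \<le> r")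
    case True
    have "V \<theta> / \<alpha> \<le> q" using True \<alpha> by (simp add: q_def divide_right_mono)
    with norm_le have nq: "(\<Sum>i\<in>I. (\<theta> i)\<^sup>2) \<le> q" by (rule order_trans)
    have "R \<theta> \<le> white_noise_risk M w (real n) \<sigma> Shat (trig_poly I 0 \<theta>)"
      unfolding R_def white_noise_risk_def Y_eq[symmetric]
    proof (rule nn_integral_mono)
      fix \<omega> assume \<omega>: "\<omega> \<in> space M"
      have y: "Y \<theta> \<omega> \<in> space (skorokhod (real n))"
        using measurable_space[OF Y_meas1[OF \<theta>] \<omega>] .
      have f: "Shat (Y \<theta> \<omega>) \<in> borel_measurable unit_interval"
        using measurable_Pair2[OF estimator_measurable[OF Shat] y] by simp
      have "(\<Sum>i\<in>I. (d' i (Y \<theta> \<omega>) - \<theta> i)\<^sup>2) \<le> (\<Sum>i\<in>I. (d i (Y \<theta> \<omega>) - \<theta> i)\<^sup>2)"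
        unfolding d'_def by (rule truncated_distance_le) (use nq in auto)
      then have "ennreal (\<Sum>i\<in>I. (d' i (Y \<theta> \<omega>) - \<theta> i)\<^sup>2) \<le> ennreal (\<Sum>i\<in>I. (d i (Y \<theta> \<omega>) - \<theta> i)\<^sup>2)"
        by (rule ennreal_leI)
      also have "\<dots> \<le> sq_norm (\<lambda>t. Shat (Y \<theta> \<omega>) t - trig_poly I 0 \<theta> t)"
        unfolding d_def by (rule trig_poly_bessel[OF I f])
      finally show "ennreal (\<Sum>i\<in>I. (d' i (Y \<theta> \<omega>) - \<theta> i)\<^sup>2) \<le> sq_norm (\<lambda>t. Shat (Y \<theta> \<omega>) t - trig_poly I 0 \<theta> t)" .
    qed
    also have "\<dots> \<le> U"
      unfolding U_def using True I by (intro SUP_upper trig_poly_in_sobolev_ball) (auto simp: V_def a_def)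
    finally show ?thesis by (simp add: add_increasing2)
  next
    case False
    have "(\<Sum>i\<in>I. (d' i y - \<theta> i)\<^sup>2) \<le> 12 / (\<alpha> * \<eta>\<^sup>2 * r) * (V \<theta> - E)\<^sup>2" for y
    proof -
      have "(\<Sum>i\<in>I. (d' i y - \<theta> i)\<^sup>2) \<le> 2 * (\<Sum>i\<in>I. (d' i y)\<^sup>2) + 2 * (\<Sum>i\<in>I. (\<theta> i)\<^sup>2)"
        by (rule sum_squared_diff_le)
      also have "\<dots> \<le> 2 * (4 * q) + 2 * (V \<theta> / \<alpha>)"
        using d'_sum[of y] norm_le[of \<theta>] by simp
      also have "\<dots> = (8 * r + 2 * V \<theta>) / \<alpha>" by (simp add: q_def add_divide_distrib)
      also have "\<dots> \<le> 12 / (\<eta>\<^sup>2 * r) * (V \<theta> - E)\<^sup>2 / \<alpha>"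
        using False r \<eta> \<alpha> mean by (intro divide_right_mono quadratic_tail_bound) (auto simp: E_def)
      also have "\<dots> = 12 / (\<alpha> * \<eta>\<^sup>2 * r) * (V \<theta> - E)\<^sup>2" by (simp add: mult_ac)
      finally show ?thesis .
    qed
    then have "R \<theta> \<le> (\<integral>\<^sup>+\<omega>. ennreal (12 / (\<alpha> * \<eta>\<^sup>2 * r) * (V \<theta> - E)\<^sup>2) \<partial>M)"
      unfolding R_def by (intro nn_integral_mono ennreal_leI)
    then show ?thesis by (simp add: M.emeasure_space_1 add_increasing)
  qed
  have V_meas [measurable]: "V \<in> borel_measurable prior"
    unfolding V_def by measurable
  have "(\<integral>\<^sup>+\<theta>. R \<theta> \<partial>prior) \<le> (\<integral>\<^sup>+\<theta>. U + ennreal (12 / (\<alpha> * \<eta>\<^sup>2 * r)) * ennreal ((0 + (\<Sum>i\<in>I. a i * ((\<theta> i)\<^sup>2 - (s i)\<^sup>2)))\<^sup>2) \<partial>prior)"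
  proof (rule nn_integral_mono)
    fix \<theta> assume \<theta>: "\<theta> \<in> space prior"
    have "V \<theta> - E = 0 + (\<Sum>i\<in>I. a i * ((\<theta> i)\<^sup>2 - (s i)\<^sup>2))"
      by (simp add: V_def E_def right_diff_distrib sum_subtractf)
    moreover have "0 \<le> 12 / (\<alpha> * \<eta>\<^sup>2 * r)" using \<alpha> r by simp
    ultimately show "R \<theta> \<le> U + ennreal (12 / (\<alpha> * \<eta>\<^sup>2 * r)) * ennreal ((0 + (\<Sum>i\<in>I. a i * ((\<theta> i)\<^sup>2 - (s i)\<^sup>2)))\<^sup>2)"
      using R_le[OF \<theta>] by (simp only: ennreal_mult')
  qed
  also have "\<dots> = U + ennreal (12 / (\<alpha> * \<eta>\<^sup>2 * r)) * ennreal (\<Sum>i\<in>I. 2 * (a i)\<^sup>2 * s i ^ 4)"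
    using gaussian_quadratic_form_second_moment[where c=0 and a=a and s=s, OF fin s]
    by (subst nn_integral_add) (auto simp: nn_integral_cmult prior.emeasure_space_1 prior_def[symmetric])
  also have "\<dots> = U + ennreal (12 / (\<alpha> * \<eta>\<^sup>2 * r) * (\<Sum>i\<in>I. 2 * (a i)\<^sup>2 * s i ^ 4))"
    using \<alpha> r by (subst ennreal_mult') auto
  finally have upper: "(\<integral>\<^sup>+\<theta>. R \<theta> \<partial>prior) \<le> U + ennreal (12 / (\<alpha> * \<eta>\<^sup>2 * r) * (\<Sum>i\<in>I. 2 * (a i)\<^sup>2 * s i ^ 4))" .
  have comp [measurable]: "(\<lambda>\<theta>. \<theta> i) \<in> borel_measurable prior" if "i \<in> I" for i
    using that by measurable
  have Rm [measurable]: "(\<lambda>p. ennreal ((d' i (Y (fst p) (snd p)) - fst p i)\<^sup>2)) \<in> borel_measurable (prior \<Otimes>\<^sub>M M)" if "i \<in> I" for i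
    using that by measurable
  have Rm2: "(\<lambda>\<theta>. \<integral>\<^sup>+\<omega>. ennreal ((d' i (Y \<theta> \<omega>) - \<theta> i)\<^sup>2) \<partial>M) \<in> borel_measurable prior" if "i \<in> I" for i
    using M.borel_measurable_nn_integral_fst[OF Rm[OF that]] by simp
  have coord: "ennreal (1 / (1 / (s j)\<^sup>2 + real n / \<sigma>\<^sup>2)) \<le> (\<integral>\<^sup>+\<theta>. \<integral>\<^sup>+\<omega>. ennreal ((d' j (Y \<theta> \<omega>) - \<theta> j)\<^sup>2) \<partial>M \<partial>prior)"
    if j: "j \<in> I" for j
  proof -
    define I' where "I' = I - {j}"
    have I': "finite I'" "j \<notin> I'" "insert j I' = I" using j by (auto simp: I'_def)
    interpret PP': product_prob_space "\<lambda>i. gaussian 0 (s i)" I'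
      using pg by (auto simp: product_prob_space_def product_prob_space_axioms_def product_sigma_finite_gaussian)
    have "(\<integral>\<^sup>+\<theta>. \<integral>\<^sup>+\<omega>. ennreal ((d' j (Y \<theta> \<omega>) - \<theta> j)\<^sup>2) \<partial>M \<partial>prior) =
      (\<integral>\<^sup>+\<theta>. \<integral>\<^sup>+x. \<integral>\<^sup>+\<omega>. ennreal ((d' j (Y (\<theta>(j := x)) \<omega>) - x)\<^sup>2) \<partial>M \<partial>gaussian 0 (s j) \<partial>Pi\<^sub>M I' (\<lambda>i. gaussian 0 (s i)))"
      unfolding prior_def I'(3)[symmetric]
      using Rm2[OF j] by (subst P.product_nn_integral_insert) (auto simp: I' prior_def)
    also have "\<dots> \<ge> (\<integral>\<^sup>+\<theta>. ennreal (1 / (1 / (s j)\<^sup>2 + real n / \<sigma>\<^sup>2)) \<partial>Pi\<^sub>M I' (\<lambda>i. gaussian 0 (s i)))"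
    proof (rule nn_integral_mono)
      fix \<theta>
      \<comment> \<open>Grows from 0 to \<open>n\<close> over the \<open>n\<close> periods, which
        gives the precision \<open>n / \<sigma>\<^sup>2\<close>.\<close>
      define \<Psi> where "\<Psi> t = integral {0..t} (\<lambda>t. (trig (fst j) (snd j) t)\<^sup>2)" for t
      have "1 \<le> fst j" using j I by auto
      then have \<Psi>: "\<Psi> (real n) = real n" "\<Psi> 0 = 0" by (simp_all add: \<Psi>_def integral_trig_squared)
      define g where "g t = (\<Sum>i\<in>I'. \<theta> i * \<Phi> i t)" for t
      have "(\<Sum>i\<in>I. (\<theta>(j := x)) i * \<Phi> i t) = g t + x * \<Phi> j t" for x t
      proof -
        have "(\<Sum>i\<in>I. (\<theta>(j := x)) i * \<Phi> i t) = x * \<Phi> j t + (\<Sum>i\<in>I'. (\<theta>(j := x)) i * \<Phi> i t)"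
          by (subst I'(3)[symmetric]) (simp add: I'(1,2))
        also have "(\<Sum>i\<in>I'. (\<theta>(j := x)) i * \<Phi> i t) = g t"
          unfolding g_def using I' by (intro sum.cong) auto
        finally show ?thesis by simp
      qed
      then have Yj: "Y (\<theta>(j := x)) \<omega> = (\<lambda>t\<in>{0..real n}. g t + x * \<Phi> j t + \<sigma> * w t \<omega>)" for x \<omega>
        unfolding Y_def by (intro restrict_ext) simp
      have "ennreal (1 / (1 / (s j)\<^sup>2 + (\<Psi> (real n) - \<Psi> 0) / \<sigma>\<^sup>2)) \<le>
        (\<integral>\<^sup>+x. \<integral>\<^sup>+\<omega>. ennreal ((d' j (\<lambda>t\<in>{0..real n}. g t + x * \<Phi> j t + \<sigma> * w t \<omega>) - x)\<^sup>2) \<partial>M \<partial>gaussian 0 (s j))"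
      proof (rule brownian_bayes_risk[OF w \<sigma> s])
        show "(\<Phi> j v - \<Phi> j u)\<^sup>2 \<le> (v - u) * (\<Psi> v - \<Psi> u)" if "0 \<le> u" "u < v" for u v
          unfolding \<Phi>_def \<Psi>_def using that by (rule trig_increment_squared_le)
        show "continuous_on {0..real n} g" unfolding g_def by (intro continuous_intros \<Phi>_cont)
      qed (use n \<Phi>_cont d'_bdd[OF j] in \<open>auto simp: \<Phi>_def\<close>)
      then show "ennreal (1 / (1 / (s j)\<^sup>2 + real n / \<sigma>\<^sup>2)) \<le>
        (\<integral>\<^sup>+x. \<integral>\<^sup>+\<omega>. ennreal ((d' j (Y (\<theta>(j := x)) \<omega>) - x)\<^sup>2) \<partial>M \<partial>gaussian 0 (s j))"
        by (simp only: Yj \<Psi> diff_zero)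
    qed
    also have "(\<integral>\<^sup>+\<theta>. ennreal (1 / (1 / (s j)\<^sup>2 + real n / \<sigma>\<^sup>2)) \<partial>Pi\<^sub>M I' (\<lambda>i. gaussian 0 (s i))) =
        ennreal (1 / (1 / (s j)\<^sup>2 + real n / \<sigma>\<^sup>2))"
      by (simp add: PP'.emeasure_space_1)
    finally show ?thesis .
  qed
  have "ennreal (\<Sum>j\<in>I. 1 / (1 / (s j)\<^sup>2 + real n / \<sigma>\<^sup>2)) = (\<Sum>j\<in>I. ennreal (1 / (1 / (s j)\<^sup>2 + real n / \<sigma>\<^sup>2)))"
    by (subst sum_ennreal) auto
  also have "\<dots> \<le> (\<Sum>j\<in>I. (\<integral>\<^sup>+\<theta>. \<integral>\<^sup>+\<omega>. ennreal ((d' j (Y \<theta> \<omega>) - \<theta> j)\<^sup>2) \<partial>M \<partial>prior))"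
    by (intro sum_mono coord)
  also have "\<dots> = (\<integral>\<^sup>+\<theta>. (\<Sum>j\<in>I. (\<integral>\<^sup>+\<omega>. ennreal ((d' j (Y \<theta> \<omega>) - \<theta> j)\<^sup>2) \<partial>M)) \<partial>prior)"
    by (rule nn_integral_sum[symmetric]) (rule Rm2)
  also have "\<dots> = (\<integral>\<^sup>+\<theta>. R \<theta> \<partial>prior)"
  proof (rule nn_integral_cong)
    fix \<theta> assume "\<theta> \<in> space prior"
    note [measurable] = Y_meas1[OF this]
    show "(\<Sum>j\<in>I. (\<integral>\<^sup>+\<omega>. ennreal ((d' j (Y \<theta> \<omega>) - \<theta> j)\<^sup>2) \<partial>M)) = R \<theta>"
      unfolding R_def by (subst nn_integral_sum[symmetric]) auto
  qed
  also note upper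
  finally show ?thesis by (simp add: U_def)
qed

text \<open>The main work is that adding the integrated signal is a measurable map \<open>D\<close>
  of the Skorokhod space into itself; the nested image measures of \<open>noise_law\<close> and
  \<open>observation_law\<close> then collapse to the law of the white noise path.\<close>

lemma robust_risk_ge_white_noise_risk:
  fixes S :: "real \<Rightarrow> real"
  assumes w: "standard_brownian_motion M w" and hi: "0 < lo" "lo \<le> hi" and Shat: "Shat \<in> estimators T"
    and S: "\<And>A. continuous_on A S"
  shows "white_noise_risk M w T (sqrt hi) Shat S \<le> robust_risk T (noise_family M w z lo hi T) Shat S"
proof -
  define X where "X = (\<lambda>\<omega>. \<lambda>t\<in>{0..T}. sqrt hi * w t \<omega>)"
  have X [measurable]: "X \<in> measurable M (skorokhod T)"
    unfolding X_def
  proof (rule measurable_continuous_path)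
    show "(\<lambda>\<omega>. sqrt hi * w t \<omega>) \<in> borel_measurable M" if "t \<in> {0..T}" for t
      using that brownian_measurable[OF w, of t] by auto
    show "continuous_on {0..T} (\<lambda>t. sqrt hi * w t \<omega>)" if "\<omega> \<in> space M" for \<omega>
      using brownian_continuous[OF w that] by (intro continuous_intros)
  qed
  have law: "noise_law M w z T (sqrt hi) 0 = distr M (skorokhod T) X"
    by (simp add: noise_law_def X_def)
  have "noise_law M w z T (sqrt hi) 0 \<in> noise_family M w z lo hi T"
    unfolding noise_family_def using hi by (intro CollectI exI[of _ "sqrt hi"] exI[of _ 0]) auto
  then have 1: "(\<integral>\<^sup>+y. sq_norm (\<lambda>t. Shat y t - S t) \<partial>observation_law T (distr M (skorokhod T) X) S)
      \<le> robust_risk T (noise_family M w z lo hi T) Shat S"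
    unfolding robust_risk_def law[symmetric] by (rule SUP_upper)
  define D where "D = (\<lambda>\<xi>. \<lambda>t\<in>{0..T}. integral {0..t} S + \<xi> t)"
  have cS: "continuous_on {0..T} (\<lambda>t. integral {0..t} S)"
    by (intro indefinite_integral_continuous_1 integrable_continuous_real S)
  have D [measurable]: "D \<in> measurable (skorokhod T) (skorokhod T)"
    unfolding skorokhod_def
  proof (rule measurable_restrict_space3)
    show "D \<in> measurable (\<Pi>\<^sub>M t\<in>{0..T}. borel) (\<Pi>\<^sub>M t\<in>{0..T}. borel)"
      unfolding D_def by (rule measurable_restrict) auto
    show "D \<in> {f. cadlag_on {0..T} f} \<rightarrow> {f. cadlag_on {0..T} f}"
    proof (intro funcsetI CollectI)
      fix \<xi> assume "\<xi> \<in> {f. cadlag_on {0..T} f}"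
      then have \<xi>: "cadlag_on {0..T} \<xi>" by simp
      have lim: "((\<lambda>t. integral {0..t} S) \<longlongrightarrow> integral {0..t} S) (at t within {0..T} \<inter> A)" if "t \<in> {0..T}" for t A
        using that cS unfolding continuous_on_def by (blast intro: tendsto_within_subset)
      have ev: "\<forall>\<^sub>F u in at t within {0..T} \<inter> A. integral {0..u} S + \<xi> u = D \<xi> u" for t A
        by (auto simp: eventually_at_filter D_def)
      show "cadlag_on {0..T} (D \<xi>)"
        unfolding cadlag_on_def
      proof (intro ballI conjI)
        fix t assume t: "t \<in> {0..T}"
        have "(\<xi> \<longlongrightarrow> \<xi> t) (at t within {0..T} \<inter> {t<..})" using \<xi> t by (auto simp: cadlag_on_def)
        from tendsto_add[OF lim[OF t] this]
        have "((\<lambda>u. integral {0..u} S + \<xi> u) \<longlongrightarrow> D \<xi> t) (at t within {0..T} \<inter> {t<..})"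
          using t by (simp add: D_def)
        then show "(D \<xi> \<longlongrightarrow> D \<xi> t) (at t within {0..T} \<inter> {t<..})"
          by (rule Lim_transform_eventually[OF _ ev])
        obtain l where "(\<xi> \<longlongrightarrow> l) (at t within {0..T} \<inter> {..<t})"
          using \<xi> t unfolding cadlag_on_def by blast
        from Lim_transform_eventually[OF tendsto_add[OF lim[OF t] this] ev]
        show "\<exists>l. (D \<xi> \<longlongrightarrow> l) (at t within {0..T} \<inter> {..<t})" by blast
      qed
    qed
  qed
  have obs: "observation_law T (distr M (skorokhod T) X) S = distr M (skorokhod T) (D \<circ> X)"
    unfolding observation_law_def D_def[symmetric]
    using distr_distr[OF D X] .
  have Sm: "S \<in> borel_measurable unit_interval"
    using borel_measurable_continuous_onI[OF S[of UNIV]] by (intro measurable_restrict_space1) simp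
  interpret sigma_finite_measure unit_interval by (rule sigma_finite_unit_interval)
  have m: "(\<lambda>y. sq_norm (\<lambda>t. Shat y t - S t)) \<in> borel_measurable (skorokhod T)"
  proof -
    note [measurable] = estimator_measurable[OF Shat] Sm
    show ?thesis unfolding sq_norm_eq by measurable
  qed
  have "D (X \<omega>) = white_noise_path w T (sqrt hi) S \<omega>" for \<omega>
    by (auto simp: D_def X_def white_noise_path_def fun_eq_iff)
  then have "white_noise_risk M w T (sqrt hi) Shat S =
      (\<integral>\<^sup>+y. sq_norm (\<lambda>t. Shat y t - S t) \<partial>observation_law T (distr M (skorokhod T) X) S)"
    unfolding obs white_noise_risk_def using m by (subst nn_integral_distr) auto
  with 1 show ?thesis by simp
qed

section \<open>Pinsker's prior\<close>

lemma
  shows sum_powers_lower: "real N ^ (p + 1) / (p + 1) \<le> (\<Sum>m=1..N. real m ^ p)"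
    and sum_powers_upper: "(\<Sum>m=1..N. real m ^ p) \<le> real N ^ (p + 1) / (p + 1) + real N ^ p"
proof -
  have d: "(p + 1) * real m ^ p \<le> (real m + 1) ^ (p + 1) - real m ^ (p + 1)"
    "(real m + 1) ^ (p + 1) - real m ^ (p + 1) \<le> (p + 1) * (real m + 1) ^ p" for m
  proof -
    have e: "(real m + 1) ^ (p + 1) - real m ^ (p + 1) = (\<Sum>i<Suc p. (real m + 1) ^ i * real m ^ (p - i))"
      using diff_power_eq_sum[of "real m + 1" p "real m"] by simp
    have "real m ^ p \<le> (real m + 1) ^ i * real m ^ (p - i)" if "i < Suc p" for i
    proof -
      have "real m ^ p = real m ^ i * real m ^ (p - i)" using that by (simp flip: power_add)
      also have "\<dots> \<le> (real m + 1) ^ i * real m ^ (p - i)" by (intro mult_right_mono power_mono) auto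
      finally show ?thesis .
    qed
    then have "(\<Sum>i<Suc p. real m ^ p) \<le> (\<Sum>i<Suc p. (real m + 1) ^ i * real m ^ (p - i))"
      by (intro sum_mono) auto
    then show "(p + 1) * real m ^ p \<le> (real m + 1) ^ (p + 1) - real m ^ (p + 1)"
      unfolding e by simp
    have "(real m + 1) ^ i * real m ^ (p - i) \<le> (real m + 1) ^ p" if "i < Suc p" for i
    proof -
      have "(real m + 1) ^ i * real m ^ (p - i) \<le> (real m + 1) ^ i * (real m + 1) ^ (p - i)"
        by (intro mult_left_mono power_mono) auto
      also have "\<dots> = (real m + 1) ^ p" using that by (simp flip: power_add)
      finally show ?thesis .
    qed
    then have "(\<Sum>i<Suc p. (real m + 1) ^ i * real m ^ (p - i)) \<le> (\<Sum>i<Suc p. (real m + 1) ^ p)"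
      by (intro sum_mono) auto
    then show "(real m + 1) ^ (p + 1) - real m ^ (p + 1) \<le> (p + 1) * (real m + 1) ^ p"
      unfolding e by simp
  qed
  have div: "x / c \<le> y / c + z" if "c > 0" "x - y \<le> c * z" for x y z c :: real
    using divide_right_mono[OF that(2), of c] that(1) by (simp add: diff_divide_distrib)
  have div': "y / c + z \<le> x / c" if "c > 0" "c * z \<le> x - y" for x y z c :: real
    using divide_right_mono[OF that(2), of c] that(1) by (simp add: diff_divide_distrib)
  show "real N ^ (p + 1) / (p + 1) \<le> (\<Sum>m=1..N. real m ^ p)"
  proof (induction N)
    case (Suc N)
    have "(real N + 1) ^ (p + 1) / (p + 1) \<le> real N ^ (p + 1) / (p + 1) + (real N + 1) ^ p"
      by (rule div[OF _ d(2)]) simp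
    with Suc show ?case by (simp add: add.commute)
  qed simp
  show "(\<Sum>m=1..N. real m ^ p) \<le> real N ^ (p + 1) / (p + 1) + real N ^ p"
  proof (induction N)
    case (Suc N)
    have "real N ^ (p + 1) / (p + 1) + real N ^ p \<le> (real N + 1) ^ (p + 1) / (p + 1)"
      by (rule div'[OF _ d(1)]) simp
    with Suc show ?case by (simp add: add.commute)
  qed simp
qed

lemma sobolev_weight_lower: "(2 * pi * real m) ^ (2 * k) \<le> sobolev_weight k m"
  unfolding sobolev_weight_def by (rule member_le_sum) auto

lemma two_pi_ge_1: "1 \<le> 2 * pi"
  using pi_ge_two by linarith

text \<open>The highest derivative dominates: for \<open>x = (2 * pi * m)\<^sup>2\<close>, which is
  at least \<open>m\<close>, each of the \<open>k\<close> lower powers of \<open>x\<close> is at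
  most \<open>x ^ k / m\<close>.\<close>

lemma sobolev_weight_upper:
  assumes m: "m \<ge> 1"
  shows "sobolev_weight k m \<le> (2 * pi * real m) ^ (2 * k) * (1 + real k / real m)"
proof -
  define x where "x = (2 * pi * real m)\<^sup>2"
  have xm: "real m \<le> x" and x1: "1 \<le> x"
  proof -
    have "1 * real m \<le> 2 * pi * real m" using two_pi_ge_1 by (intro mult_right_mono) auto
    then have "real m * real m \<le> x"
      unfolding x_def power2_eq_square by (intro mult_mono) auto
    moreover have "real m * 1 \<le> real m * real m" using m by (intro mult_left_mono) auto
    ultimately show "real m \<le> x" by simp
    with m show "1 \<le> x" by simp
  qed
  have "x ^ j \<le> x ^ k / real m" if "j < k" for j
  proof -
    have "x ^ j * real m \<le> x ^ j * x" using xm x1 by (intro mult_left_mono) auto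
    also have "\<dots> = x ^ Suc j" by simp
    also have "\<dots> \<le> x ^ k" using x1 that by (intro power_increasing) auto
    finally show ?thesis using m by (simp add: pos_le_divide_eq)
  qed
  then have "(\<Sum>j<k. x ^ j) \<le> (\<Sum>j<k. x ^ k / real m)" by (intro sum_mono) auto
  then have "(\<Sum>j\<le>k. x ^ j) \<le> x ^ k * (1 + real k / real m)"
    by (simp add: lessThan_Suc_atMost[symmetric] distrib_left mult_ac)
  then show ?thesis by (simp add: sobolev_weight_def x_def power_mult)
qed

text \<open>
  Pinsker's least favourable prior: the variances \<open>\<epsilon>2 ((N / m)^k - 1)\<close> (here \<open>\<epsilon>2\<close> is the squared
  noise level) are restricted to the frequencies above \<open>\<eta> N\<close>.
\<close>

definition frequencies :: "real \<Rightarrow> nat \<Rightarrow> nat set" where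
  "frequencies \<eta> N = {m. \<eta> * real N < real m \<and> m < N}"

definition pinsker_variance :: "nat \<Rightarrow> real \<Rightarrow> nat \<Rightarrow> nat \<Rightarrow> real" where
  "pinsker_variance k \<epsilon>2 N m = \<epsilon>2 * ((real N / real m) ^ k - 1)"

context
  fixes k N :: nat and \<eta> \<epsilon>2 :: real
  assumes k: "k \<ge> 1" and N: "N \<ge> 1" and \<eta>: "0 < \<eta>" and \<epsilon>2: "\<epsilon>2 > 0"
begin

lemma finite_frequencies: "finite (frequencies \<eta> N)"
  by (rule finite_subset[of _ "{..<N}"]) (auto simp: frequencies_def)

lemma frequencies_subset: "frequencies \<eta> N \<subseteq> {1..N}"
proof
  fix m assume m: "m \<in> frequencies \<eta> N"
  have "0 \<le> \<eta> * real N" using \<eta> by simp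
  also have "\<dots> < real m" using m by (simp add: frequencies_def)
  finally show "m \<in> {1..N}" using m by (simp add: frequencies_def)
qed

lemma pinsker_variance_pos:
  assumes "m \<in> frequencies \<eta> N"
  shows "pinsker_variance k \<epsilon>2 N m > 0"
proof -
  have "1 \<le> m" "m < N" using assms frequencies_subset by (auto simp: frequencies_def)
  then have "1 < real N / real m" by simp
  then have "1 < (real N / real m) ^ k" using k by (intro one_less_power) auto
  then show ?thesis using \<epsilon>2 by (simp add: pinsker_variance_def)
qed

text \<open>The posterior variance at noise variance \<open>\<epsilon>2\<close>; the factor
  \<open>1 - (m / N) ^ k\<close> is the weight of Pinsker's linear filter.\<close>

lemma pinsker_bayes_risk:
  assumes "m \<in> frequencies \<eta> N"
  shows "1 / (1 / pinsker_variance k \<epsilon>2 N m + 1 / \<epsilon>2) = \<epsilon>2 * (1 - (real m / real N) ^ k)"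
proof -
  have m: "1 \<le> m" "m < N" using assms frequencies_subset by (auto simp: frequencies_def)
  define y where "y = (real N / real m) ^ k"
  have "1 < real N / real m" using m by simp
  then have y: "1 < y" using k unfolding y_def by (intro one_less_power) auto
  have inv: "(real m / real N) ^ k = 1 / y" using m by (simp add: y_def power_divide)
  have "1 / (\<epsilon>2 * (y - 1)) + 1 / \<epsilon>2 = y / (\<epsilon>2 * (y - 1))"
    using y \<epsilon>2 by (simp add: field_simps)
  moreover have "1 / (y / (\<epsilon>2 * (y - 1))) = \<epsilon>2 * (1 - 1 / y)"
    using y \<epsilon>2 by (simp add: field_simps)
  ultimately show ?thesis
    by (simp only: pinsker_variance_def y_def[symmetric] inv)
qed

text \<open>Over all frequencies up to \<open>N\<close> the weights sum to at least
  \<open>N * k / (k + 1) - 1\<close> by comparison with an integral; the at most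
  \<open>\<eta> * N\<close> low frequencies left out carry weights of at most 1.\<close>

lemma sum_bayes_risk_lower:
  "\<epsilon>2 * (real N * (real k / (real k + 1) - \<eta>) - 1) \<le> (\<Sum>m\<in>frequencies \<eta> N. \<epsilon>2 * (1 - (real m / real N) ^ k))"
proof -
  let ?f = "\<lambda>m. 1 - (real m / real N) ^ k"
  have f: "0 \<le> ?f m" "?f m \<le> 1" if "m \<in> {1..N}" for m
    using that by (auto intro!: power_le_one)
  let ?L = "{m \<in> {1..N}. real m \<le> \<eta> * real N}"
  have cL: "real (card ?L) \<le> \<eta> * real N"
  proof -
    have "?L \<subseteq> {1..nat \<lfloor>\<eta> * real N\<rfloor>}" by (auto simp: le_nat_iff le_floor_iff)
    then have "card ?L \<le> nat \<lfloor>\<eta> * real N\<rfloor>"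
      using card_mono[of "{1..nat \<lfloor>\<eta> * real N\<rfloor>}"] by simp
    then show ?thesis using \<eta> by (meson le_nat_floor of_nat_floor of_nat_le_iff order_trans mult_nonneg_nonneg of_nat_0_le_iff less_imp_le)
  qed
  have "real N * (real k / (real k + 1)) - 1 \<le> (\<Sum>m=1..N. ?f m)"
  proof -
    have "(\<Sum>m=1..N. (real m / real N) ^ k) = (\<Sum>m=1..N. real m ^ k) / real N ^ k"
      by (simp add: power_divide sum_divide_distrib)
    also have "\<dots> \<le> (real N ^ (k + 1) / (k + 1) + real N ^ k) / real N ^ k"
      by (intro divide_right_mono sum_powers_upper) auto
    also have "\<dots> = real N / (k + 1) + 1" using N by (simp add: add_divide_distrib)
    finally have "real N - (real N / (k + 1) + 1) \<le> (\<Sum>m=1..N. ?f m)" by (simp add: sum_subtractf)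
    moreover have "real N - (real N / (k + 1) + 1) = real N * (real k / (real k + 1)) - 1"
      by (simp add: field_simps)
    ultimately show ?thesis by simp
  qed
  also have "(\<Sum>m=1..N. ?f m) \<le> (\<Sum>m\<in>frequencies \<eta> N \<union> ?L. ?f m)"
  proof -
    \<comment> \<open>The frequency \<open>N\<close> itself has weight 0, so its absence from
      \<open>frequencies\<close> costs nothing.\<close>
    have "(\<Sum>m=1..N. ?f m) = (\<Sum>m\<in>(frequencies \<eta> N \<union> ?L). ?f m)"
      using frequencies_subset N by (intro sum.mono_neutral_right) (auto simp: frequencies_def)
    then show ?thesis by simp
  qed
  also have "\<dots> \<le> (\<Sum>m\<in>frequencies \<eta> N. ?f m) + (\<Sum>m\<in>?L. ?f m)"
    using finite_frequencies by (subst sum.union_disjoint) (auto simp: frequencies_def)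
  also have "(\<Sum>m\<in>?L. ?f m) \<le> \<eta> * real N"
  proof -
    have "(\<Sum>m\<in>?L. ?f m) \<le> (\<Sum>m\<in>?L. 1)" using f by (intro sum_mono) auto
    with cL show ?thesis by simp
  qed
  finally have "real N * (real k / (real k + 1) - \<eta>) - 1 \<le> (\<Sum>m\<in>frequencies \<eta> N. ?f m)"
    by (simp add: algebra_simps)
  then show ?thesis using \<epsilon>2 by (simp add: sum_distrib_left[symmetric])
qed

text \<open>To leading order a term is \<open>N^k m^k - m^(2k)\<close>, and
  \<open>1/(k+1) - 1/(2k+1)\<close> is the constant \<open>k / ((k+1) (2k+1))\<close>. The lower
  derivatives cost the factor \<open>1 + k / (\<eta> N)\<close>, uniformly since
  \<open>m > \<eta> N\<close>.\<close>

lemma sum_weighted_variance_upper: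
  "(\<Sum>m\<in>frequencies \<eta> N. sobolev_weight k m * pinsker_variance k \<epsilon>2 N m) \<le>
    (1 + real k / (\<eta> * real N)) * (2 * pi) ^ (2 * k) * (\<epsilon>2 * real N ^ (2 * k + 1)) *
    (real k / ((real k + 1) * (2 * real k + 1)) + 1 / real N)"
proof -
  let ?g = "\<lambda>m. real N ^ k * real m ^ k - real m ^ (2 * k)"
  let ?C = "(1 + real k / (\<eta> * real N)) * (2 * pi) ^ (2 * k) * \<epsilon>2"
  have C: "?C \<ge> 0" using \<eta> \<epsilon>2 N by simp
  have g: "0 \<le> ?g m" if "m \<in> {1..N}" for m
  proof -
    have "real m ^ k * real m ^ k \<le> real N ^ k * real m ^ k"
      using that by (intro mult_right_mono power_mono) auto
    then show ?thesis by (simp add: mult_2 power_add)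
  qed
  have "(\<Sum>m\<in>frequencies \<eta> N. sobolev_weight k m * pinsker_variance k \<epsilon>2 N m) \<le> (\<Sum>m\<in>frequencies \<eta> N. ?C * ?g m)"
  proof (rule sum_mono)
    fix m assume m: "m \<in> frequencies \<eta> N"
    then have m1: "1 \<le> m" "m < N" and mN: "\<eta> * real N < real m" using frequencies_subset by (auto simp: frequencies_def)
    have "sobolev_weight k m \<le> (2 * pi * real m) ^ (2 * k) * (1 + real k / real m)"
      by (rule sobolev_weight_upper) fact
    also have "\<dots> \<le> (2 * pi * real m) ^ (2 * k) * (1 + real k / (\<eta> * real N))"
      using mN \<eta> N m1 by (intro mult_left_mono add_left_mono divide_left_mono) auto
    finally have "sobolev_weight k m * pinsker_variance k \<epsilon>2 N m \<le>
      (2 * pi * real m) ^ (2 * k) * (1 + real k / (\<eta> * real N)) * pinsker_variance k \<epsilon>2 N m"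
      using pinsker_variance_pos[OF m] by (intro mult_right_mono) auto
    also have "\<dots> = ?C * (real m ^ (2 * k) * ((real N / real m) ^ k - 1))"
      by (simp add: pinsker_variance_def power_mult_distrib mult_ac)
    also have "real m ^ (2 * k) * ((real N / real m) ^ k - 1) = ?g m"
    proof -
      have "real m ^ (2 * k) = real m ^ k * real m ^ k" by (simp add: mult_2 power_add)
      then show ?thesis using m1 by (simp only:) (simp add: power_divide field_simps)
    qed
    finally show "sobolev_weight k m * pinsker_variance k \<epsilon>2 N m \<le> ?C * ?g m" .
  qed
  also have "\<dots> \<le> (\<Sum>m=1..N. ?C * ?g m)"
    using C g frequencies_subset by (intro sum_mono2) auto
  also have "\<dots> = ?C * (real N ^ k * (\<Sum>m=1..N. real m ^ k) - (\<Sum>m=1..N. real m ^ (2 * k)))"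
    by (simp add: sum_distrib_left[symmetric] sum_subtractf)
  also have "\<dots> \<le> ?C * (real N ^ k * (real N ^ (k + 1) / (k + 1) + real N ^ k) - real N ^ (2 * k + 1) / ((2 * k) + 1))"
    using sum_powers_upper[where N=N and p=k] sum_powers_lower[where N=N and p="2 * k"] C by (intro mult_left_mono diff_mono) auto
  also have "real N ^ k * (real N ^ (k + 1) / (k + 1) + real N ^ k) - real N ^ (2 * k + 1) / ((2 * k) + 1) =
      real N ^ (2 * k + 1) * (real k / ((real k + 1) * (2 * real k + 1)) + 1 / real N)"
  proof -
    have "real N ^ k * (real N ^ (k + 1) / (k + 1) + real N ^ k) = real N ^ (2 * k + 1) / (k + 1) + real N ^ (2 * k + 1) / real N"
      using N by (simp only: mult_2[of k] power_add power_one_right) (simp add: field_simps)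
    moreover have "real k / ((real k + 1) * (2 * real k + 1)) = 1 / (real k + 1) - 1 / (2 * real k + 1)"
      by (simp add: divide_simps)
    then have "real N ^ (2 * k + 1) * (real k / ((real k + 1) * (2 * real k + 1))) =
        real N ^ (2 * k + 1) / (real k + 1) - real N ^ (2 * k + 1) / (2 * real k + 1)"
      by (simp only: right_diff_distrib times_divide_eq_right mult_1_right)
    ultimately show ?thesis by (simp add: distrib_left add.commute)
  qed
  finally show ?thesis by (simp add: mult_ac)
qed

text \<open>A crude bound, at most \<open>N\<close> terms each bounded by a common maximum: it
  enters only the tail, where just the order in \<open>N\<close> matters.\<close>

lemma sum_weighted_variance_squared_upper:
  "(\<Sum>m\<in>frequencies \<eta> N. 2 * (sobolev_weight k m * pinsker_variance k \<epsilon>2 N m)\<^sup>2) \<le>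
    2 * real N * ((1 + real k) * (2 * pi) ^ (2 * k) * \<epsilon>2 * real N ^ (2 * k))\<^sup>2"
proof -
  let ?B = "(1 + real k) * (2 * pi) ^ (2 * k) * \<epsilon>2 * real N ^ (2 * k)"
  have "2 * (sobolev_weight k m * pinsker_variance k \<epsilon>2 N m)\<^sup>2 \<le> 2 * ?B\<^sup>2" if m: "m \<in> frequencies \<eta> N" for m
  proof -
    have m1: "1 \<le> m" "m < N" using m frequencies_subset by (auto simp: frequencies_def)
    have "sobolev_weight k m \<le> (2 * pi * real m) ^ (2 * k) * (1 + real k / real m)"
      by (rule sobolev_weight_upper) fact
    also have "\<dots> \<le> (2 * pi * real m) ^ (2 * k) * (1 + real k)"
      using m1 by (intro mult_left_mono add_left_mono) (auto simp: divide_le_eq mult_le_cancel_left1)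
    finally have "sobolev_weight k m * pinsker_variance k \<epsilon>2 N m \<le>
       (2 * pi * real m) ^ (2 * k) * (1 + real k) * pinsker_variance k \<epsilon>2 N m"
      using pinsker_variance_pos[OF m] by (intro mult_right_mono) auto
    also have "\<dots> \<le> (2 * pi * real m) ^ (2 * k) * (1 + real k) * (\<epsilon>2 * (real N / real m) ^ k)"
      using \<epsilon>2 by (intro mult_left_mono) (auto simp: pinsker_variance_def)
    also have "\<dots> = (1 + real k) * (2 * pi) ^ (2 * k) * \<epsilon>2 * (real m ^ k * real N ^ k)"
    proof -
      have p: "(2 * pi * real m) ^ (2 * k) = (2 * pi) ^ (2 * k) * (real m ^ k * real m ^ k)"
        unfolding power_mult_distrib[of "2 * pi"] mult_2[of k] power_add[of "real m"] ..
      have c: "real m ^ k * (real N / real m) ^ k = real N ^ k"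
        using m1 by (simp add: power_divide)
      have "P * (A * A) * b * (\<epsilon>2 * D) = b * P * \<epsilon>2 * (A * (A * D))" for P A b D :: real
        by (simp only: mult_ac)
      from this[of "(2 * pi) ^ (2 * k)" "real m ^ k" "1 + real k" "(real N / real m) ^ k"] show ?thesis unfolding p c .
    qed
    also have "\<dots> \<le> (1 + real k) * (2 * pi) ^ (2 * k) * \<epsilon>2 * (real N ^ k * real N ^ k)"
      using m1 \<epsilon>2 by (intro mult_left_mono mult_right_mono power_mono) auto
    also have "\<dots> = ?B"
      by (simp only: mult_2[of k] power_add[of "real N"])
    finally have "sobolev_weight k m * pinsker_variance k \<epsilon>2 N m \<le> ?B" .
    moreover have "0 \<le> sobolev_weight k m * pinsker_variance k \<epsilon>2 N m"
      using pinsker_variance_pos[OF m] by (auto simp: sobolev_weight_def intro!: mult_nonneg_nonneg sum_nonneg)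
    ultimately show ?thesis by (intro mult_left_mono power_mono) auto
  qed
  then have "(\<Sum>m\<in>frequencies \<eta> N. 2 * (sobolev_weight k m * pinsker_variance k \<epsilon>2 N m)\<^sup>2) \<le> real (card (frequencies \<eta> N)) * (2 * ?B\<^sup>2)"
    by (rule sum_bounded_above)
  also have "\<dots> \<le> real N * (2 * ?B\<^sup>2)"
    using card_mono[OF _ frequencies_subset] by (intro mult_right_mono) auto
  finally show ?thesis by (simp add: mult_ac)
qed

end

text \<open>The factors 2 count the two phases at each frequency. \<open>mean\<close> keeps the
  prior mean of the ellipsoid functional below \<open>r\<close> with relative slack
  \<open>\<eta>\<close>, as the tail bound needs. A negative difference becomes 0 under
  \<open>ennreal\<close>, so the claim is then trivial.\<close>

lemma pinsker_lower_bound_finite: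
  fixes k N n :: nat and \<eta> lo hi :: real
  assumes k: "k \<ge> 1" and N: "N \<ge> 1" and \<eta>: "0 < \<eta>" "\<eta> \<le> 1" and r: "r > 0" and n: "n \<ge> 1"
    and lo: "0 < lo" "lo \<le> hi"
    and w: "standard_brownian_motion M w" and Shat: "Shat \<in> estimators (real n)"
    and mean: "2 * ((1 + real k / (\<eta> * real N)) * (2 * pi) ^ (2 * k) * (hi / real n * real N ^ (2 * k + 1)) *
      (real k / ((real k + 1) * (2 * real k + 1)) + 1 / real N)) \<le> (1 - \<eta>) * r"
  shows "ennreal (2 * (hi / real n * (real N * (real k / (real k + 1) - \<eta>) - 1)) -
      12 / ((\<eta> * real N) ^ (2 * k) * \<eta>\<^sup>2 * r) *
      (4 * real N * ((1 + real k) * (2 * pi) ^ (2 * k) * (hi / real n) * real N ^ (2 * k))\<^sup>2))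
    \<le> (SUP S\<in>sobolev_ball k r. robust_risk (real n) (noise_family M w z lo hi (real n)) Shat S)"
proof -
  define \<epsilon>2 where "\<epsilon>2 = hi / real n"
  have \<epsilon>2: "\<epsilon>2 > 0" using lo n by (simp add: \<epsilon>2_def)
  note ctx = k N \<eta>(1) \<epsilon>2
  let ?K = "frequencies \<eta> N"
  define I where "I = ?K \<times> {0, 1 :: nat}"
  have I: "finite I" "I \<subseteq> {1..} \<times> {0, 1}"
    using finite_frequencies[OF ctx] frequencies_subset[OF ctx] by (auto simp: I_def)
  have sum_I: "(\<Sum>i\<in>I. f (fst i)) = 2 * (\<Sum>m\<in>?K. f m)" for f :: "nat \<Rightarrow> real"
  proof -
    have "(\<Sum>i\<in>I. f (fst i)) = (\<Sum>m\<in>?K. \<Sum>b\<in>{0, 1 :: nat}. f m)"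
      using sum.cartesian_product[of "\<lambda>m b. f m" "{0, 1 :: nat}" ?K] by (simp only: I_def case_prod_beta')
    then show ?thesis by (simp add: sum_distrib_left)
  qed
  \<comment> \<open>The value 1 outside \<open>I\<close> is a placeholder:
    \<open>white_noise_minimax_lower_bound\<close> wants positive deviations at every index.\<close>
  define s where "s i = (if i \<in> I then sqrt (pinsker_variance k \<epsilon>2 N (fst i)) else 1)" for i
  have pv: "pinsker_variance k \<epsilon>2 N (fst i) > 0" if "i \<in> I" for i
    using that by (intro pinsker_variance_pos[OF ctx]) (auto simp: I_def)
  have s: "s i > 0" for i using pv by (simp add: s_def)
  have s2: "(s i)\<^sup>2 = pinsker_variance k \<epsilon>2 N (fst i)" if "i \<in> I" for i
    using that pv[OF that] by (simp add: s_def)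
  have s4: "s i ^ 4 = (pinsker_variance k \<epsilon>2 N (fst i))\<^sup>2" if "i \<in> I" for i
    using s2[OF that] by (metis power2_eq_square power4_eq_xxxx mult.assoc)
  let ?a = "\<lambda>i :: nat \<times> nat. sobolev_weight k (fst i)"
  let ?\<alpha> = "(\<eta> * real N) ^ (2 * k)"
  have \<alpha>: "?\<alpha> > 0" using \<eta> N by simp
  have \<alpha>a: "?\<alpha> \<le> ?a i" if "i \<in> I" for i
  proof -
    have "\<eta> * real N \<le> 1 * real (fst i)" using that by (auto simp: I_def frequencies_def)
    also have "\<dots> \<le> 2 * pi * real (fst i)" using two_pi_ge_1 by (intro mult_right_mono) auto
    finally have "?\<alpha> \<le> (2 * pi * real (fst i)) ^ (2 * k)" using \<eta> by (intro power_mono) auto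
    also have "\<dots> \<le> ?a i" by (rule sobolev_weight_lower)
    finally show ?thesis .
  qed
  have mean': "(\<Sum>i\<in>I. ?a i * (s i)\<^sup>2) \<le> (1 - \<eta>) * r"
  proof -
    have "(\<Sum>i\<in>I. ?a i * (s i)\<^sup>2) = (\<Sum>i\<in>I. ?a i * pinsker_variance k \<epsilon>2 N (fst i))"
      by (intro sum.cong) (auto simp: s2)
    also have "\<dots> = 2 * (\<Sum>m\<in>?K. sobolev_weight k m * pinsker_variance k \<epsilon>2 N m)" by (rule sum_I)
    also have "\<dots> \<le> 2 * ((1 + real k / (\<eta> * real N)) * (2 * pi) ^ (2 * k) * (\<epsilon>2 * real N ^ (2 * k + 1)) *
      (real k / ((real k + 1) * (2 * real k + 1)) + 1 / real N))"
      by (intro mult_left_mono sum_weighted_variance_upper[OF ctx]) auto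
    also have "\<dots> \<le> (1 - \<eta>) * r" using mean by (simp add: \<epsilon>2_def)
    finally show ?thesis .
  qed
  have bayes: "2 * (\<epsilon>2 * (real N * (real k / (real k + 1) - \<eta>) - 1)) \<le> (\<Sum>i\<in>I. 1 / (1 / (s i)\<^sup>2 + real n / (sqrt hi)\<^sup>2))"
  proof -
    have "(\<Sum>i\<in>I. 1 / (1 / (s i)\<^sup>2 + real n / (sqrt hi)\<^sup>2)) = (\<Sum>i\<in>I. \<epsilon>2 * (1 - (real (fst i) / real N) ^ k))"
    proof (rule sum.cong)
      fix i assume i: "i \<in> I"
      have "real n / (sqrt hi)\<^sup>2 = 1 / \<epsilon>2" using lo by (simp add: \<epsilon>2_def)
      with i show "1 / (1 / (s i)\<^sup>2 + real n / (sqrt hi)\<^sup>2) = \<epsilon>2 * (1 - (real (fst i) / real N) ^ k)"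
        using pinsker_bayes_risk[OF ctx, of "fst i"] by (auto simp: s2 I_def)
    qed simp
    also have "\<dots> = 2 * (\<Sum>m\<in>?K. \<epsilon>2 * (1 - (real m / real N) ^ k))" by (rule sum_I)
    finally show ?thesis using sum_bayes_risk_lower[OF ctx] by simp
  qed
  have tail: "12 / (?\<alpha> * \<eta>\<^sup>2 * r) * (\<Sum>i\<in>I. 2 * (?a i)\<^sup>2 * s i ^ 4) \<le>
      12 / (?\<alpha> * \<eta>\<^sup>2 * r) * (4 * real N * ((1 + real k) * (2 * pi) ^ (2 * k) * \<epsilon>2 * real N ^ (2 * k))\<^sup>2)"
  proof (rule mult_left_mono)
    have "(\<Sum>i\<in>I. 2 * (?a i)\<^sup>2 * s i ^ 4) = (\<Sum>i\<in>I. 2 * (?a i * pinsker_variance k \<epsilon>2 N (fst i))\<^sup>2)"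
      by (intro sum.cong) (auto simp: s4 power_mult_distrib)
    also have "\<dots> = 2 * (\<Sum>m\<in>?K. 2 * (sobolev_weight k m * pinsker_variance k \<epsilon>2 N m)\<^sup>2)" by (rule sum_I)
    finally show "(\<Sum>i\<in>I. 2 * (?a i)\<^sup>2 * s i ^ 4) \<le> 4 * real N * ((1 + real k) * (2 * pi) ^ (2 * k) * \<epsilon>2 * real N ^ (2 * k))\<^sup>2"
      using sum_weighted_variance_squared_upper[OF ctx] by simp
  qed (use \<alpha> r in simp)
  define U where "U = (SUP S\<in>sobolev_ball k r. robust_risk (real n) (noise_family M w z lo hi (real n)) Shat S)"
  have white: "(SUP S\<in>sobolev_ball k r. white_noise_risk M w (real n) (sqrt hi) Shat S) \<le> U"
    unfolding U_def
  proof (rule SUP_mono)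
    fix S assume "S \<in> sobolev_ball k r"
    moreover have "0 < k" using k by simp
    \<comment> \<open>As \<open>k \<ge> 1\<close>, order 0 is among the differentiable ones, so
      every signal in the ball is continuous.\<close>
    ultimately have "(deriv ^^ 0) S differentiable at t" for t
      unfolding sobolev_ball_def periodic_diff_def by blast
    then have "continuous_on A S" for A
      by (auto intro!: continuous_at_imp_continuous_on differentiable_imp_continuous_within)
    from robust_risk_ge_white_noise_risk[OF w lo Shat this]
      \<open>S \<in> sobolev_ball k r\<close>
    show "\<exists>S'\<in>sobolev_ball k r. white_noise_risk M w (real n) (sqrt hi) Shat S \<le>
      robust_risk (real n) (noise_family M w z lo hi (real n)) Shat S'" by blast
  qed
  let ?A = "2 * (\<epsilon>2 * (real N * (real k / (real k + 1) - \<eta>) - 1))"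
  let ?B = "12 / (?\<alpha> * \<eta>\<^sup>2 * r) * (4 * real N * ((1 + real k) * (2 * pi) ^ (2 * k) * \<epsilon>2 * real N ^ (2 * k))\<^sup>2)"
  have B: "?B \<ge> 0" using \<alpha> r by simp
  have "ennreal ?A \<le> ennreal (\<Sum>i\<in>I. 1 / (1 / (s i)\<^sup>2 + real n / (sqrt hi)\<^sup>2))"
    by (rule ennreal_leI[OF bayes])
  also have "\<dots> \<le> (SUP S\<in>sobolev_ball k r. white_noise_risk M w (real n) (sqrt hi) Shat S) +
    ennreal (12 / (?\<alpha> * \<eta>\<^sup>2 * r) * (\<Sum>i\<in>I. 2 * (?a i)\<^sup>2 * s i ^ 4))"
    using lo by (intro white_noise_minimax_lower_bound w n Shat I s r \<eta> \<alpha> \<alpha>a mean') auto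
  also have "\<dots> \<le> U + ennreal ?B"
    by (intro add_mono white ennreal_leI tail)
  finally have "ennreal ?A \<le> U + ennreal ?B" .
  then have "ennreal ?A - ennreal ?B \<le> U"
    by (simp add: ennreal_minus_le_iff add.commute)
  then show ?thesis
    using B by (simp add: ennreal_minus U_def \<epsilon>2_def)
qed

section \<open>Asymptotics\<close>

lemma powr_odd_root_power:
  fixes x :: real
  assumes "x > 0"
  shows "(x powr (1 / (2 * real k + 1))) ^ (2 * k + 1) = x"
    and "(x powr (1 / (2 * real k + 1))) ^ (2 * k) = x powr (2 * real k / (2 * real k + 1))"
proof -
  have pos: "x powr (1 / (2 * real k + 1)) > 0" using assms by simp
  have e: "(x powr (1 / (2 * real k + 1))) ^ m = x powr (real m / (2 * real k + 1))" for m
    unfolding powr_realpow[OF pos, symmetric] powr_powr by simp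
  have "real (2 * k + 1) / (2 * real k + 1) = 1" by (simp add: divide_simps)
  with e[of "2 * k + 1"] assms show "(x powr (1 / (2 * real k + 1))) ^ (2 * k + 1) = x"
    by (simp only: powr_one_gt_zero_iff)
  show "(x powr (1 / (2 * real k + 1))) ^ (2 * k) = x powr (2 * real k / (2 * real k + 1))"
    using e[of "2 * k"] by simp
qed

lemma floor_ratio_tendsto:
  assumes "c > 0"
  shows "((\<lambda>u. real (nat \<lfloor>c * u\<rfloor>) / u) \<longlongrightarrow> c) at_top"
proof (rule tendsto_sandwich)
  have "((\<lambda>u :: real. 1 / u) \<longlongrightarrow> 0) at_top"
    using tendsto_inverse_0_at_top[OF filterlim_ident] by (simp add: inverse_eq_divide)
  from tendsto_diff[OF tendsto_const this, of c] show "((\<lambda>u. c - 1 / u) \<longlongrightarrow> c) at_top" by simp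
  have fl: "c * u - 1 \<le> real (nat \<lfloor>c * u\<rfloor>)" "real (nat \<lfloor>c * u\<rfloor>) \<le> c * u" if "u > 0" for u
  proof -
    have "0 \<le> c * u" using assms that by simp
    then show "c * u - 1 \<le> real (nat \<lfloor>c * u\<rfloor>)" "real (nat \<lfloor>c * u\<rfloor>) \<le> c * u" by linarith+
  qed
  show "\<forall>\<^sub>F u in at_top. c - 1 / u \<le> real (nat \<lfloor>c * u\<rfloor>) / u"
    using eventually_gt_at_top[of 0]
  proof eventually_elim
    case (elim u)
    have "c - 1 / u = (c * u - 1) / u" using elim by (simp add: field_simps)
    also have "\<dots> \<le> real (nat \<lfloor>c * u\<rfloor>) / u" using fl[OF elim] elim by (intro divide_right_mono) auto
    finally show ?case .
  qed
  show "\<forall>\<^sub>F u in at_top. real (nat \<lfloor>c * u\<rfloor>) / u \<le> c"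
    using eventually_gt_at_top[of 0]
    by eventually_elim (use fl in \<open>simp add: pos_divide_le_eq\<close>)
qed simp

text \<open>The constant \<open>c\<close> in the cutoff \<open>N\<close>, the floor of
  \<open>c * u\<close>, where \<open>u ^ (2 * k + 1)\<close> is \<open>n / \<sigma>hi n\<close>. It
  solves the limiting form of the mean constraint with right-hand side
  \<open>(1 - 2 * \<eta>) * r\<close>; the second \<open>\<eta>\<close> leaves strict room below
  \<open>(1 - \<eta>) * r\<close> for finite \<open>u\<close>.\<close>

definition pinsker_scale :: "nat \<Rightarrow> real \<Rightarrow> real \<Rightarrow> real" where
  "pinsker_scale k r \<eta> =
     ((1 - 2 * \<eta>) * r * (real k + 1) * (2 * real k + 1) / (2 * real k * (2 * pi) ^ (2 * k))) powr (1 / (2 * real k + 1))"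

context
  fixes k :: nat and r \<eta> :: real
  assumes k: "k \<ge> 1" and r: "r > 0" and \<eta>: "0 < \<eta>" "\<eta> < 1 / 2"
begin

lemma pinsker_scale_pos: "pinsker_scale k r \<eta> > 0"
  using k r \<eta> by (simp add: pinsker_scale_def)

lemma pinsker_scale_power:
  "2 * ((2 * pi) ^ (2 * k) * pinsker_scale k r \<eta> ^ (2 * k + 1) * (real k / ((real k + 1) * (2 * real k + 1)))) = (1 - 2 * \<eta>) * r"
proof -
  let ?x = "(1 - 2 * \<eta>) * r * (real k + 1) * (2 * real k + 1) / (2 * real k * (2 * pi) ^ (2 * k))"
  have x: "?x > 0" using k r \<eta> by simp
  have eq: "pinsker_scale k r \<eta> ^ (2 * k + 1) = ?x"
    unfolding pinsker_scale_def by (rule powr_odd_root_power(1)) (rule x)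
  have key: "2 * (P * (b * d * e / (2 * l * P)) * (l / (d * e))) = b" if "P > 0" "d > 0" "e > 0" "l > 0" for P b d e l :: real
    using that by (simp add: field_simps)
  show ?thesis unfolding eq by (rule key) (use k in auto)
qed

lemma scale_frequency_at_top: "filterlim (\<lambda>u. real (nat \<lfloor>pinsker_scale k r \<eta> * u\<rfloor>)) at_top at_top"
proof (rule filterlim_at_top_mono)
  show "filterlim (\<lambda>u. pinsker_scale k r \<eta> * u - 1) at_top at_top"
    using pinsker_scale_pos
    by (intro filterlim_tendsto_add_at_top[of "\<lambda>_. -1" "-1", simplified] filterlim_tendsto_pos_mult_at_top[OF tendsto_const] filterlim_ident)
      (simp_all add: filterlim_ident)
  show "\<forall>\<^sub>F u in at_top. pinsker_scale k r \<eta> * u - 1 \<le> real (nat \<lfloor>pinsker_scale k r \<eta> * u\<rfloor>)"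
    by (intro always_eventually allI) linarith
qed

text \<open>The left-hand side converges to \<open>(1 - 2 * \<eta>) * r\<close>, strictly below the
  bound; \<open>1 / u ^ (2 * k + 1)\<close> stands for the squared noise level.\<close>

lemma mean_condition_eventually:
  "\<forall>\<^sub>F u in at_top. let N = nat \<lfloor>pinsker_scale k r \<eta> * u\<rfloor> in
     2 * ((1 + real k / (\<eta> * real N)) * (2 * pi) ^ (2 * k) * (1 / u ^ (2 * k + 1) * real N ^ (2 * k + 1)) *
      (real k / ((real k + 1) * (2 * real k + 1)) + 1 / real N)) \<le> (1 - \<eta>) * r"
proof -
  let ?c = "pinsker_scale k r \<eta>"
  let ?N = "\<lambda>u. real (nat \<lfloor>?c * u\<rfloor>)"
  have inv: "((\<lambda>u. 1 / ?N u) \<longlongrightarrow> 0) at_top"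
    using tendsto_inverse_0_at_top[OF scale_frequency_at_top] by (simp add: inverse_eq_divide)
  have "((\<lambda>u. 2 * ((1 + real k / \<eta> * (1 / ?N u)) * (2 * pi) ^ (2 * k) * (?N u / u) ^ (2 * k + 1) *
      (real k / ((real k + 1) * (2 * real k + 1)) + 1 / ?N u))) \<longlongrightarrow>
      2 * ((1 + real k / \<eta> * 0) * (2 * pi) ^ (2 * k) * ?c ^ (2 * k + 1) *
      (real k / ((real k + 1) * (2 * real k + 1)) + 0))) at_top"
    by (intro tendsto_intros inv floor_ratio_tendsto pinsker_scale_pos)
  moreover have "2 * ((1 + real k / \<eta> * 0) * (2 * pi) ^ (2 * k) * ?c ^ (2 * k + 1) *
      (real k / ((real k + 1) * (2 * real k + 1)) + 0)) < (1 - \<eta>) * r"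
    using pinsker_scale_power r \<eta> by simp
  ultimately have "\<forall>\<^sub>F u in at_top. 2 * ((1 + real k / \<eta> * (1 / ?N u)) * (2 * pi) ^ (2 * k) * (?N u / u) ^ (2 * k + 1) *
      (real k / ((real k + 1) * (2 * real k + 1)) + 1 / ?N u)) < (1 - \<eta>) * r"
    by (rule order_tendstoD(2))
  then show ?thesis
  proof eventually_elim
    case (elim u)
    have "(?N u / u) ^ (2 * k + 1) = 1 / u ^ (2 * k + 1) * ?N u ^ (2 * k + 1)" by (simp only: power_divide) simp
    moreover have "real k / \<eta> * (1 / ?N u) = real k / (\<eta> * ?N u)" by simp
    ultimately show ?case using elim unfolding Let_def by (simp only: less_imp_le)
  qed
qed

text \<open>After scaling, the tail is a constant times \<open>(N / u) ^ (2 * k + 1) / u\<close> and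
  vanishes, since \<open>N / u\<close> converges.\<close>

lemma scaled_bound_tendsto:
  "((\<lambda>u. let N = nat \<lfloor>pinsker_scale k r \<eta> * u\<rfloor> in
     u ^ (2 * k) * (2 * (1 / u ^ (2 * k + 1) * (real N * (real k / (real k + 1) - \<eta>) - 1)) -
      12 / ((\<eta> * real N) ^ (2 * k) * \<eta>\<^sup>2 * r) *
      (4 * real N * ((1 + real k) * (2 * pi) ^ (2 * k) * (1 / u ^ (2 * k + 1)) * real N ^ (2 * k))\<^sup>2)))
    \<longlongrightarrow> 2 * (pinsker_scale k r \<eta> * (real k / (real k + 1) - \<eta>))) at_top"
proof -
  let ?c = "pinsker_scale k r \<eta>"
  let ?N = "\<lambda>u. real (nat \<lfloor>?c * u\<rfloor>)"
  define C where "C = 48 / (\<eta> ^ (2 * k) * \<eta>\<^sup>2 * r) * ((1 + real k) * (2 * pi) ^ (2 * k))\<^sup>2"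
  have inv: "((\<lambda>u :: real. 1 / u) \<longlongrightarrow> 0) at_top"
    using tendsto_inverse_0_at_top[OF filterlim_ident] by (simp add: inverse_eq_divide)
  have "((\<lambda>u. 2 * (?N u / u * (real k / (real k + 1) - \<eta>) - 1 / u) - C * (?N u / u) ^ (2 * k + 1) * (1 / u)) \<longlongrightarrow>
    2 * (?c * (real k / (real k + 1) - \<eta>) - 0) - C * ?c ^ (2 * k + 1) * 0) at_top"
    by (intro tendsto_intros inv floor_ratio_tendsto pinsker_scale_pos)
  then have "((\<lambda>u. 2 * (?N u / u * (real k / (real k + 1) - \<eta>) - 1 / u) - C * (?N u / u) ^ (2 * k + 1) * (1 / u)) \<longlongrightarrow>
    2 * (?c * (real k / (real k + 1) - \<eta>))) at_top" by simp
  then show ?thesis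
  proof (rule Lim_transform_eventually)
    \<comment> \<open>Applied with \<open>p\<close> and \<open>q\<close> the powers
      \<open>2 * k\<close> of \<open>u\<close> and \<open>N\<close>,
      \<open>e = \<eta> ^ (2 * k)\<close> and \<open>f = \<eta>\<^sup>2\<close>; 48 is 12 times
      4.\<close>
    have alg: "p * (2 * (1 / (p * u) * (N * A - 1)) - 12 / (e * q * f * r) * (4 * N * (B * (1 / (p * u)) * q)\<^sup>2)) =
        2 * (N / u * A - 1 / u) - 48 / (e * f * r) * B\<^sup>2 * (q / p * (N / u)) * (1 / u)"
      if "p > 0" "u > 0" "N > 0" "q > 0" "e > 0" "f > 0" for p u N A e q f B :: real
      using that r by (simp add: field_simps power2_eq_square)
    have "\<forall>\<^sub>F u in at_top. 0 < ?N u" using scale_frequency_at_top[unfolded filterlim_at_top_dense] by blast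
    with eventually_gt_at_top[of 0]
    show "\<forall>\<^sub>F u in at_top. 2 * (?N u / u * (real k / (real k + 1) - \<eta>) - 1 / u) - C * (?N u / u) ^ (2 * k + 1) * (1 / u) =
      (let N = nat \<lfloor>?c * u\<rfloor> in
        u ^ (2 * k) * (2 * (1 / u ^ (2 * k + 1) * (real N * (real k / (real k + 1) - \<eta>) - 1)) -
        12 / ((\<eta> * real N) ^ (2 * k) * \<eta>\<^sup>2 * r) *
        (4 * real N * ((1 + real k) * (2 * pi) ^ (2 * k) * (1 / u ^ (2 * k + 1)) * real N ^ (2 * k))\<^sup>2)))"
    proof eventually_elim
      case (elim u)
      have e: "x ^ (2 * k + 1) = x ^ (2 * k) * x" for x :: real by simp
      show ?case
        unfolding Let_def C_def power_divide power_mult_distrib[of \<eta>] e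
        by (rule alg[symmetric]) (use elim \<eta> in auto)
    qed
  qed
qed

end

lemma pinsker_const_limit:
  assumes k: "k \<ge> 1" and r: "r > 0"
  shows "((\<lambda>\<eta>. 2 * (pinsker_scale k r \<eta> * (real k / (real k + 1) - \<eta>))) \<longlongrightarrow> pinsker_const k r) (at_right 0)"
proof -
  define p where "p = 1 / (2 * real k + 1)"
  define A where "A = real k / (real k + 1)"
  have A: "A > 0" using k by (simp add: A_def)
  have p1: "1 = p + 2 * real k * p" by (simp add: p_def field_simps)
  have "((\<lambda>\<eta>. 2 * (pinsker_scale k r \<eta> * (real k / (real k + 1) - \<eta>))) \<longlongrightarrow>
    2 * (pinsker_scale k r 0 * (real k / (real k + 1) - 0))) (at_right 0)"
    unfolding pinsker_scale_def using k r by (intro tendsto_intros) auto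
  also have "2 * (pinsker_scale k r 0 * (real k / (real k + 1) - 0)) = pinsker_const k r"
  proof -
    have "r * (real k + 1) * (2 * real k + 1) / (2 * real k * (2 * pi) ^ (2 * k)) =
      ((1 + 2 * real k) * r) * (1 / (2 * A)) * (1 / (2 * pi) powr (2 * real k))"
      using k powr_realpow[of "2 * pi" "2 * k"] by (simp add: A_def field_simps)
    then have "pinsker_scale k r 0 = (((1 + 2 * real k) * r) * (1 / (2 * A)) * (1 / (2 * pi) powr (2 * real k))) powr p"
      by (simp add: pinsker_scale_def p_def)
    also have "\<dots> = ((1 + 2 * real k) * r) powr p * (1 / (2 * A)) powr p * (1 / (2 * pi) powr (2 * real k)) powr p"
    proof -
      have "(x * y * z) powr p = x powr p * y powr p * z powr p" if "x \<ge> 0" "y \<ge> 0" "z \<ge> 0" for x y z :: real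
        using that by (simp add: powr_mult)
      then show ?thesis by this (use A r in auto)
    qed
    also have "(1 / (2 * pi) powr (2 * real k)) powr p = (2 * pi) powr (- (2 * real k * p))"
      by (simp add: powr_minus powr_powr powr_divide inverse_eq_divide)
    also have "(1 / (2 * A)) powr p = (2 * A) powr (- p)"
      using A by (simp add: powr_minus powr_divide inverse_eq_divide)
    finally have s: "pinsker_scale k r 0 = ((1 + 2 * real k) * r) powr p * (2 * A) powr (- p) * (2 * pi) powr (- (2 * real k * p))" .
    \<comment> \<open>The exponents \<open>p\<close> and \<open>2 * k * p\<close> add to 1. The
      first factor cancels the \<open>(2 * A) powr (- p)\<close> inside the scale; the second
      combines with the power of \<open>2 * pi\<close> into that of \<open>A / pi\<close>.\<close>
    have "2 * A = (2 * A) powr (p + 2 * real k * p)" using A p1 by simp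
    then have split: "2 * A = (2 * A) powr p * (2 * A) powr (2 * real k * p)" by (simp add: powr_add)
    have "2 * (x * q * y * A) = x * (q * X) * (Y * y)" if "2 * A = X * Y" for x q y X Y :: real
    proof -
      have "2 * (x * q * y * A) = 2 * A * (x * q * y)" by simp
      then show ?thesis unfolding that by (simp only: mult_ac)
    qed
    from this[OF split]
    have "2 * (pinsker_scale k r 0 * A) = ((1 + 2 * real k) * r) powr p * ((2 * A) powr (- p) * (2 * A) powr p) *
       ((2 * A) powr (2 * real k * p) * (2 * pi) powr (- (2 * real k * p)))"
      unfolding s .
    also have "(2 * A) powr (- p) * (2 * A) powr p = 1" using A by (simp flip: powr_add)
    also have "(2 * A) powr (2 * real k * p) * (2 * pi) powr (- (2 * real k * p)) = (A / pi) powr (2 * real k * p)"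
      using A by (simp add: powr_minus powr_mult powr_divide field_simps)
    finally have "2 * (pinsker_scale k r 0 * A) = ((1 + 2 * real k) * r) powr p * (A / pi) powr (2 * real k * p)" by simp
    then show ?thesis by (simp add: pinsker_const_def A_def p_def mult.commute)
  qed
  finally show ?thesis .
qed

lemma powr_at_top:
  assumes "p > 0"
  shows "filterlim (\<lambda>x :: real. x powr p) at_top at_top"
proof (subst filterlim_at_top, intro allI)
  fix Z :: real
  show "\<forall>\<^sub>F x in at_top. Z \<le> x powr p"
    using eventually_ge_at_top[of "(max Z 0) powr (1 / p)"]
  proof eventually_elim
    case (elim x)
    have "max Z 0 = (max Z 0 powr (1 / p)) powr p" using assms by (simp add: powr_powr)
    also have "\<dots> \<le> x powr p" using assms elim by (intro powr_mono2) auto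
    finally show ?case by simp
  qed
qed

theorem theorem6p1:
  fixes M :: "'w measure"
    and Levy :: "real measure"
    and w :: "real \<Rightarrow> 'w \<Rightarrow> real"
    and \<mu> :: "'w \<Rightarrow> (real \<times> real) measure"
    and z :: "real \<Rightarrow> 'w \<Rightarrow> real"
    and \<sigma>lo \<sigma>hi :: "nat \<Rightarrow> real"
    and k :: nat
    and r :: real
  assumes noise: "levy_noise M Levy w \<mu> z"
    and bounds: "\<And>n. n \<ge> 1 \<Longrightarrow> 0 < \<sigma>lo n \<and> \<sigma>lo n \<le> \<sigma>hi n"
    and lower: "\<And>\<epsilon>. \<epsilon> > 0 \<Longrightarrow> liminf (\<lambda>n. ereal (real n powr \<epsilon> * \<sigma>lo n)) > 0"
    and upper: "\<And>\<epsilon>. \<epsilon> > 0 \<Longrightarrow> (\<lambda>n. real n powr (- \<epsilon>) * \<sigma>hi n) \<longlonglongrightarrow> 0"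
    and k: "k \<ge> 1"
    and r: "r > 0"
  shows "liminf (\<lambda>n. INF Shat\<in>estimators (real n).
            ennreal ((real n / \<sigma>hi n) powr (2 * real k / (2 * real k + 1))) *
            (SUP S\<in>sobolev_ball k r.
               robust_risk (real n) (noise_family M w z (\<sigma>lo n) (\<sigma>hi n) (real n)) Shat S))
         \<ge> ennreal (pinsker_const k r)"
    (is "liminf ?f \<ge> _")
proof -
  have w: "standard_brownian_motion M w" using noise by (rule levy_noise.brownian)
  define v where "v n = real n / \<sigma>hi n" for n
  have v_pos: "v n > 0" if "n \<ge> 1" for n
    using bounds[OF that] that by (simp add: v_def)
  \<comment> \<open>\<open>upper\<close> with exponent 1 says that \<open>\<sigma>hi n / n\<close>,
    the inverse of \<open>v n\<close>, tends to 0.\<close>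
  have "filterlim (\<lambda>n. inverse (real n powr (- 1) * \<sigma>hi n)) at_top sequentially"
  proof (rule filterlim_inverse_at_top)
    show "(\<lambda>n. real n powr (- 1) * \<sigma>hi n) \<longlonglongrightarrow> 0" by (rule upper) simp
    show "\<forall>\<^sub>F n in sequentially. 0 < real n powr (- 1) * \<sigma>hi n"
      using eventually_ge_at_top[of 1]
    proof eventually_elim
      case (elim n)
      with bounds[OF elim] show ?case by (intro mult_pos_pos) auto
    qed
  qed
  moreover have "\<forall>\<^sub>F n in sequentially. inverse (real n powr (- 1) * \<sigma>hi n) = v n"
    using eventually_ge_at_top[of 1]
    by eventually_elim (simp add: v_def powr_minus divide_inverse)
  ultimately have v_top: "filterlim v at_top sequentially"
    by (rule filterlim_cong[OF refl refl, THEN iffD1, rotated])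
  \<comment> \<open>In terms of \<open>u\<close> the normalising factor is
    \<open>u ^ (2 * k)\<close> and the squared noise level is \<open>1 / u ^ (2 * k + 1)\<close>:
    only natural powers remain.\<close>
  define u where "u n = v n powr (1 / (2 * real k + 1))" for n
  have u_top: "filterlim u at_top sequentially"
    unfolding u_def by (rule filterlim_compose[OF powr_at_top v_top]) simp
  have u_pow: "u n ^ (2 * k + 1) = v n" "u n ^ (2 * k) = v n powr (2 * real k / (2 * real k + 1))" "u n > 0"
    if "n \<ge> 1" for n
  proof -
    show "u n > 0" using v_pos[OF that] by (simp add: u_def)
    show "u n ^ (2 * k + 1) = v n" "u n ^ (2 * k) = v n powr (2 * real k / (2 * real k + 1))"
      unfolding u_def by (rule powr_odd_root_power[OF v_pos[OF that]])+
  qed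
  have bound: "ennreal (2 * (pinsker_scale k r \<eta> * (real k / (real k + 1) - \<eta>))) \<le> liminf ?f"
    if \<eta>: "0 < \<eta>" "\<eta> < 1 / 2" for \<eta>
  proof -
    define N where "N x = nat \<lfloor>pinsker_scale k r \<eta> * x\<rfloor>" for x
    define h where "h x = x ^ (2 * k) * (2 * (1 / x ^ (2 * k + 1) * (real (N x) * (real k / (real k + 1) - \<eta>) - 1)) -
      12 / ((\<eta> * real (N x)) ^ (2 * k) * \<eta>\<^sup>2 * r) *
      (4 * real (N x) * ((1 + real k) * (2 * pi) ^ (2 * k) * (1 / x ^ (2 * k + 1)) * real (N x) ^ (2 * k))\<^sup>2))" for x
    have "(h \<longlongrightarrow> 2 * (pinsker_scale k r \<eta> * (real k / (real k + 1) - \<eta>))) at_top"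
      using scaled_bound_tendsto[OF k r \<eta>] by (simp add: h_def[abs_def] N_def Let_def)
    then have lim: "(\<lambda>n. ennreal (h (u n))) \<longlonglongrightarrow> ennreal (2 * (pinsker_scale k r \<eta> * (real k / (real k + 1) - \<eta>)))"
      by (intro tendsto_ennrealI filterlim_compose[OF _ u_top])
    have N_ev: "\<forall>\<^sub>F n in sequentially. real (N (u n)) \<ge> 1"
      using filterlim_compose[OF scale_frequency_at_top[OF k r \<eta>] u_top] unfolding N_def filterlim_at_top by blast
    have mean_ev: "\<forall>\<^sub>F n in sequentially. 2 * ((1 + real k / (\<eta> * real (N (u n)))) * (2 * pi) ^ (2 * k) *
      (1 / u n ^ (2 * k + 1) * real (N (u n)) ^ (2 * k + 1)) *
      (real k / ((real k + 1) * (2 * real k + 1)) + 1 / real (N (u n)))) \<le> (1 - \<eta>) * r"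
      using eventually_compose_filterlim[OF mean_condition_eventually[OF k r \<eta>] u_top] by (simp add: N_def Let_def)
    have "\<forall>\<^sub>F n in sequentially. ennreal (h (u n)) \<le> ?f n"
      using N_ev mean_ev eventually_ge_at_top[of 1]
    proof eventually_elim
      case (elim n)
      note up = u_pow[OF elim(3)]
      have hi: "\<sigma>hi n / real n = 1 / u n ^ (2 * k + 1)" unfolding up(1) v_def by simp
      \<comment> \<open>Neither the bound nor the threshold in \<open>n\<close> depends on the
        estimator, so both survive the infimum.\<close>
      show ?case
      proof (rule INF_greatest)
        fix Shat assume Shat: "Shat \<in> estimators (real n)"
        let ?U = "SUP S\<in>sobolev_ball k r. robust_risk (real n) (noise_family M w z (\<sigma>lo n) (\<sigma>hi n) (real n)) Shat S"
        have "ennreal (2 * (\<sigma>hi n / real n * (real (N (u n)) * (real k / (real k + 1) - \<eta>) - 1)) -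
            12 / ((\<eta> * real (N (u n))) ^ (2 * k) * \<eta>\<^sup>2 * r) *
            (4 * real (N (u n)) * ((1 + real k) * (2 * pi) ^ (2 * k) * (\<sigma>hi n / real n) * real (N (u n)) ^ (2 * k))\<^sup>2)) \<le> ?U"
          using k \<eta> r elim bounds[OF elim(3)] w Shat
          by (intro pinsker_lower_bound_finite) (simp_all add: hi)
        then have "ennreal (u n ^ (2 * k)) * ennreal (2 * (\<sigma>hi n / real n * (real (N (u n)) * (real k / (real k + 1) - \<eta>) - 1)) -
            12 / ((\<eta> * real (N (u n))) ^ (2 * k) * \<eta>\<^sup>2 * r) *
            (4 * real (N (u n)) * ((1 + real k) * (2 * pi) ^ (2 * k) * (\<sigma>hi n / real n) * real (N (u n)) ^ (2 * k))\<^sup>2)) \<le>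
            ennreal (u n ^ (2 * k)) * ?U"
          by (rule mult_left_mono) simp
        then have "ennreal (h (u n)) \<le> ennreal (u n ^ (2 * k)) * ?U"
          using up(3) unfolding h_def hi by (subst ennreal_mult') auto
        then show "ennreal (h (u n)) \<le> ennreal ((real n / \<sigma>hi n) powr (2 * real k / (2 * real k + 1))) * ?U"
          unfolding up(2) v_def .
      qed
    qed
    from Liminf_mono[OF this] show ?thesis
      using lim_imp_Liminf[OF _ lim] by simp
  qed
  show ?thesis
  \<comment> \<open>\<open>n\<close> goes to infinity first, at fixed \<open>\<eta>\<close>; only
    then does \<open>\<eta>\<close> tend to 0.\<close>
  proof (rule tendsto_upperbound)
    show "((\<lambda>\<eta>. ennreal (2 * (pinsker_scale k r \<eta> * (real k / (real k + 1) - \<eta>)))) \<longlongrightarrow> ennreal (pinsker_const k r)) (at_right 0)"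
      by (intro tendsto_ennrealI pinsker_const_limit k r)
    show "\<forall>\<^sub>F \<eta> in at_right 0. ennreal (2 * (pinsker_scale k r \<eta> * (real k / (real k + 1) - \<eta>))) \<le> liminf ?f"
      unfolding eventually_at_right_field using bound by (intro exI[of _ "1 / 2"]) auto
  qed simp
qed

end
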